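(* Let $p$ be an odd prime and let $J_p=k^{S_{p-1}}\#kC_p$ be the bismash product associated with the factorization $S_p=C_pS_{p-1}$, with $F=C_p$ and $G=S_{p-1}$. Let $m_{p,1}$ be the number of $F$-orbits $\mathcal{O}_x\subset G$ (under $\lhd$) such that the stabilizer $F_x$ is trivial and $\mathcal{O}_x$ contains an element of order $2$, and let $m_{p,0}$ be the number of $F$-orbits $\mathcal{O}_x\subset G$ such that $F_x$ is trivial and $\mathcal{O}_x$ contains no element of order $2$. Let $i_p=|\{w\in S_p : w^2=1\}|$. Then: (1) $m_{p,1}=\dfrac{i_p-1}{p}-1$, and (2) $m_{p,0}+m_{p,1}=(p-1)\dfrac{(p-2)!-1}{p}$. Thus, counting simple modules up to isomorphism, $J_p$ has $p(p-1)$ simple modules of dimension $1$, with exactly $p+1$ of them having Frobenius-Schur indicator $+1$ and the others having indicator $0$. All other simple $J_p$-modules have dimension $p$: there are $(p-1)\dfrac{(p-2)!-1}{p}$ of these altogether, of which $m_{p,1}$ have indicator $+1$ and the rest have indicator $0$.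
   Context: $k$ is an algebraically closed field of characteristic $0$. All groups are finite. Factorizations: a group $L$ is factorizable into subgroups $F,G$ if every element of $L$ can be written uniquely as $ax$ with $a\in F$, $x\in G$. For $x\in G$, $a\in F$ let $x\rhd a\in F$ and $x\lhd a\in G$ be the unique elements with $xa=(x\rhd a)(x\lhd a)$ in $L$. Then $\rhd$ is a left action of $G$ on the set $F$ and $\lhd$ is a right action of $F$ on the set $G$. For $x\in G$, $\mathcal{O}_x$ denotes the $F$-orbit of $x$ under $\lhd$ and $F_x=\{a\in F : x\lhd a=x\}$. Bismash product: $H=k^G\#kF$ is the Hopf algebra with basis $\{p_x\#a : x\in G, a\in F\}$ (where $\{p_x\}$ is the basis of the dual algebra $k^G$ dual to the elements of $G$), product $(p_x\#a)(p_y\#b)=\delta_{y,\,x\lhd a}\,p_x\#ab$, comultiplication $\Delta(p_x\#a)=\sum_{y\in G}p_{xy^{-1}}\#(y\rhd a)\otimes p_y\#a$, counit $\epsilon(p_x\#a)=\delta_{x,1}$, and antipode $\alpha(p_x\#a)=p_{(x\lhd a)^{-1}}\#(x\rhd a)^{-1}$. It is semisimple. The factorization of $S_n$ (here $n=p$): $S_{n-1}\subset S_n$ is the subgroup of permutations fixing $n$, and $C_n$ is the subgroup generated by the $n$-cycle $(1,2,\ldots,n)$. Permutations are composed as functions, right to left. $S_n$ is factorizable into $F=C_n$ and $G=S_{n-1}$. Frobenius-Schur indicator: for a semisimple Hopf algebra $H$ over $k$, let $\Lambda\in H$ be the unique integral with $\epsilon(\Lambda)=1$, and write $\Delta(\Lambda)=\sum\Lambda_1\otimes\Lambda_2$.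 The indicator of a simple $H$-module with character $\chi$ is $\nu(\chi)=\chi\left(\sum\Lambda_1\Lambda_2\right)$. *)

theory Defs
  imports
    "HOL-Algebra.Sym_Groups"
    "HOL-Algebra.Multiplicative_Group"
    "HOL-Algebra.Generated_Groups"
    "HOL-Computational_Algebra.Primes"
    "Jordan_Normal_Form.VS_Connect"
begin

section \<open>Factorizable groups\<close>

text \<open>
  Throughout, \<open>L\<close> is a group that is factorizable into its subgroups \<open>F\<close> and \<open>G\<close>: every element
  of \<open>L\<close> is \<open>a x\<close> for a unique \<open>a \<in> F\<close> and a unique \<open>x \<in> G\<close>. The two actions are the
  \<open>F\<close>-part and the \<open>G\<close>-part of \<open>x a\<close>, for \<open>x \<in> G\<close> and \<open>a \<in> F\<close>.
\<close>

definition lact :: "('a, 'm) monoid_scheme \<Rightarrow> 'a set \<Rightarrow> 'a set \<Rightarrow> 'a \<Rightarrow> 'a \<Rightarrow> 'a" where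
  "lact L F G x a = (THE b. b \<in> F \<and> (\<exists>y\<in>G. x \<otimes>\<^bsub>L\<^esub> a = b \<otimes>\<^bsub>L\<^esub> y))"

definition ract :: "('a, 'm) monoid_scheme \<Rightarrow> 'a set \<Rightarrow> 'a set \<Rightarrow> 'a \<Rightarrow> 'a \<Rightarrow> 'a" where
  "ract L F G x a = (THE y. y \<in> G \<and> (\<exists>b\<in>F. x \<otimes>\<^bsub>L\<^esub> a = b \<otimes>\<^bsub>L\<^esub> y))"

definition ract_orbit :: "('a, 'm) monoid_scheme \<Rightarrow> 'a set \<Rightarrow> 'a set \<Rightarrow> 'a \<Rightarrow> 'a set" where
  "ract_orbit L F G x = {ract L F G x a | a. a \<in> F}"

definition ract_stabilizer :: "('a, 'm) monoid_scheme \<Rightarrow> 'a set \<Rightarrow> 'a set \<Rightarrow> 'a \<Rightarrow> 'a set" where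
  "ract_stabilizer L F G x = {a \<in> F. ract L F G x a = x}"

definition free_orbits :: "('a, 'm) monoid_scheme \<Rightarrow> 'a set \<Rightarrow> 'a set \<Rightarrow> 'a set set" where
  "free_orbits L F G =
     {ract_orbit L F G x | x. x \<in> G \<and> ract_stabilizer L F G x = {\<one>\<^bsub>L\<^esub>}}"


section \<open>Algebras and Hopf algebras with a finite basis\<close>

text \<open>
  An element of a \<open>k\<close>-space with finite basis \<open>B\<close> is given by its coordinates, a function that
  vanishes outside \<open>B\<close>; scalars act pointwise, and the tensor square has basis \<open>B \<times> B\<close>.
\<close>

definition bvec :: "'b \<Rightarrow> 'b \<Rightarrow> 'k::field" where
  "bvec u = (\<lambda>v. if v = u then 1 else 0)"

definition lin_ext :: "'b set \<Rightarrow> ('b \<Rightarrow> 'c \<Rightarrow> 'k::field) \<Rightarrow> ('b \<Rightarrow> 'k) \<Rightarrow> 'c \<Rightarrow> 'k" where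
  "lin_ext B f h = (\<lambda>w. \<Sum>u\<in>B. h u * f u w)"

record ('b, 'k) based_hopf = "('b \<Rightarrow> 'k) ring" +
  base :: "'b set"
  comult :: "('b \<Rightarrow> 'k) \<Rightarrow> ('b \<times> 'b \<Rightarrow> 'k)"
  counit :: "('b \<Rightarrow> 'k) \<Rightarrow> 'k"
  antipode :: "('b \<Rightarrow> 'k) \<Rightarrow> ('b \<Rightarrow> 'k)"

text \<open>The pair \<open>(x, a)\<close> stands for the basis element \<open>p\<^sub>x # a\<close>.\<close>

definition bismash :: "('a, 'm) monoid_scheme \<Rightarrow> 'a set \<Rightarrow> 'a set \<Rightarrow> ('a \<times> 'a, 'k::field) based_hopf" where
  "bismash L F G =
     \<lparr> carrier = {h. \<forall>u. u \<notin> G \<times> F \<longrightarrow> h u = 0},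
       mult = (\<lambda>h h'. lin_ext (G \<times> F) (\<lambda>(x, a). lin_ext (G \<times> F)
         (\<lambda>(y, b). if y = ract L F G x a then bvec (x, a \<otimes>\<^bsub>L\<^esub> b) else (\<lambda>_. 0)) h') h),
       one = (\<lambda>u. \<Sum>x\<in>G. bvec (x, \<one>\<^bsub>L\<^esub>) u),
       zero = (\<lambda>_. 0),
       add = (\<lambda>h h' u. h u + h' u),
       base = G \<times> F,
       comult = lin_ext (G \<times> F) (\<lambda>(x, a) t.
         \<Sum>y\<in>G. bvec ((x \<otimes>\<^bsub>L\<^esub> inv\<^bsub>L\<^esub> y, lact L F G y a), (y, a)) t),
       counit = (\<lambda>h. \<Sum>(x, a)\<in>G \<times> F. h (x, a) * (if x = \<one>\<^bsub>L\<^esub> then 1 else 0)),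
       antipode = lin_ext (G \<times> F) (\<lambda>(x, a).
         bvec (inv\<^bsub>L\<^esub> (ract L F G x a), inv\<^bsub>L\<^esub> (lact L F G x a))) \<rparr>"

definition tensor_mult :: "('b, 'k::field) based_hopf \<Rightarrow> ('b \<times> 'b \<Rightarrow> 'k) \<Rightarrow> ('b \<Rightarrow> 'k)" where
  "tensor_mult H = lin_ext (base H \<times> base H) (\<lambda>(u, v). bvec u \<otimes>\<^bsub>H\<^esub> bvec v)"

definition integral_elt :: "('b, 'k::field) based_hopf \<Rightarrow> ('b \<Rightarrow> 'k) \<Rightarrow> bool" where
  "integral_elt H \<Lambda> \<longleftrightarrow> \<Lambda> \<in> carrier H \<and>
     (\<forall>h\<in>carrier H. h \<otimes>\<^bsub>H\<^esub> \<Lambda> = (\<lambda>u. counit H h * \<Lambda> u) \<and> \<Lambda> \<otimes>\<^bsub>H\<^esub> h = (\<lambda>u. counit H h * \<Lambda> u))"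

definition normalized_integral :: "('b, 'k::field) based_hopf \<Rightarrow> ('b \<Rightarrow> 'k)" where
  "normalized_integral H = (THE \<Lambda>. integral_elt H \<Lambda> \<and> counit H \<Lambda> = 1)"


section \<open>Modules over a noncommutative algebra\<close>

text \<open>The axioms are those of the locale \<open>module\<close>, except that the ring need not be commutative.\<close>

locale left_module = R?: ring R + M?: abelian_group M
  for R :: "('r, 'n) ring_scheme" (structure) and M :: "('r, 'v, 'm) module_scheme" (structure) +
  assumes smult_closed: "\<lbrakk>a \<in> carrier R; x \<in> carrier M\<rbrakk> \<Longrightarrow> a \<odot>\<^bsub>M\<^esub> x \<in> carrier M"
    and smult_l_distr: "\<lbrakk>a \<in> carrier R; b \<in> carrier R; x \<in> carrier M\<rbrakk> \<Longrightarrow>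
      (a \<oplus>\<^bsub>R\<^esub> b) \<odot>\<^bsub>M\<^esub> x = a \<odot>\<^bsub>M\<^esub> x \<oplus>\<^bsub>M\<^esub> b \<odot>\<^bsub>M\<^esub> x"
    and smult_r_distr: "\<lbrakk>a \<in> carrier R; x \<in> carrier M; y \<in> carrier M\<rbrakk> \<Longrightarrow>
      a \<odot>\<^bsub>M\<^esub> (x \<oplus>\<^bsub>M\<^esub> y) = a \<odot>\<^bsub>M\<^esub> x \<oplus>\<^bsub>M\<^esub> a \<odot>\<^bsub>M\<^esub> y"
    and smult_assoc1: "\<lbrakk>a \<in> carrier R; b \<in> carrier R; x \<in> carrier M\<rbrakk> \<Longrightarrow>
      (a \<otimes>\<^bsub>R\<^esub> b) \<odot>\<^bsub>M\<^esub> x = a \<odot>\<^bsub>M\<^esub> (b \<odot>\<^bsub>M\<^esub> x)"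
    and smult_one: "x \<in> carrier M \<Longrightarrow> \<one>\<^bsub>R\<^esub> \<odot>\<^bsub>M\<^esub> x = x"

text \<open>
  A simple module is nonzero and has no submodules besides \<open>0\<close> and itself. Its elements range over a
  type \<open>'v\<close>, so isomorphism classes can only be counted for \<open>'v\<close> large enough. The scalar multiples of
  a nonzero vector already embed \<open>k\<close> into \<open>'v\<close>, and such an embedding suffices, as \<open>k\<close> is infinite and
  simple modules over a finite-dimensional algebra are finite-dimensional.
\<close>

definition simple_modules :: "('r, 'n) ring_scheme \<Rightarrow> ('r, 'v) module set" where
  "simple_modules R = {M. left_module R M \<and> carrier M \<noteq> {\<zero>\<^bsub>M\<^esub>} \<and>
     (\<forall>N. Module.submodule N R M \<longrightarrow> N = {\<zero>\<^bsub>M\<^esub>} \<or> N = carrier M)}"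

definition module_iso :: "('r, 'n) ring_scheme \<Rightarrow> (('r, 'v) module \<times> ('r, 'v) module) set" where
  "module_iso R = {(M, N). left_module R M \<and> left_module R N \<and>
     (\<exists>f\<in>module_hom R M N. bij_betw f (carrier M) (carrier N))}"

text \<open>The underlying \<open>k\<close>-space of a module: \<open>c \<in> k\<close> acts as \<open>c 1\<^sub>H \<in> H\<close>.\<close>

definition underlying_space ::
    "('b, 'k::field) based_hopf \<Rightarrow> ('b \<Rightarrow> 'k, 'v) module \<Rightarrow> ('k, 'v) module" where
  "underlying_space H M =
     \<lparr> carrier = carrier M, mult = mult M, one = one M, zero = zero M, add = add M,
       smult = (\<lambda>c v. (\<lambda>u. c * \<one>\<^bsub>H\<^esub> u) \<odot>\<^bsub>M\<^esub> v) \<rparr>"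

definition has_dim :: "('b, 'k::field) based_hopf \<Rightarrow> ('b \<Rightarrow> 'k, 'v) module \<Rightarrow> nat \<Rightarrow> bool" where
  "has_dim H M d \<longleftrightarrow> vectorspace.fin_dim class_ring (underlying_space H M) \<and>
     vectorspace.dim class_ring (underlying_space H M) = d"

text \<open>Trace of an endomorphism of a finite-dimensional space: the sum, over the elements \<open>b\<close> of a
  basis, of the \<open>b\<close>-coordinate of the image of \<open>b\<close>.\<close>

definition coord :: "('k::field, 'v) module \<Rightarrow> 'v set \<Rightarrow> 'v \<Rightarrow> 'v \<Rightarrow> 'k" where
  "coord V B v = (SOME c. module.lincomb V c B = v)"

definition lin_trace :: "('k::field, 'v) module \<Rightarrow> ('v \<Rightarrow> 'v) \<Rightarrow> 'k" where
  "lin_trace V f =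
     (let B = (SOME B. finite B \<and> vectorspace.basis class_ring V B) in \<Sum>b\<in>B. coord V B (f b) b)"

definition character :: "('b, 'k::field) based_hopf \<Rightarrow> ('b \<Rightarrow> 'k, 'v) module \<Rightarrow> ('b \<Rightarrow> 'k) \<Rightarrow> 'k" where
  "character H M h = lin_trace (underlying_space H M) (\<lambda>v. h \<odot>\<^bsub>M\<^esub> v)"

definition indicator_FS :: "('b, 'k::field) based_hopf \<Rightarrow> ('b \<Rightarrow> 'k, 'v) module \<Rightarrow> 'k" where
  "indicator_FS H M = character H M (tensor_mult H (comult H (normalized_integral H)))"


section \<open>The factorization of the symmetric group\<close>

definition cyc_sub :: "nat \<Rightarrow> (nat \<Rightarrow> nat) set" where
  "cyc_sub n = generate (sym_group n) {cycle_of_list [1..<Suc n]}"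

definition point_stab :: "nat \<Rightarrow> (nat \<Rightarrow> nat) set" where
  "point_stab n = {g \<in> carrier (sym_group n). g n = n}"

definition J_hopf :: "nat \<Rightarrow> ((nat \<Rightarrow> nat) \<times> (nat \<Rightarrow> nat), 'k::field) based_hopf" where
  "J_hopf n = bismash (sym_group n) (cyc_sub n) (point_stab n)"

definition m1 :: "nat \<Rightarrow> nat" where
  "m1 n = card {O' \<in> free_orbits (sym_group n) (cyc_sub n) (point_stab n).
     \<exists>y\<in>O'. group.ord (sym_group n) y = 2}"

definition m0 :: "nat \<Rightarrow> nat" where
  "m0 n = card {O' \<in> free_orbits (sym_group n) (cyc_sub n) (point_stab n).
     \<not> (\<exists>y\<in>O'. group.ord (sym_group n) y = 2)}"

definition i_num :: "nat \<Rightarrow> nat" where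
  "i_num n = card {w \<in> carrier (sym_group n). w \<otimes>\<^bsub>sym_group n\<^esub> w = \<one>\<^bsub>sym_group n\<^esub>}"

definition num_iso :: "('r, 'n) ring_scheme \<Rightarrow> ('r, 'v) module set \<Rightarrow> nat" where
  "num_iso R S = card (S // module_iso R)"

end

theory Submission
  imports Defs "HOL-Number_Theory.Cong"
begin

text \<open>
  For an orbit \<open>X\<close> of \<open>F\<close> on \<open>G\<close> and a character \<open>\<rho>\<close> of \<open>F\<close> the bismash product \<open>J\<close> has a simple module
  \<open>M(X, \<rho>)\<close> of dimension \<open>|X|\<close>, which occurs as a left ideal of \<open>J\<close>. When \<open>F\<close> has prime order \<open>p\<close>, all
  stabilizers are trivial or equal to \<open>F\<close>, and these left ideals span \<open>J\<close>: each \<open>p\<^sub>x # 1\<close> is itself in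
  one of them if the stabilizer of \<open>x\<close> is trivial, and is a sum over the characters of \<open>F\<close> otherwise.
  So by Schur's lemma the simple modules are the \<open>M({x}, \<rho>)\<close> for \<open>x\<close> normalizing \<open>F\<close> and the
  \<open>M(X, 1)\<close> for the free orbits \<open>X\<close>.

  Taking the trace of \<open>\<Sum>\<Lambda>\<^sub>1 \<Lambda>\<^sub>2\<close> on \<open>M(X, 1)\<close> for a free \<open>X\<close> counts the \<open>y \<in> X\<close> whose inverse lies in
  \<open>X\<close>, divided by \<open>p\<close>. Inversion permutes the orbits, and on an orbit that it preserves it has a fixed
  point because \<open>p\<close> is odd; so the indicator is \<open>1\<close> or \<open>0\<close> according to whether \<open>X\<close> contains an element
  of order \<open>2\<close>. Writing the elements of \<open>L\<close> as \<open>a y\<close>, the same count over all orbits gives the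
  number of solutions of \<open>w\<^sup>2 = 1\<close>. In \<open>S\<^sub>p\<close> the elements of \<open>G\<close> that normalize \<open>F = C\<^sub>p\<close> are the
  \<open>p - 1\<close> maps \<open>i \<mapsto> v i\<close> mod \<open>p\<close>, of which only \<open>v = \<plusminus>1\<close> square to \<open>1\<close>.
\<close>

section \<open>Simple modules up to isomorphism\<close>

text \<open>Two features of the definitions shape the proof. \<open>module_iso\<close> compares
  modules over one type \<open>'v\<close>, whereas the models are functions on an orbit; hence the
  relation \<open>module_isomorphic\<close> between different types, and the transport of models
  into \<open>'v\<close> along an injection made from \<open>emb\<close>. And
  \<open>lin_trace\<close> refers to an arbitrarily chosen basis, so trace and dimension are
  computed once for every space linearly parametrized by the functions on a finite set.

  The count of square roots of 1 runs as follows. For w = a y, the equation w w = 1 says that y a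
  has G-part inv y and F-part inv a. On a free orbit closed under inversion, the first condition
  determines a and implies the second, so the orbit contributes p solutions. For y fixed by F the
  first condition is inv y = y and does not involve a: y = 1 contributes only a = 1, and y = \<tau>,
  the map i -> -i, inverts every a and contributes all p. This is i_p = p m1 + 1 + p. The same
  \<tau> accounts for p of the p + 1 one-dimensional modules of indicator 1; the last one is the
  trivial character at y = 1.\<close>

definition module_isomorphic ::
    "('r, 'n) ring_scheme \<Rightarrow> ('r, 'v) module \<Rightarrow> ('r, 'w) module \<Rightarrow> bool" where
  "module_isomorphic R M N \<longleftrightarrow> left_module R M \<and> left_module R N \<and>
     (\<exists>f\<in>module_hom R M N. bij_betw f (carrier M) (carrier N))"

lemma module_iso_iff: "(M, N) \<in> module_iso R \<longleftrightarrow> module_isomorphic R M N"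
  by (simp add: module_iso_def module_isomorphic_def)

lemma module_homI:
  assumes "\<And>x. x \<in> carrier M \<Longrightarrow> f x \<in> carrier N"
    and "\<And>x y. x \<in> carrier M \<Longrightarrow> y \<in> carrier M \<Longrightarrow> f (x \<oplus>\<^bsub>M\<^esub> y) = f x \<oplus>\<^bsub>N\<^esub> f y"
    and "\<And>r x. r \<in> carrier R \<Longrightarrow> x \<in> carrier M \<Longrightarrow> f (r \<odot>\<^bsub>M\<^esub> x) = r \<odot>\<^bsub>N\<^esub> f x"
  shows "f \<in> module_hom R M N"
  using assms unfolding module_hom_def by blast

lemma module_hom_inv_into:
  assumes M: "left_module R M" and f: "f \<in> module_hom R M N"
    and b: "bij_betw f (carrier M) (carrier N)"
  shows "inv_into (carrier M) f \<in> module_hom R N M"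
proof -
  interpret left_module R M by (rule M)
  let ?g = "inv_into (carrier M) f"
  have gc: "?g y \<in> carrier M" and fg: "f (?g y) = y" if "y \<in> carrier N" for y
    using b that by (auto simp: bij_betw_def inv_into_into f_inv_into_f)
  have gf: "?g (f x) = x" if "x \<in> carrier M" for x
    using b that by (simp add: bij_betw_def)
  show ?thesis
  proof (rule module_homI)
    fix x y assume "x \<in> carrier N" "y \<in> carrier N"
    then show "?g (x \<oplus>\<^bsub>N\<^esub> y) = ?g x \<oplus>\<^bsub>M\<^esub> ?g y"
      using gf[of "?g x \<oplus>\<^bsub>M\<^esub> ?g y"] gc fg module_hom_add[OF f, of "?g x" "?g y"] by simp
  next
    fix r x assume "r \<in> carrier R" "x \<in> carrier N"
    then show "?g (r \<odot>\<^bsub>N\<^esub> x) = r \<odot>\<^bsub>M\<^esub> ?g x"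
      using gf[of "r \<odot>\<^bsub>M\<^esub> ?g x"] gc fg module_hom_smult[OF f, of r "?g x"] smult_closed by simp
  qed (rule gc)
qed

lemma module_hom_comp:
  assumes "f \<in> module_hom R M N" and "g \<in> module_hom R N P"
  shows "g \<circ> f \<in> module_hom R M P"
  using assms unfolding module_hom_def Pi_def by auto

lemma module_isomorphic_sym:
  assumes "module_isomorphic R M N" shows "module_isomorphic R N M"
  using assms module_hom_inv_into bij_betw_inv_into unfolding module_isomorphic_def by blast

lemma module_isomorphic_trans:
  assumes "module_isomorphic R M N" and "module_isomorphic R N P"
  shows "module_isomorphic R M P"
  using assms module_hom_comp bij_betw_trans unfolding module_isomorphic_def by metis

lemma module_hom_group_hom:
  assumes "left_module R M" and "left_module R N" and f: "f \<in> module_hom R M N"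
  shows "group_hom (add_monoid M) (add_monoid N) f"
proof -
  interpret M: left_module R M by fact
  interpret N: left_module R N by fact
  show ?thesis
    using module_hom_closed[OF f] module_hom_add[OF f]
    by (intro group_hom.intro group_hom_axioms.intro M.a_group N.a_group) (auto simp: hom_def)
qed

lemma module_hom_zero:
  assumes "left_module R M" and "left_module R N" and "f \<in> module_hom R M N"
  shows "f \<zero>\<^bsub>M\<^esub> = \<zero>\<^bsub>N\<^esub>"
  using group_hom.hom_one[OF module_hom_group_hom[OF assms]] by simp

lemma (in left_module) smult_zero: "a \<in> carrier R \<Longrightarrow> a \<odot>\<^bsub>M\<^esub> \<zero>\<^bsub>M\<^esub> = \<zero>\<^bsub>M\<^esub>"
  using smult_r_distr[of a "\<zero>\<^bsub>M\<^esub>" "\<zero>\<^bsub>M\<^esub>"] smult_closed[of a "\<zero>\<^bsub>M\<^esub>"] M.add.l_cancel_one by force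

lemma (in left_module) zero_smult: "x \<in> carrier M \<Longrightarrow> \<zero>\<^bsub>R\<^esub> \<odot>\<^bsub>M\<^esub> x = \<zero>\<^bsub>M\<^esub>"
  using smult_l_distr[of "\<zero>\<^bsub>R\<^esub>" "\<zero>\<^bsub>R\<^esub>" x] smult_closed[of "\<zero>\<^bsub>R\<^esub>" x] M.add.l_cancel_one by force

lemma submodule_image:
  assumes M: "left_module R M" and N: "left_module R N" and f: "f \<in> module_hom R M N"
    and K: "Module.submodule K R M"
  shows "Module.submodule (f ` K) R N"
proof -
  interpret f: group_hom "add_monoid M" "add_monoid N" f by (rule module_hom_group_hom[OF M N f])
  interpret K: Module.submodule K R M by (rule K)
  have sub: "subgroup (f ` K) (add_monoid N)"
    using f.subgroup_img_is_subgroup K.subgroup_axioms by blast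
  show ?thesis
  proof (intro Module.submodule.intro sub Module.submodule_axioms.intro)
    fix a x assume a: "a \<in> carrier R" and "x \<in> f ` K"
    then obtain y where y: "y \<in> K" "x = f y" by blast
    moreover from this K.subset have "y \<in> carrier M" by auto
    ultimately show "a \<odot>\<^bsub>N\<^esub> x \<in> f ` K"
      using module_hom_smult[OF f a, of y] K.smult_closed[OF a, of y] by (metis imageI)
  qed
qed

lemma submodule_carrier:
  assumes "left_module R M" shows "Module.submodule (carrier M) R M"
proof -
  interpret left_module R M by fact
  show ?thesis
    using group.subgroup_self[OF M.a_group] smult_closed
    by (intro Module.submodule.intro Module.submodule_axioms.intro) auto
qed

lemma submodule_kernel:
  assumes M: "left_module R M" and N: "left_module R N" and f: "f \<in> module_hom R M N"
  shows "Module.submodule {x \<in> carrier M. f x = \<zero>\<^bsub>N\<^esub>} R M"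
proof -
  interpret f: group_hom "add_monoid M" "add_monoid N" f by (rule module_hom_group_hom[OF M N f])
  interpret M: left_module R M by (rule M)
  interpret N: left_module R N by (rule N)
  have sub: "subgroup {x \<in> carrier M. f x = \<zero>\<^bsub>N\<^esub>} (add_monoid M)"
    using f.subgroup_kernel by (simp add: kernel_def)
  show ?thesis
    using module_hom_smult[OF f] M.smult_closed N.smult_zero
    by (intro Module.submodule.intro sub Module.submodule_axioms.intro) auto
qed

lemma simple_modulesD:
  assumes "M \<in> simple_modules R"
  shows "left_module R M" and "carrier M \<noteq> {\<zero>\<^bsub>M\<^esub>}"
    and "Module.submodule N R M \<Longrightarrow> N = {\<zero>\<^bsub>M\<^esub>} \<or> N = carrier M"
  using assms unfolding simple_modules_def by blast+

text \<open>The kernel misses x, hence is zero; the image contains f x, hence is everything.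
  Nonvanishing at a single point is the form in which the left ideals of J supply such an f.\<close>

lemma schur:
  assumes M: "M \<in> simple_modules R" and N: "N \<in> simple_modules R"
    and f: "f \<in> module_hom R M N" and x: "x \<in> carrier M" "f x \<noteq> \<zero>\<^bsub>N\<^esub>"
  shows "module_isomorphic R M N"
proof -
  note lm = simple_modulesD(1)[OF M] simple_modulesD(1)[OF N]
  interpret f: group_hom "add_monoid M" "add_monoid N" f by (rule module_hom_group_hom[OF lm f])
  have "{y \<in> carrier M. f y = \<zero>\<^bsub>N\<^esub>} = {\<zero>\<^bsub>M\<^esub>}"
    using simple_modulesD(3)[OF M submodule_kernel[OF lm f]] x by blast
  then have "inj_on f (carrier M)"
    using f.inj_iff_trivial_ker by (simp add: kernel_def)
  moreover have "f ` carrier M = carrier N"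
    using simple_modulesD(3)[OF N submodule_image[OF lm f submodule_carrier[OF lm(1)]]] x by blast
  ultimately show ?thesis
    using lm f unfolding module_isomorphic_def bij_betw_def by blast
qed

text \<open>A submodule of N is pulled back along the inverse isomorphism. Since the types may
  differ, this makes a transported model a member of the set that is counted.\<close>

lemma module_isomorphic_simple:
  assumes M: "M \<in> simple_modules R" and "module_isomorphic R M N"
  shows "N \<in> simple_modules R"
proof -
  from assms(2) obtain f where lm: "left_module R M" "left_module R N"
    and f: "f \<in> module_hom R M N" and b: "bij_betw f (carrier M) (carrier N)"
    unfolding module_isomorphic_def by blast
  let ?g = "inv_into (carrier M) f"
  note g = module_hom_inv_into[OF lm(1) f b]
  note z = module_hom_zero[OF lm f]
  have zM: "\<zero>\<^bsub>M\<^esub> \<in> carrier M"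
  proof -
    interpret left_module R M by (rule lm)
    show ?thesis by simp
  qed
  have "carrier N \<noteq> {\<zero>\<^bsub>N\<^esub>}"
  proof
    assume "carrier N = {\<zero>\<^bsub>N\<^esub>}"
    then have "x = \<zero>\<^bsub>M\<^esub>" if "x \<in> carrier M" for x
      using inj_onD[OF bij_betw_imp_inj_on[OF b], of x "\<zero>\<^bsub>M\<^esub>"] bij_betwE[OF b] that zM z by simp
    with zM have "carrier M = {\<zero>\<^bsub>M\<^esub>}" by blast
    with simple_modulesD(2)[OF M] show False by simp
  qed
  moreover have "K = {\<zero>\<^bsub>N\<^esub>} \<or> K = carrier N" if K: "Module.submodule K R N" for K
  proof -
    interpret K: Module.submodule K R N by (rule K)
    have "K \<subseteq> f ` carrier M" using K.subset b by (simp add: bij_betw_def)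
    then have fgK: "f ` ?g ` K = K" by (rule image_inv_into_cancel[OF refl])
    have "?g ` K = {\<zero>\<^bsub>M\<^esub>} \<or> ?g ` K = carrier M"
      using simple_modulesD(3)[OF M submodule_image[OF lm(2,1) g K]] .
    then show ?thesis
    proof
      assume "?g ` K = {\<zero>\<^bsub>M\<^esub>}"
      with fgK z show ?thesis by simp
    next
      assume "?g ` K = carrier M"
      with fgK b show ?thesis by (simp add: bij_betw_def)
    qed
  qed
  ultimately show ?thesis using lm(2) unfolding simple_modules_def by blast
qed

section \<open>Transport of modules to another type, and the count of isomorphism classes\<close>

definition transport :: "('v \<Rightarrow> 'w) \<Rightarrow> ('r, 'v) module \<Rightarrow> ('r, 'w) module" where
  "transport e M = (let d = inv_into (carrier M) e in
     \<lparr> carrier = e ` carrier M, mult = (\<lambda>x y. e (d x)), one = e \<zero>\<^bsub>M\<^esub>, zero = e \<zero>\<^bsub>M\<^esub>,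
       add = (\<lambda>x y. e (d x \<oplus>\<^bsub>M\<^esub> d y)), smult = (\<lambda>r x. e (r \<odot>\<^bsub>M\<^esub> d x)) \<rparr>)"

lemma module_isomorphic_transport:
  fixes M :: "('r, 'v) module" and e :: "'v \<Rightarrow> 'w"
  assumes M: "left_module R M" and e: "inj_on e (carrier M)"
  shows "module_isomorphic R M (transport e M)"
proof -
  interpret M: left_module R M by (rule M)
  let ?N = "transport e M"
  have d: "inv_into (carrier M) e (e x) = x" if "x \<in> carrier M" for x
    using e that by simp
  have N: "carrier ?N = e ` carrier M" "\<zero>\<^bsub>?N\<^esub> = e \<zero>\<^bsub>M\<^esub>"
    by (simp_all add: transport_def Let_def)
  have Nadd: "e x \<oplus>\<^bsub>?N\<^esub> e y = e (x \<oplus>\<^bsub>M\<^esub> y)" if "x \<in> carrier M" "y \<in> carrier M" for x y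
    using that by (simp add: transport_def Let_def d)
  have Nsm: "r \<odot>\<^bsub>?N\<^esub> e x = e (r \<odot>\<^bsub>M\<^esub> x)" if "x \<in> carrier M" for r x
    using that by (simp add: transport_def Let_def d)
  have ab: "abelian_group ?N"
  proof (rule abelian_groupI)
    fix x assume "x \<in> carrier ?N"
    then obtain x' where x': "x' \<in> carrier M" "x = e x'" by (auto simp: N)
    show "\<exists>y\<in>carrier ?N. y \<oplus>\<^bsub>?N\<^esub> x = \<zero>\<^bsub>?N\<^esub>"
      using x' by (intro bexI[of _ "e (\<ominus>\<^bsub>M\<^esub> x')"]) (auto simp: N Nadd M.l_neg)
  qed (auto simp: N Nadd M.a_ac)
  have lmN: "left_module R ?N"
  proof (intro left_module.intro left_module_axioms.intro ab)
    show "ring R" by (rule M.R.ring_axioms)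
  qed (auto simp: N Nadd Nsm M.smult_closed M.smult_l_distr M.smult_r_distr M.smult_assoc1 M.smult_one)
  have "e \<in> module_hom R M ?N"
    by (rule module_homI) (auto simp: N Nadd Nsm)
  moreover have "bij_betw e (carrier M) (carrier ?N)"
    using e by (simp add: bij_betw_def N)
  ultimately show ?thesis using M lmN unfolding module_isomorphic_def by blast
qed

text \<open>The models may live over another type than the modules that are counted.\<close>

lemma simple_modules_quotient:
  fixes R :: "('r, 'n) ring_scheme" and model :: "'t \<Rightarrow> ('r, 'w) module"
    and P :: "('r, 'v) module \<Rightarrow> bool"
  assumes T: "finite T"
    and cover: "\<And>M :: ('r, 'v) module. M \<in> simple_modules R \<Longrightarrow> \<exists>t\<in>T. module_isomorphic R (model t) M"
    and simple: "\<And>t. t \<in> T \<Longrightarrow> model t \<in> simple_modules R"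
    and distinct: "\<And>t s. t \<in> T \<Longrightarrow> s \<in> T \<Longrightarrow> module_isomorphic R (model t) (model s) \<Longrightarrow> t = s"
    and realized: "\<And>t. t \<in> T \<Longrightarrow> \<exists>e :: 'w \<Rightarrow> 'v. inj_on e (carrier (model t))"
    and PQ: "\<And>M t. t \<in> T \<Longrightarrow> module_isomorphic R (model t) M \<Longrightarrow> P M \<longleftrightarrow> Q t"
  shows "finite ({M \<in> simple_modules R. P M} // module_iso R)"
    and "num_iso R {M \<in> simple_modules R. P M} = card {t \<in> T. Q t}"
proof -
  define cls where "cls t = {N :: ('r, 'v) module. module_isomorphic R (model t) N}" for t
  \<comment> \<open>The injection on the carrier moves the model into \<open>'v\<close>, so every
    class \<open>cls t\<close> is inhabited.\<close>
  have ex: "\<exists>M :: ('r, 'v) module. M \<in> simple_modules R \<and> module_isomorphic R (model t) M"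
    if t: "t \<in> T" for t
  proof -
    obtain e :: "'w \<Rightarrow> 'v" where "inj_on e (carrier (model t))" using realized[OF t] by blast
    from module_isomorphic_transport[OF simple_modulesD(1)[OF simple[OF t]] this]
    show ?thesis using module_isomorphic_simple[OF simple[OF t]] by blast
  qed
  have cls_eq: "module_iso R `` {M} = cls t" if "module_isomorphic R (model t) M" for M t
    using module_isomorphic_trans[OF that] module_isomorphic_trans[OF module_isomorphic_sym[OF that]]
    unfolding cls_def by (auto simp: module_iso_iff)
  have eq: "{M \<in> simple_modules R. P M} // module_iso R = cls ` {t \<in> T. Q t}"
  proof (intro equalityI subsetI)
    fix C assume "C \<in> {M \<in> simple_modules R. P M} // module_iso R"
    then obtain M where "M \<in> simple_modules R" "P M" "C = module_iso R `` {M}"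
      by (auto elim: quotientE)
    moreover obtain t where "t \<in> T" "module_isomorphic R (model t) M"
      using cover calculation(1) by blast
    ultimately show "C \<in> cls ` {t \<in> T. Q t}"
      using PQ[of t M] cls_eq[of t M] by (intro image_eqI[of _ _ t]) simp_all
  next
    fix C assume "C \<in> cls ` {t \<in> T. Q t}"
    then obtain t where t: "t \<in> T" "Q t" "C = cls t" by blast
    obtain M :: "('r, 'v) module" where "M \<in> simple_modules R" "module_isomorphic R (model t) M"
      using ex[OF t(1)] by blast
    then show "C \<in> {M \<in> simple_modules R. P M} // module_iso R"
      using t PQ[of t M] cls_eq[of t M] quotientI[of M "{M \<in> simple_modules R. P M}" "module_iso R"] by simp
  qed
  \<comment> \<open>A common member over \<open>'v\<close> links the two models. Inhabitation is
    essential here: empty classes would all coincide.\<close>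
  have inj: "inj_on cls {t \<in> T. Q t}"
  proof (rule inj_onI)
    fix t s assume t: "t \<in> {t \<in> T. Q t}" and s: "s \<in> {t \<in> T. Q t}" and "cls t = cls s"
    from t ex[of t] obtain M :: "('r, 'v) module" where M: "module_isomorphic R (model t) M"
      by blast
    then have "M \<in> cls s" unfolding \<open>cls t = cls s\<close>[symmetric] by (simp add: cls_def)
    then have "module_isomorphic R (model s) M" by (simp add: cls_def)
    from module_isomorphic_trans[OF M module_isomorphic_sym[OF this]]
    have "module_isomorphic R (model t) (model s)" .
    then show "t = s" using distinct t s by blast
  qed
  show "finite ({M \<in> simple_modules R. P M} // module_iso R)" using T by (simp add: eq)
  show "num_iso R {M \<in> simple_modules R. P M} = card {t \<in> T. Q t}"
    by (simp add: num_iso_def eq card_image[OF inj])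
qed

section \<open>Trace and dimension in coordinates\<close>

definition supported_on :: "'i set \<Rightarrow> ('i \<Rightarrow> 'k::zero) set" where
  "supported_on X = {g. \<forall>i. i \<notin> X \<longrightarrow> g i = 0}"

text \<open>The induction runs over the truncations of g to subsets Y of X, because linearity of L
  is assumed only for functions supported on X.\<close>

lemma linear_functional_expand:
  fixes L :: "('i \<Rightarrow> 'k::field) \<Rightarrow> 'k"
  assumes X: "finite X"
    and add: "\<And>g h. g \<in> supported_on X \<Longrightarrow> h \<in> supported_on X \<Longrightarrow> L (\<lambda>i. g i + h i) = L g + L h"
    and smult: "\<And>c g. g \<in> supported_on X \<Longrightarrow> L (\<lambda>i. c * g i) = c * L g"
    and g: "g \<in> supported_on X"
  shows "L g = (\<Sum>i\<in>X. g i * L (bvec i))"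
proof -
  have "L (\<lambda>j. if j \<in> Y then g j else 0) = (\<Sum>i\<in>Y. g i * L (bvec i))" if "finite Y" "Y \<subseteq> X" for Y
    using that
  proof (induction Y)
    case empty
    then show ?case using smult[of g 0] g by simp
  next
    case (insert y Y)
    have b: "bvec y \<in> supported_on X"
      using insert.prems by (auto simp: supported_on_def bvec_def)
    then have b': "(\<lambda>j. g y * bvec y j) \<in> supported_on X"
      by (auto simp: supported_on_def)
    have r: "(\<lambda>j. if j \<in> Y then g j else 0) \<in> supported_on X"
      using g by (auto simp: supported_on_def)
    have "(\<lambda>j. if j \<in> insert y Y then g j else 0)
        = (\<lambda>j. g y * bvec y j + (if j \<in> Y then g j else 0))"
      using insert.hyps by (auto simp: bvec_def fun_eq_iff)
    then show ?case
      using insert add[OF b' r] smult[OF b, of "g y"] by simp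
  qed
  moreover have "(\<lambda>j. if j \<in> X then g j else 0) = g"
    using g by (auto simp: supported_on_def)
  ultimately show ?thesis using X by force
qed

lemma ex1_unique: "\<exists>!x. P x \<Longrightarrow> P x \<Longrightarrow> P y \<Longrightarrow> x = y"
  by blast

text \<open>Applied with V the underlying space of a module and \<phi> an isomorphism from one of
  the models, whose vectors already are functions on X.\<close>

locale coordinatized = vectorspace "class_ring :: 'k ring" V
  for V :: "('k::field, 'v) module" (structure) +
  fixes X :: "'i set" and \<phi> :: "('i \<Rightarrow> 'k) \<Rightarrow> 'v"
  assumes finite_X: "finite X"
    and \<phi>_bij: "bij_betw \<phi> (supported_on X) (carrier V)"
    and \<phi>_add: "\<And>g h. g \<in> supported_on X \<Longrightarrow> h \<in> supported_on X \<Longrightarrow> \<phi> (\<lambda>i. g i + h i) = \<phi> g \<oplus>\<^bsub>V\<^esub> \<phi> h"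
    and \<phi>_smult: "\<And>c g. g \<in> supported_on X \<Longrightarrow> \<phi> (\<lambda>i. c * g i) = c \<odot>\<^bsub>V\<^esub> \<phi> g"
begin

definition \<kappa> :: "'v \<Rightarrow> 'i \<Rightarrow> 'k" where "\<kappa> = inv_into (supported_on X) \<phi>"

lemma \<phi>_closed: "g \<in> supported_on X \<Longrightarrow> \<phi> g \<in> carrier V"
  using \<phi>_bij by (auto simp: bij_betw_def)

lemma \<kappa>_closed: "v \<in> carrier V \<Longrightarrow> \<kappa> v \<in> supported_on X"
  using \<phi>_bij by (auto simp: bij_betw_def \<kappa>_def inv_into_into)

lemma \<phi>_\<kappa>: "v \<in> carrier V \<Longrightarrow> \<phi> (\<kappa> v) = v"
  using \<phi>_bij by (auto simp: bij_betw_def \<kappa>_def f_inv_into_f)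

lemma \<kappa>_\<phi>: "g \<in> supported_on X \<Longrightarrow> \<kappa> (\<phi> g) = g"
  using \<phi>_bij by (simp add: bij_betw_def \<kappa>_def)

lemma supported_add: "g \<in> supported_on X \<Longrightarrow> h \<in> supported_on X \<Longrightarrow> (\<lambda>i. g i + h i :: 'k) \<in> supported_on X"
  by (simp add: supported_on_def)

lemma supported_smult: "g \<in> supported_on X \<Longrightarrow> (\<lambda>i. c * g i :: 'k) \<in> supported_on X"
  by (simp add: supported_on_def)

lemma bvec_supported: "i \<in> X \<Longrightarrow> (bvec i :: 'i \<Rightarrow> 'k) \<in> supported_on X"
  by (auto simp: supported_on_def bvec_def)

lemma \<kappa>_add: "v \<in> carrier V \<Longrightarrow> w \<in> carrier V \<Longrightarrow> \<kappa> (v \<oplus>\<^bsub>V\<^esub> w) = (\<lambda>i. \<kappa> v i + \<kappa> w i)"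
  using \<kappa>_\<phi>[OF supported_add[OF \<kappa>_closed \<kappa>_closed]] by (simp add: \<phi>_add \<kappa>_closed \<phi>_\<kappa>)

lemma \<kappa>_smult: "v \<in> carrier V \<Longrightarrow> \<kappa> (c \<odot>\<^bsub>V\<^esub> v) = (\<lambda>i. c * \<kappa> v i)"
  using \<kappa>_\<phi>[OF supported_smult[OF \<kappa>_closed]] by (simp add: \<phi>_smult \<kappa>_closed \<phi>_\<kappa>)

lemma smult_in: "v \<in> carrier V \<Longrightarrow> c \<odot>\<^bsub>V\<^esub> v \<in> carrier V"
  using module.smult_closed[of c v] by simp

lemma lincomb_insert': "finite A \<Longrightarrow> a \<notin> A \<Longrightarrow> insert a A \<subseteq> carrier V \<Longrightarrow>
    lincomb c (insert a A) = c a \<odot>\<^bsub>V\<^esub> a \<oplus>\<^bsub>V\<^esub> lincomb c A"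
  unfolding lincomb_def by (subst finsum_insert) (auto intro!: smult_in)

lemma \<kappa>_zero: "\<kappa> \<zero>\<^bsub>V\<^esub> = (\<lambda>_. 0)"
proof -
  have "0 \<odot>\<^bsub>V\<^esub> \<zero>\<^bsub>V\<^esub> = \<zero>\<^bsub>V\<^esub>" using lmult_0[of "\<zero>\<^bsub>V\<^esub>"] by simp
  with \<kappa>_smult[of "\<zero>\<^bsub>V\<^esub>" 0] show ?thesis by simp
qed

lemma \<kappa>_lincomb: "finite A \<Longrightarrow> A \<subseteq> carrier V \<Longrightarrow> \<kappa> (lincomb c A) i = (\<Sum>a\<in>A. c a * \<kappa> a i)"
proof (induction A rule: finite_induct)
  case empty
  then show ?case by (simp add: lincomb_def \<kappa>_zero)
next
  case (insert a A)
  have "lincomb c A \<in> carrier V" using insert by (intro lincomb_closed) auto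
  then show ?case
    using insert by (simp add: lincomb_insert' \<kappa>_add \<kappa>_smult smult_in)
qed

abbreviation std_basis :: "'v set" where "std_basis \<equiv> (\<lambda>i. \<phi> (bvec i)) ` X"

lemma inj_std_basis: "inj_on (\<lambda>i. \<phi> (bvec i)) X"
proof (rule inj_onI)
  fix i j assume "i \<in> X" "j \<in> X" "\<phi> (bvec i) = \<phi> (bvec j)"
  then have "(bvec i :: 'i \<Rightarrow> 'k) = bvec j" by (metis \<kappa>_\<phi> bvec_supported)
  then have "(bvec i i :: 'k) = bvec j i" by simp
  then show "i = j" by (simp add: bvec_def split: if_splits)
qed

lemma \<kappa>_lincomb_std:
  assumes "i \<in> X" shows "\<kappa> (lincomb c std_basis) i = c (\<phi> (bvec i))"
proof -
  have "\<kappa> (lincomb c std_basis) i = (\<Sum>j\<in>X. c (\<phi> (bvec j)) * \<kappa> (\<phi> (bvec j)) i)"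
    using finite_X by (subst \<kappa>_lincomb) (auto simp: \<phi>_closed bvec_supported sum.reindex[OF inj_std_basis])
  also have "\<dots> = (\<Sum>j\<in>X. if j = i then c (\<phi> (bvec j)) else 0)"
    by (intro sum.cong refl) (simp add: \<kappa>_\<phi> bvec_supported, simp add: bvec_def)
  finally show ?thesis using assms finite_X by simp
qed

lemma \<kappa>_eqI: "v \<in> carrier V \<Longrightarrow> w \<in> carrier V \<Longrightarrow> (\<And>i. i \<in> X \<Longrightarrow> \<kappa> v i = \<kappa> w i) \<Longrightarrow> v = w"
proof -
  assume v: "v \<in> carrier V" and w: "w \<in> carrier V" and eq: "\<And>i. i \<in> X \<Longrightarrow> \<kappa> v i = \<kappa> w i"
  have "\<kappa> v i = \<kappa> w i" for i
    using eq[of i] \<kappa>_closed[OF v] \<kappa>_closed[OF w] by (cases "i \<in> X") (auto simp: supported_on_def)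
  then have "\<kappa> v = \<kappa> w" by (rule ext)
  then show "v = w" by (metis \<phi>_\<kappa> v w)
qed

lemma basis_std: "basis std_basis"
proof -
  have B: "std_basis \<subseteq> carrier V" "finite std_basis"
    using finite_X by (auto simp: \<phi>_closed bvec_supported)
  have "\<exists>!a. a \<in> std_basis \<rightarrow>\<^sub>E carrier (class_ring :: 'k ring) \<and> lincomb a std_basis = v"
    if v: "v \<in> carrier V" for v
  proof (rule ex_ex1I)
    define a where "a = restrict (\<lambda>b. \<kappa> v (inv_into X (\<lambda>i. \<phi> (bvec i)) b)) std_basis"
    have "lincomb a std_basis = v"
    proof (rule \<kappa>_eqI)
      show "lincomb a std_basis \<in> carrier V" using B by (intro lincomb_closed) auto
      fix i assume "i \<in> X"
      then show "\<kappa> (lincomb a std_basis) i = \<kappa> v i"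
        by (simp add: \<kappa>_lincomb_std a_def inv_into_f_f[OF inj_std_basis])
    qed (rule v)
    moreover have "a \<in> std_basis \<rightarrow>\<^sub>E carrier (class_ring :: 'k ring)" by (simp add: a_def)
    ultimately show "\<exists>a. a \<in> std_basis \<rightarrow>\<^sub>E carrier (class_ring :: 'k ring) \<and> lincomb a std_basis = v"
      by blast
  next
    fix a b
    assume a: "a \<in> std_basis \<rightarrow>\<^sub>E carrier (class_ring :: 'k ring) \<and> lincomb a std_basis = v"
      and b: "b \<in> std_basis \<rightarrow>\<^sub>E carrier (class_ring :: 'k ring) \<and> lincomb b std_basis = v"
    show "a = b"
    proof (rule PiE_ext)
      show "a \<in> std_basis \<rightarrow>\<^sub>E carrier (class_ring :: 'k ring)" using a by blast
      show "b \<in> std_basis \<rightarrow>\<^sub>E carrier (class_ring :: 'k ring)" using b by blast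
      fix x assume "x \<in> std_basis"
      then obtain i where "i \<in> X" "x = \<phi> (bvec i)" by blast
      then show "a x = b x" using a b \<kappa>_lincomb_std[of i a] \<kappa>_lincomb_std[of i b] by simp
    qed
  qed
  then show ?thesis using basis_criterion[OF B(2,1)] by blast
qed

lemma fin_dim: "fin_dim"
  using basis_std finite_X unfolding fin_dim_def basis_def by blast

lemma dim_eq: "dim = card X"
  using dim_basis[OF _ basis_std] finite_X by (simp add: card_image inj_std_basis)

text \<open>Independence of the basis. Let \<open>c\<close> be the coordinates in the chosen basis B
  and \<kappa> those in the standard one. Expanding each b in the standard basis gives a double sum
  over B and X; summing over b first reassembles the i-th standard coordinate of the image of the
  i-th standard vector.\<close>

lemma lin_trace_eq:
  assumes T: "\<And>v. v \<in> carrier V \<Longrightarrow> T v \<in> carrier V"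
    and Tadd: "\<And>v w. v \<in> carrier V \<Longrightarrow> w \<in> carrier V \<Longrightarrow> T (v \<oplus>\<^bsub>V\<^esub> w) = T v \<oplus>\<^bsub>V\<^esub> T w"
    and Tsmult: "\<And>c v. v \<in> carrier V \<Longrightarrow> T (c \<odot>\<^bsub>V\<^esub> v) = c \<odot>\<^bsub>V\<^esub> T v"
  shows "lin_trace V T = (\<Sum>i\<in>X. \<kappa> (T (\<phi> (bvec i))) i)"
proof -
  define B where "B = (SOME B. finite B \<and> basis B)"
  have "\<exists>B. finite B \<and> basis B"
    using basis_std finite_X by (intro exI[of _ std_basis] conjI) simp
  then have fB: "finite B \<and> basis B"
    unfolding B_def by (rule someI_ex)
  then have B: "finite B" "B \<subseteq> carrier V" and bB: "basis B" unfolding basis_def by blast+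
  have ex1: "\<exists>!a. a \<in> B \<rightarrow>\<^sub>E UNIV \<and> lincomb a B = v" if "v \<in> carrier V" for v
    using iffD1[OF basis_criterion[OF B] bB] that by simp
  have closed: "lincomb a B \<in> carrier V" for a using B by (intro lincomb_closed) auto
  \<comment> \<open>The basis criterion gives a unique extensional coefficient function, while
    \<open>coord\<close> picks any function; only its values on B are determined, and restriction
    passes from one to the other.\<close>
  have restr: "lincomb (restrict a B) B = lincomb a B" for a
    unfolding lincomb_def using B smult_in by (intro finsum_cong') auto
  have uniq: "a b = a' b" if "lincomb a B = lincomb a' B" "b \<in> B" for a a' b
  proof -
    have "restrict a B \<in> B \<rightarrow>\<^sub>E UNIV" "restrict a' B \<in> B \<rightarrow>\<^sub>E UNIV" by auto
    then have "restrict a B = restrict a' B"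
      by (intro ex1_unique[OF ex1[OF closed[of a]]]) (simp_all add: restr that(1)[symmetric])
    from fun_cong[OF this, of b] show ?thesis using that(2) by simp
  qed
  define c where "c v = coord V B v" for v
  have c: "lincomb (c v) B = v" if "v \<in> carrier V" for v
    unfolding c_def coord_def
    using ex1_implies_ex[OF ex1[OF that]] by (intro someI_ex[of "\<lambda>c. lincomb c B = v"]) auto
  have c_add: "c (v \<oplus>\<^bsub>V\<^esub> w) b = c v b + c w b" if "v \<in> carrier V" "w \<in> carrier V" "b \<in> B" for v w b
    using lincomb_sum[OF B, of "c v" "c w"] that by (intro uniq) (simp_all add: c)
  have c_smult: "c (x \<odot>\<^bsub>V\<^esub> v) b = x * c v b" if "v \<in> carrier V" "b \<in> B" for v x b
    using lincomb_smult[OF B(2), of "c v" x] that smult_in by (intro uniq) (simp_all add: c)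
  have expand: "c (T b) b = (\<Sum>i\<in>X. \<kappa> b i * c (T (\<phi> (bvec i))) b)" if b: "b \<in> B" for b
  proof -
    have "c (T (\<phi> (\<kappa> b))) b = (\<Sum>i\<in>X. \<kappa> b i * c (T (\<phi> (bvec i))) b)"
      using b B(2)
      by (intro linear_functional_expand[where L = "\<lambda>g. c (T (\<phi> g)) b"] finite_X)
        (auto simp: \<phi>_add \<phi>_smult Tadd Tsmult c_add c_smult \<phi>_closed T \<kappa>_closed subset_iff)
    then show ?thesis using b B(2) \<phi>_\<kappa>[of b] by (simp add: subset_iff)
  qed
  have "lin_trace V T = (\<Sum>b\<in>B. c (T b) b)"
    by (simp add: lin_trace_def Let_def B_def c_def)
  also have "\<dots> = (\<Sum>b\<in>B. \<Sum>i\<in>X. \<kappa> b i * c (T (\<phi> (bvec i))) b)"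
    by (rule sum.cong[OF refl expand])
  also have "\<dots> = (\<Sum>i\<in>X. \<Sum>b\<in>B. c (T (\<phi> (bvec i))) b * \<kappa> b i)"
    by (subst sum.swap) (simp add: mult.commute)
  also have "\<dots> = (\<Sum>i\<in>X. \<kappa> (T (\<phi> (bvec i))) i)"
    by (intro sum.cong refl) (simp add: \<kappa>_lincomb[OF B, symmetric] c T \<phi>_closed bvec_supported)
  finally show ?thesis .
qed

end

section \<open>Factorized groups\<close>

text \<open>Uniqueness of the factorization is encoded as a trivial intersection of the factors;
  \<open>factor_unique\<close> recovers it.\<close>

locale factorization = group L for L :: "('a, 'm) monoid_scheme" (structure) +
  fixes F G :: "'a set"
  assumes subgroup_F: "subgroup F L" and subgroup_G: "subgroup G L"
    and finite_carrier: "finite (carrier L)"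
    and factor: "\<And>l. l \<in> carrier L \<Longrightarrow> \<exists>a\<in>F. \<exists>x\<in>G. l = a \<otimes> x"
    and trivial_Int: "F \<inter> G = {\<one>}"
begin

abbreviation rt :: "'a \<Rightarrow> 'a \<Rightarrow> 'a" where "rt \<equiv> ract L F G"
abbreviation lt :: "'a \<Rightarrow> 'a \<Rightarrow> 'a" where "lt \<equiv> lact L F G"
abbreviation orb :: "'a \<Rightarrow> 'a set" where "orb \<equiv> ract_orbit L F G"

lemma F_carrier [simp]: "a \<in> F \<Longrightarrow> a \<in> carrier L"
  using subgroup.mem_carrier[OF subgroup_F] .
lemma G_carrier [simp]: "x \<in> G \<Longrightarrow> x \<in> carrier L"
  using subgroup.mem_carrier[OF subgroup_G] .
lemma F_mult [simp]: "a \<in> F \<Longrightarrow> b \<in> F \<Longrightarrow> a \<otimes> b \<in> F"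
  using subgroup.m_closed[OF subgroup_F] .
lemma G_mult [simp]: "a \<in> G \<Longrightarrow> b \<in> G \<Longrightarrow> a \<otimes> b \<in> G"
  using subgroup.m_closed[OF subgroup_G] .
lemma F_one [simp]: "\<one> \<in> F" and G_one [simp]: "\<one> \<in> G"
  using subgroup.one_closed subgroup_F subgroup_G by auto
lemma F_inv [simp]: "a \<in> F \<Longrightarrow> inv a \<in> F"
  using subgroup.m_inv_closed[OF subgroup_F] .
lemma G_inv [simp]: "a \<in> G \<Longrightarrow> inv a \<in> G"
  using subgroup.m_inv_closed[OF subgroup_G] .
lemma finite_F [simp]: "finite F" and finite_G [simp]: "finite G"
  using finite_carrier subgroup_F subgroup_G subgroup.subset finite_subset by metis+

lemma factor_unique:
  assumes "a \<in> F" "b \<in> F" "x \<in> G" "y \<in> G" and eq: "a \<otimes> x = b \<otimes> y"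
  shows "a = b \<and> x = y"
proof -
  have "inv b \<otimes> a = inv b \<otimes> (b \<otimes> y) \<otimes> inv x"
    using assms by (simp flip: eq add: m_assoc)
  also have "\<dots> = y \<otimes> inv x" using assms by (simp add: m_assoc[symmetric])
  finally have e: "inv b \<otimes> a = y \<otimes> inv x" .
  moreover have "inv b \<otimes> a \<in> F" "y \<otimes> inv x \<in> G" using assms by auto
  ultimately have 1: "inv b \<otimes> a = \<one>" using trivial_Int by auto
  have "b \<otimes> (inv b \<otimes> a) = b \<otimes> \<one>" by (simp only: 1)
  then have ab: "a = b" using assms(1,2) by (simp add: m_assoc[symmetric])
  then show ?thesis using eq assms(2-4) by simp
qed

text \<open>From here on, values of the two actions are found by exhibiting a factorization of x a,
  never through the definite descriptions.\<close>

lemma rt_lt_eqI: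
  assumes "b \<in> F" "y \<in> G" and eq: "x \<otimes> a = b \<otimes> y"
  shows "rt x a = y" and "lt x a = b"
proof -
  show "rt x a = y" unfolding ract_def
    using assms by (intro the_equality) (auto dest: factor_unique)
  show "lt x a = b" unfolding lact_def
    using assms by (intro the_equality) (auto dest: factor_unique)
qed

lemma rt_lt:
  assumes x: "x \<in> G" and a: "a \<in> F"
  shows rt_closed [simp]: "rt x a \<in> G" and lt_closed [simp]: "lt x a \<in> F"
    and lt_rt: "x \<otimes> a = lt x a \<otimes> rt x a"
proof -
  have "x \<otimes> a \<in> carrier L" using assms by simp
  then obtain b y where ay: "b \<in> F" "y \<in> G" "x \<otimes> a = b \<otimes> y" using factor by blast
  from ay rt_lt_eqI[OF ay] show "rt x a \<in> G" "lt x a \<in> F" "x \<otimes> a = lt x a \<otimes> rt x a" by auto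
qed

lemma rt_one [simp]: "x \<in> G \<Longrightarrow> rt x \<one> = x"
  by (rule rt_lt_eqI[of \<one>]) auto

lemma one_rt [simp]: "a \<in> F \<Longrightarrow> rt \<one> a = \<one>" and one_lt [simp]: "a \<in> F \<Longrightarrow> lt \<one> a = a"
  using rt_lt_eqI[of a \<one> \<one> a] by auto

lemma rt_mult:
  assumes "x \<in> G" "a \<in> F" "b \<in> F" shows "rt x (a \<otimes> b) = rt (rt x a) b"
proof (rule rt_lt_eqI)
  show "x \<otimes> (a \<otimes> b) = (lt x a \<otimes> lt (rt x a) b) \<otimes> rt (rt x a) b"
    using lt_rt[of x a] lt_rt[of "rt x a" b] assms by (simp add: m_assoc[symmetric]) (simp add: m_assoc)
qed (use assms in auto)

lemma rt_inv: "x \<in> G \<Longrightarrow> a \<in> F \<Longrightarrow> rt (rt x a) (inv a) = x"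
  by (simp flip: rt_mult)

text \<open>The factorization of y a, rearranged to inv y (lt y a) = a inv (rt y a), is itself a
  factorization, this time of inv y times an element of F. It shows that inversion maps orbits to
  orbits.\<close>

lemma inv_rt_lt:
  assumes y: "y \<in> G" and a: "a \<in> F"
  shows inv_rt: "rt (inv y) (lt y a) = inv (rt y a)" and inv_lt: "lt (inv y) (lt y a) = a"
proof -
  have "y \<otimes> a \<otimes> inv (rt y a) = lt y a"
    using lt_rt[OF y a] y a by (simp add: m_assoc)
  then have "inv y \<otimes> lt y a = inv y \<otimes> (y \<otimes> a \<otimes> inv (rt y a))" by simp
  also have "\<dots> = a \<otimes> inv (rt y a)" using y a by (simp add: m_assoc[symmetric])
  finally have e: "inv y \<otimes> lt y a = a \<otimes> inv (rt y a)" .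
  show "rt (inv y) (lt y a) = inv (rt y a)" "lt (inv y) (lt y a) = a"
    using rt_lt_eqI[OF a _ e] y a by auto
qed

lemma rt_eq_one_iff: "y \<in> G \<Longrightarrow> a \<in> F \<Longrightarrow> rt y a = \<one> \<longleftrightarrow> y = \<one>"
  using rt_inv[of y a] by (metis F_inv one_rt)

lemma orb_self: "x \<in> G \<Longrightarrow> x \<in> orb x"
  unfolding ract_orbit_def by (auto intro!: exI[of _ \<one>])

lemma orb_subset: "x \<in> G \<Longrightarrow> orb x \<subseteq> G"
  unfolding ract_orbit_def by auto

lemma rt_in_orb: "a \<in> F \<Longrightarrow> rt x a \<in> orb x"
  unfolding ract_orbit_def by auto

lemma orb_eq:
  assumes "x \<in> G" "y \<in> orb x" shows "orb y = orb x"
proof -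
  obtain a where a: "a \<in> F" "y = rt x a" using assms(2) unfolding ract_orbit_def by blast
  have "rt y b \<in> orb x" if "b \<in> F" for b
    using a that assms(1) rt_in_orb[of "a \<otimes> b" x] by (simp add: rt_mult)
  moreover have "rt x b \<in> orb y" if "b \<in> F" for b
    using a that assms(1) rt_in_orb[of "inv a \<otimes> b" y] by (simp add: rt_mult rt_inv)
  ultimately show ?thesis unfolding ract_orbit_def by blast
qed

definition orbits :: "'a set set" where "orbits = orb ` G"

lemma orbitsD:
  assumes "X \<in> orbits"
  shows orbit_sub: "X \<subseteq> G" and orbit_eq: "y \<in> X \<Longrightarrow> X = orb y" and orbit_finite: "finite X"
    and orbit_rt: "y \<in> X \<Longrightarrow> a \<in> F \<Longrightarrow> rt y a \<in> X" and orbit_nonempty: "X \<noteq> {}"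
proof -
  obtain x where x: "x \<in> G" "X = orb x" using assms unfolding orbits_def by blast
  show sub: "X \<subseteq> G" using orb_subset[OF x(1)] x(2) by simp
  show eq: "X = orb y" if "y \<in> X" for y using orb_eq[OF x(1)] x(2) that by simp
  show "X \<noteq> {}" using orb_self[OF x(1)] x(2) by blast
  show "finite X" using finite_subset[OF sub] by simp
  show "rt y a \<in> X" if "y \<in> X" "a \<in> F" using eq[OF that(1)] rt_in_orb[OF that(2), of y] by simp
qed

lemma rt_notin:
  assumes X: "X \<in> orbits" and "y \<in> G" "y \<notin> X" "a \<in> F" shows "rt y a \<notin> X"
  using orbit_rt[OF X, of "rt y a" "inv a"] rt_inv[of y a] assms by auto


section \<open>The bismash product and its integral\<close>

abbreviation J :: "('a \<times> 'a, 'k::field) based_hopf" where "J \<equiv> bismash L F G"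

lemma J_simps [simp]:
  "carrier J = supported_on (G \<times> F)" "zero J = (\<lambda>_. 0)"
  "h \<oplus>\<^bsub>J\<^esub> h' = (\<lambda>u. h u + h' u)" "base J = G \<times> F"
  by (auto simp: bismash_def supported_on_def)

lemma one_J: "(\<one>\<^bsub>J\<^esub> :: 'a \<times> 'a \<Rightarrow> 'k::field) (y, c) = (if y \<in> G \<and> c = \<one> then 1 else 0)"
proof -
  have "(\<one>\<^bsub>J\<^esub> :: 'a \<times> 'a \<Rightarrow> 'k) (y, c) = (\<Sum>x\<in>G. if x = y then (if c = \<one> then 1 else 0) else 0)"
    unfolding bismash_def by (simp add: bvec_def if_distrib cong: if_cong) (auto intro!: sum.cong)
  then show ?thesis by simp
qed

text \<open>A twisted convolution over F: the basis element at (y, a) reaches (y, c) exactly when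
  followed by the one at (rt y a, inv a c).\<close>

lemma mult_J:
  "(h \<otimes>\<^bsub>J\<^esub> h') (y, c) = (if y \<in> G \<and> c \<in> F then \<Sum>a\<in>F. h (y, a) * h' (rt y a, inv a \<otimes> c) else 0)"
proof -
  have inner: "(\<Sum>u\<in>G \<times> F. h' u * (case u of (z, b) \<Rightarrow>
        if z = rt x a then bvec (x, a \<otimes> b) else (\<lambda>_. 0)) (y, c))
      = (if x = y \<and> c \<in> F then h' (rt x a, inv a \<otimes> c) else 0)" if "x \<in> G" "a \<in> F" for x a
  proof -
    have "(\<Sum>u\<in>G \<times> F. h' u * (case u of (z, b) \<Rightarrow>
        if z = rt x a then bvec (x, a \<otimes> b) else (\<lambda>_. 0)) (y, c))
      = (\<Sum>z\<in>G. \<Sum>b\<in>F. h' (z, b) * (if z = rt x a then bvec (x, a \<otimes> b) else (\<lambda>_. 0)) (y, c))"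
      by (simp add: sum.cartesian_product case_prod_unfold)
    also have "\<dots> = (\<Sum>z\<in>G. if z = rt x a then \<Sum>b\<in>F. h' (z, b) * bvec (x, a \<otimes> b) (y, c) else 0)"
      by (intro sum.cong refl) auto
    also have "\<dots> = (\<Sum>b\<in>F. h' (rt x a, b) * bvec (x, a \<otimes> b) (y, c))"
      using that by simp
    also have "\<dots> = (\<Sum>b\<in>F. if b = inv a \<otimes> c then (if x = y \<and> c \<in> F then h' (rt x a, b) else 0) else 0)"
    proof (intro sum.cong refl)
      fix b assume b: "b \<in> F"
      then have "a \<otimes> b = c \<longleftrightarrow> c \<in> F \<and> b = inv a \<otimes> c"
        using that by (auto simp: m_assoc[symmetric])
      then show "h' (rt x a, b) * bvec (x, a \<otimes> b) (y, c)
          = (if b = inv a \<otimes> c then (if x = y \<and> c \<in> F then h' (rt x a, b) else 0) else 0)"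
        by (auto simp: bvec_def)
    qed
    also have "\<dots> = (if x = y \<and> c \<in> F then h' (rt x a, inv a \<otimes> c) else 0)"
      using that by auto
    finally show ?thesis .
  qed
  have "(h \<otimes>\<^bsub>J\<^esub> h') (y, c) = (\<Sum>x\<in>G. \<Sum>a\<in>F. h (x, a) * (\<Sum>u\<in>G \<times> F. h' u * (case u of (z, b) \<Rightarrow>
        if z = rt x a then bvec (x, a \<otimes> b) else (\<lambda>_. 0)) (y, c)))"
    by (simp add: bismash_def lin_ext_def sum.cartesian_product case_prod_unfold)
  also have "\<dots> = (\<Sum>x\<in>G. \<Sum>a\<in>F. h (x, a) * (if x = y \<and> c \<in> F then h' (rt x a, inv a \<otimes> c) else 0))"
    by (intro sum.cong refl) (simp only: inner)
  also have "\<dots> = (\<Sum>x\<in>G. if x = y then \<Sum>a\<in>F. h (x, a) * (if c \<in> F then h' (rt x a, inv a \<otimes> c) else 0) else 0)"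
    by (intro sum.cong refl) auto
  also have "\<dots> = (if y \<in> G \<and> c \<in> F then \<Sum>a\<in>F. h (y, a) * h' (rt y a, inv a \<otimes> c) else 0)"
    by auto
  finally show ?thesis .
qed

lemma mult_J_closed: "h \<otimes>\<^bsub>J\<^esub> h' \<in> supported_on (G \<times> F)"
  by (auto simp: supported_on_def mult_J)

lemma sum_F_translate: "a \<in> F \<Longrightarrow> (\<Sum>b\<in>F. f (inv a \<otimes> b)) = (\<Sum>b\<in>F. f b)"
  by (rule sum.reindex_bij_witness[of _ "\<lambda>b. a \<otimes> b" "\<lambda>b. inv a \<otimes> b"])
    (auto simp: m_assoc[symmetric])

text \<open>After the exchange of the two sums, the inner variable b is translated by a. This works
  because acting by b is acting by a and then by inv a b.\<close>

lemma mult_J_assoc: "h \<otimes>\<^bsub>J\<^esub> h' \<otimes>\<^bsub>J\<^esub> h'' = h \<otimes>\<^bsub>J\<^esub> (h' \<otimes>\<^bsub>J\<^esub> h'')"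
proof
  fix u show "(h \<otimes>\<^bsub>J\<^esub> h' \<otimes>\<^bsub>J\<^esub> h'') u = (h \<otimes>\<^bsub>J\<^esub> (h' \<otimes>\<^bsub>J\<^esub> h'')) u"
  proof (cases u)
    case (Pair y c)
    show ?thesis
    proof (cases "y \<in> G \<and> c \<in> F")
      case False then show ?thesis by (auto simp: Pair mult_J[of _ _ y c])
    next
      case True
      have "(h \<otimes>\<^bsub>J\<^esub> h' \<otimes>\<^bsub>J\<^esub> h'') (y, c)
          = (\<Sum>b\<in>F. \<Sum>a\<in>F. h (y, a) * h' (rt y a, inv a \<otimes> b) * h'' (rt y b, inv b \<otimes> c))"
        using True by (simp add: mult_J sum_distrib_right)
      also have "\<dots> = (\<Sum>a\<in>F. \<Sum>b\<in>F. h (y, a) * h' (rt y a, inv a \<otimes> b) * h'' (rt y b, inv b \<otimes> c))"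
        by (rule sum.swap)
      also have "\<dots> = (\<Sum>a\<in>F. \<Sum>b\<in>F. h (y, a) * h' (rt y a, b) *
          h'' (rt (rt y a) b, inv b \<otimes> (inv a \<otimes> c)))"
      proof (rule sum.cong[OF refl])
        fix a assume a: "a \<in> F"
        have "(\<Sum>b\<in>F. h (y, a) * h' (rt y a, inv a \<otimes> b) * h'' (rt y b, inv b \<otimes> c))
          = (\<Sum>b\<in>F. h (y, a) * h' (rt y a, inv a \<otimes> b) *
              h'' (rt (rt y a) (inv a \<otimes> b), inv (inv a \<otimes> b) \<otimes> (inv a \<otimes> c)))"
        proof (intro sum.cong refl)
          fix b assume b: "b \<in> F"
          have "rt (rt y a) (inv a \<otimes> b) = rt y b"
            using a b True by (simp add: rt_mult[symmetric]) (simp add: m_assoc[symmetric])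
          moreover have "inv (inv a \<otimes> b) \<otimes> (inv a \<otimes> c) = inv b \<otimes> c"
            using a b True by (simp add: inv_mult_group m_assoc) (simp add: m_assoc[symmetric])
          ultimately show "h (y, a) * h' (rt y a, inv a \<otimes> b) * h'' (rt y b, inv b \<otimes> c)
            = h (y, a) * h' (rt y a, inv a \<otimes> b) *
              h'' (rt (rt y a) (inv a \<otimes> b), inv (inv a \<otimes> b) \<otimes> (inv a \<otimes> c))" by simp
        qed
        also have "\<dots> = (\<Sum>b\<in>F. h (y, a) * h' (rt y a, b) *
          h'' (rt (rt y a) b, inv b \<otimes> (inv a \<otimes> c)))"
          by (rule sum_F_translate[OF a])
        finally show "(\<Sum>b\<in>F. h (y, a) * h' (rt y a, inv a \<otimes> b) * h'' (rt y b, inv b \<otimes> c)) = \<dots>" .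
      qed
      also have "\<dots> = (h \<otimes>\<^bsub>J\<^esub> (h' \<otimes>\<^bsub>J\<^esub> h'')) (y, c)"
        using True by (simp add: mult_J sum_distrib_left mult.assoc)
      finally show ?thesis by (simp add: Pair)
    qed
  qed
qed

text \<open>Together with \<open>mult_J_scalar\<close> this makes c times the unit central, so that
  elements of J act linearly over k on every module; the case c = 1 is the unit law.\<close>

lemma scalar_mult_J:
  assumes "h \<in> supported_on (G \<times> F)"
  shows "(\<lambda>u. c * \<one>\<^bsub>J\<^esub> u) \<otimes>\<^bsub>J\<^esub> h = (\<lambda>u. c * h u)"
proof
  fix u show "((\<lambda>u. c * \<one>\<^bsub>J\<^esub> u) \<otimes>\<^bsub>J\<^esub> h) u = c * h u"
  proof (cases u)
    case (Pair y d)
    have "(\<Sum>a\<in>F. c * (if a = \<one> then 1 else 0) * h (rt y a, inv a \<otimes> d))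
        = (\<Sum>a\<in>F. if a = \<one> then c * h (rt y a, inv a \<otimes> d) else 0)"
      by (intro sum.cong refl) simp
    then show ?thesis using assms by (auto simp: Pair mult_J one_J supported_on_def)
  qed
qed

lemma mult_J_scalar:
  assumes "h \<in> supported_on (G \<times> F)"
  shows "h \<otimes>\<^bsub>J\<^esub> (\<lambda>u. c * \<one>\<^bsub>J\<^esub> u) = (\<lambda>u. c * h u)"
proof
  fix u show "(h \<otimes>\<^bsub>J\<^esub> (\<lambda>u. c * \<one>\<^bsub>J\<^esub> u)) u = c * h u"
  proof (cases u)
    case (Pair y d)
    have "(\<Sum>a\<in>F. h (y, a) * (c * \<one>\<^bsub>J\<^esub> (rt y a, inv a \<otimes> d)))
        = (\<Sum>a\<in>F. if a = d then c * h (y, a) else 0)" if "y \<in> G" "d \<in> F"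
    proof (intro sum.cong refl)
      fix a assume "a \<in> F"
      then have "inv a \<otimes> d = \<one> \<longleftrightarrow> a = d"
        using that inv_equality[of "inv a" d] by auto
      then show "h (y, a) * (c * \<one>\<^bsub>J\<^esub> (rt y a, inv a \<otimes> d)) = (if a = d then c * h (y, a) else 0)"
        using \<open>a \<in> F\<close> that by (simp add: one_J)
    qed
    then show ?thesis using assms by (auto simp: Pair mult_J supported_on_def)
  qed
qed

lemma one_J_closed: "\<one>\<^bsub>J\<^esub> \<in> supported_on (G \<times> F)"
  by (auto simp: supported_on_def one_J)

lemma ring_J: "ring (J :: ('a \<times> 'a, 'k::field) based_hopf)"
proof (rule ringI)
  let ?J = "J :: ('a \<times> 'a, 'k) based_hopf"
  show "abelian_group ?J"
  proof (rule abelian_groupI)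
    fix h assume "h \<in> carrier ?J"
    then show "\<exists>h'\<in>carrier ?J. h' \<oplus>\<^bsub>J\<^esub> h = \<zero>\<^bsub>J\<^esub>"
      by (intro bexI[of _ "\<lambda>u. - h u"]) (auto simp: supported_on_def)
  qed (auto simp: supported_on_def algebra_simps)
  show "Group.monoid ?J"
    using scalar_mult_J[where c = 1] mult_J_scalar[where c = 1]
    by (intro monoidI) (auto simp: mult_J_closed mult_J_assoc one_J_closed)
  show "(h \<oplus>\<^bsub>J\<^esub> h') \<otimes>\<^bsub>J\<^esub> h'' = h \<otimes>\<^bsub>J\<^esub> h'' \<oplus>\<^bsub>?J\<^esub> h' \<otimes>\<^bsub>J\<^esub> h''" for h h' h'' :: "'a \<times> 'a \<Rightarrow> 'k"
    by (auto simp: fun_eq_iff mult_J algebra_simps sum.distrib)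
  show "h'' \<otimes>\<^bsub>J\<^esub> (h \<oplus>\<^bsub>J\<^esub> h') = h'' \<otimes>\<^bsub>J\<^esub> h \<oplus>\<^bsub>?J\<^esub> h'' \<otimes>\<^bsub>J\<^esub> h'" for h h' h'' :: "'a \<times> 'a \<Rightarrow> 'k"
    by (auto simp: fun_eq_iff mult_J algebra_simps sum.distrib)
qed

section \<open>The normalized integral and the element whose trace is the indicator\<close>

lemma counit_J: "counit J h = (\<Sum>a\<in>F. h (\<one>, a))"
proof -
  have "counit J h = (\<Sum>x\<in>G. \<Sum>a\<in>F. h (x, a) * (if x = \<one> then 1 else 0))"
    by (simp add: bismash_def sum.cartesian_product)
  also have "\<dots> = (\<Sum>x\<in>G. if x = \<one> then \<Sum>a\<in>F. h (x, a) else 0)"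
    by (intro sum.cong refl) simp
  finally show ?thesis by simp
qed

text \<open>The element p_1 # e, where e is the average of the elements of F; the factor 1/|F| makes
  the counit 1.\<close>

definition \<Lambda> :: "'a \<times> 'a \<Rightarrow> 'k::field" where
  "\<Lambda> = (\<lambda>(x, a). if x = \<one> \<and> a \<in> F then 1 / of_nat (card F) else 0)"

lemma card_F_nonzero: "(of_nat (card F) :: 'k::field_char_0) \<noteq> 0"
  using F_one by (auto simp: card_eq_0_iff simp del: F_one)

text \<open>On the left, h (y, a) survives only if rt y a = 1, that is y = 1, which leaves the sum
  defining the counit. On the right, F fixes 1, and the sum over F absorbs the substitution of inv a
  c for a.\<close>

lemma integral_\<Lambda>: "integral_elt J (\<Lambda> :: 'a \<times> 'a \<Rightarrow> 'k::field)"
proof -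
  have "h \<otimes>\<^bsub>J\<^esub> \<Lambda> = (\<lambda>u. counit J h * \<Lambda> u)" for h :: "'a \<times> 'a \<Rightarrow> 'k"
  proof
    fix u show "(h \<otimes>\<^bsub>J\<^esub> \<Lambda>) u = counit J h * \<Lambda> u"
      by (cases u) (auto simp: mult_J counit_J \<Lambda>_def rt_eq_one_iff sum_distrib_right)
  qed
  moreover have "\<Lambda> \<otimes>\<^bsub>J\<^esub> h = (\<lambda>u. counit J h * \<Lambda> u)" for h :: "'a \<times> 'a \<Rightarrow> 'k"
  proof
    fix u show "(\<Lambda> \<otimes>\<^bsub>J\<^esub> h) u = counit J h * \<Lambda> u"
    proof (cases u)
      case (Pair y c)
      have "(\<Sum>a\<in>F. h (\<one>, inv a \<otimes> c)) = (\<Sum>a\<in>F. h (\<one>, a))" if "c \<in> F"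
        using that by (intro sum.reindex_bij_witness[of _ "\<lambda>b. c \<otimes> inv b" "\<lambda>b. inv b \<otimes> c"])
          (auto simp: m_assoc inv_mult_group, auto simp: m_assoc[symmetric])
      then show ?thesis
        by (auto simp: Pair mult_J counit_J \<Lambda>_def sum_distrib_right sum_divide_distrib[symmetric])
    qed
  qed
  moreover have "\<Lambda> \<in> carrier (J :: ('a \<times> 'a, 'k) based_hopf)"
    by (auto simp: supported_on_def \<Lambda>_def)
  ultimately show ?thesis unfolding integral_elt_def by blast
qed

text \<open>For uniqueness, the product of \<Lambda> and M is evaluated twice, with either factor as
  the integral: it is counit(\<Lambda>) M as well as counit(M) \<Lambda>.\<close>

lemma normalized_integral_J: "normalized_integral J = (\<Lambda> :: 'a \<times> 'a \<Rightarrow> 'k::field_char_0)"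
  unfolding normalized_integral_def
proof (rule the_equality)
  have c: "counit J (\<Lambda> :: 'a \<times> 'a \<Rightarrow> 'k) = 1"
    using card_F_nonzero by (simp add: counit_J \<Lambda>_def)
  with integral_\<Lambda> show "integral_elt J (\<Lambda> :: 'a \<times> 'a \<Rightarrow> 'k) \<and> counit J (\<Lambda> :: 'a \<times> 'a \<Rightarrow> 'k) = 1" ..
  fix M :: "'a \<times> 'a \<Rightarrow> 'k" assume M: "integral_elt J M \<and> counit J M = 1"
  then have "\<Lambda> \<otimes>\<^bsub>J\<^esub> M = (\<lambda>u. counit J (\<Lambda> :: 'a \<times> 'a \<Rightarrow> 'k) * M u)"
    using integral_\<Lambda> unfolding integral_elt_def by blast
  moreover have "\<Lambda> \<otimes>\<^bsub>J\<^esub> M = (\<lambda>u. counit J M * \<Lambda> u)"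
    using M integral_\<Lambda> unfolding integral_elt_def by blast
  ultimately show "M = \<Lambda>" using M c by (simp add: fun_eq_iff)
qed

lemma bvec_mult_J:
  assumes "x \<in> G" "a \<in> F" "b \<in> F"
  shows "bvec (x, a) \<otimes>\<^bsub>J\<^esub> bvec (y, b) = (if y = rt x a then bvec (x, a \<otimes> b) else (\<lambda>_. 0))"
proof
  fix u
  show "(bvec (x, a) \<otimes>\<^bsub>J\<^esub> bvec (y, b)) u = (if y = rt x a then bvec (x, a \<otimes> b) else (\<lambda>_. 0)) u"
  proof (cases u)
    case (Pair z c)
    show ?thesis
    proof (cases "z \<in> G \<and> c \<in> F")
      case False
      then show ?thesis using assms by (auto simp: Pair mult_J bvec_def)
    next
      case True
      have "(bvec (x, a) \<otimes>\<^bsub>J\<^esub> bvec (y, b)) (z, c)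
          = (\<Sum>d\<in>F. bvec (x, a) (z, d) * bvec (y, b) (rt z d, inv d \<otimes> c))"
        using True by (simp add: mult_J)
      also have "\<dots> = (\<Sum>d\<in>F. if d = a then (if z = x then bvec (y, b) (rt z d, inv d \<otimes> c) else 0) else 0)"
        by (intro sum.cong refl) (simp add: bvec_def)
      also have "\<dots> = (if z = x then bvec (y, b) (rt z a, inv a \<otimes> c) else 0)"
        using assms by simp
      also have "inv a \<otimes> c = b \<longleftrightarrow> c = a \<otimes> b"
        using assms True by (auto simp: m_assoc[symmetric])
      then have "(if z = x then bvec (y, b) (rt z a, inv a \<otimes> c) else 0)
          = (if y = rt x a then bvec (x, a \<otimes> b) else (\<lambda>_. 0)) (z, c)"
        by (auto simp: bvec_def)
      finally show ?thesis by (simp add: Pair)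
    qed
  qed
qed

lemma comult_\<Lambda>:
  "comult J (\<Lambda> :: 'a \<times> 'a \<Rightarrow> 'k::field) t
    = (\<Sum>a\<in>F. \<Sum>y\<in>G. bvec ((inv y, lt y a), (y, a)) t / of_nat (card F))"
proof -
  have "comult J (\<Lambda> :: 'a \<times> 'a \<Rightarrow> 'k) t = (\<Sum>x\<in>G. \<Sum>a\<in>F. \<Lambda> (x, a) * (\<Sum>y\<in>G. bvec ((x \<otimes> inv y, lt y a), (y, a)) t))"
    by (simp add: bismash_def lin_ext_def sum.cartesian_product case_prod_unfold)
  also have "\<dots> = (\<Sum>x\<in>G. if x = \<one> then
      (\<Sum>a\<in>F. (\<Sum>y\<in>G. bvec ((x \<otimes> inv y, lt y a), (y, a)) t) / of_nat (card F)) else 0)"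
    by (intro sum.cong refl) (auto simp: \<Lambda>_def)
  also have "\<dots> = (\<Sum>a\<in>F. (\<Sum>y\<in>G. bvec ((\<one> \<otimes> inv y, lt y a), (y, a)) t) / of_nat (card F))"
    by simp
  also have "\<dots> = (\<Sum>a\<in>F. \<Sum>y\<in>G. bvec ((inv y, lt y a), (y, a)) t / of_nat (card F))"
    by (simp add: sum_divide_distrib)
  finally show ?thesis .
qed

text \<open>The tensor factors are the basis elements at (inv y, lt y a) and (y, a). Their product
  is nonzero iff lt y a carries inv y to y; by \<open>inv_rt\<close> it carries inv y to inv (rt y
  a), whence the condition rt y a = inv y.\<close>

lemma \<Lambda>12:
  "tensor_mult J (comult J (\<Lambda> :: 'a \<times> 'a \<Rightarrow> 'k::field)) w =
    (\<Sum>a\<in>F. \<Sum>y\<in>G. (if rt y a = inv y then bvec (inv y, lt y a \<otimes> a) w else 0) / of_nat (card F))"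
proof -
  let ?B = "(G \<times> F) \<times> (G \<times> F)"
  let ?m = "\<lambda>t. (bvec (fst t) \<otimes>\<^bsub>J\<^esub> bvec (snd t)) w :: 'k"
  have fin: "finite ?B" by simp
  have "tensor_mult J (comult J (\<Lambda> :: 'a \<times> 'a \<Rightarrow> 'k)) w = (\<Sum>t\<in>?B. comult J \<Lambda> t * ?m t)"
    by (simp add: tensor_mult_def lin_ext_def case_prod_unfold)
  also have "\<dots> = (\<Sum>t\<in>?B. \<Sum>a\<in>F. \<Sum>y\<in>G. bvec ((inv y, lt y a), (y, a)) t / of_nat (card F) * ?m t)"
    by (simp add: comult_\<Lambda> sum_distrib_right)
  also have "\<dots> = (\<Sum>a\<in>F. \<Sum>t\<in>?B. \<Sum>y\<in>G. bvec ((inv y, lt y a), (y, a)) t / of_nat (card F) * ?m t)"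
    by (rule sum.swap)
  also have "\<dots> = (\<Sum>a\<in>F. \<Sum>y\<in>G. \<Sum>t\<in>?B. bvec ((inv y, lt y a), (y, a)) t / of_nat (card F) * ?m t)"
    by (intro sum.cong refl sum.swap)
  also have "\<dots> = (\<Sum>a\<in>F. \<Sum>y\<in>G. (if rt y a = inv y then bvec (inv y, lt y a \<otimes> a) w else 0) / of_nat (card F))"
  proof (intro sum.cong refl)
    fix a y assume a: "a \<in> F" and y: "y \<in> G"
    have "(\<Sum>t\<in>?B. bvec ((inv y, lt y a), (y, a)) t / of_nat (card F) * ?m t)
        = (\<Sum>t\<in>?B. if t = ((inv y, lt y a), (y, a)) then ?m t / of_nat (card F) else 0)"
      by (intro sum.cong refl) (auto simp: bvec_def)
    also have "\<dots> = (bvec (inv y, lt y a) \<otimes>\<^bsub>J\<^esub> bvec (y, a)) w / of_nat (card F)"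
      using a y fin by simp
    also have "y = rt (inv y) (lt y a) \<longleftrightarrow> rt y a = inv y"
      using a y inv_inv[of "rt y a"] inv_inv[of y] by (metis inv_rt rt_closed G_carrier)
    then have "(bvec (inv y, lt y a) \<otimes>\<^bsub>J\<^esub> bvec (y, a)) w
        = (if rt y a = inv y then bvec (inv y, lt y a \<otimes> a) w else 0)"
      using a y by (subst bvec_mult_J) auto
    finally show "(\<Sum>t\<in>?B. bvec ((inv y, lt y a), (y, a)) t / of_nat (card F) * ?m t)
        = (if rt y a = inv y then bvec (inv y, lt y a \<otimes> a) w else 0) / of_nat (card F)" .
  qed
  finally show ?thesis .
qed

section \<open>Simple modules of the bismash product\<close>

definition is_char :: "('a \<Rightarrow> 'k::field) \<Rightarrow> bool" where
  "is_char \<rho> \<longleftrightarrow> \<rho> \<one> = 1 \<and> (\<forall>a\<in>F. \<forall>b\<in>F. \<rho> (a \<otimes> b) = \<rho> a * \<rho> b)"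

lemma is_charD:
  assumes "is_char \<rho>"
  shows "\<rho> \<one> = 1" and "a \<in> F \<Longrightarrow> b \<in> F \<Longrightarrow> \<rho> (a \<otimes> b) = \<rho> a * \<rho> b"
  using assms by (auto simp: is_char_def)

lemma char_nonzero:
  assumes "is_char \<rho>" "a \<in> F" shows "\<rho> a \<noteq> 0"
  using is_charD[OF assms(1)] is_charD(2)[OF assms(1), of a "inv a"] assms(2) by auto

text \<open>The module \<open>M(X, \<rho>)\<close> has a basis \<open>v\<^sub>y\<close> indexed by the orbit \<open>X\<close>, on which
  \<open>p\<^sub>y # a\<close> maps \<open>v\<^sub>z\<close> to \<open>\<rho>(a) v\<^sub>y\<close> if \<open>z\<close> is the image of \<open>y\<close> under \<open>a\<close>, and to \<open>0\<close> otherwise.\<close>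

definition orbit_model :: "'a set \<Rightarrow> ('a \<Rightarrow> 'k::field) \<Rightarrow> ('a \<times> 'a \<Rightarrow> 'k, 'a \<Rightarrow> 'k) module" where
  "orbit_model X \<rho> =
     \<lparr> carrier = supported_on X, mult = (\<lambda>g h y. g y * h y), one = (\<lambda>_. 0), zero = (\<lambda>_. 0),
       add = (\<lambda>g h y. g y + h y),
       smult = (\<lambda>h g y. if y \<in> X then \<Sum>a\<in>F. h (y, a) * \<rho> a * g (rt y a) else 0) \<rparr>"

lemma orbit_model_simps [simp]:
  "carrier (orbit_model X \<rho>) = supported_on X" "\<zero>\<^bsub>orbit_model X \<rho>\<^esub> = (\<lambda>_. 0)"
  "g \<oplus>\<^bsub>orbit_model X \<rho>\<^esub> g' = (\<lambda>y. g y + g' y)"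
  by (simp_all add: orbit_model_def)

lemma orbit_model_smult:
  "(h \<odot>\<^bsub>orbit_model X \<rho>\<^esub> g) y = (if y \<in> X then \<Sum>a\<in>F. h (y, a) * \<rho> a * g (rt y a) else 0)"
  by (simp add: orbit_model_def)

lemma bvec_smult:
  assumes "a \<in> F"
  shows "bvec (y, a) \<odot>\<^bsub>orbit_model X \<rho>\<^esub> g = (\<lambda>z. if z = y \<and> y \<in> X then \<rho> a * g (rt y a) else 0)"
proof
  fix z
  have "(\<Sum>b\<in>F. bvec (y, a) (z, b) * \<rho> b * g (rt z b))
      = (\<Sum>b\<in>F. if b = a then (if z = y then \<rho> b * g (rt z b) else 0) else 0)"
    by (intro sum.cong refl) (simp add: bvec_def)
  then show "(bvec (y, a) \<odot>\<^bsub>orbit_model X \<rho>\<^esub> g) z = (if z = y \<and> y \<in> X then \<rho> a * g (rt y a) else 0)"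
    using assms by (auto simp: orbit_model_smult)
qed

lemma scalar_closed: "(\<lambda>u. c * \<one>\<^bsub>J\<^esub> u) \<in> supported_on (G \<times> F)"
  by (auto simp: supported_on_def one_J)

lemma scalar_smult:
  assumes X: "X \<in> orbits" and \<rho>: "is_char \<rho>" and g: "g \<in> supported_on X"
  shows "(\<lambda>u. c * \<one>\<^bsub>J\<^esub> u) \<odot>\<^bsub>orbit_model X \<rho>\<^esub> g = (\<lambda>y. c * g y)"
proof
  fix y
  have "(\<Sum>a\<in>F. c * \<one>\<^bsub>J\<^esub> (y, a) * \<rho> a * g (rt y a)) = (\<Sum>a\<in>F. if a = \<one> then c * g y else 0)"
    if "y \<in> X"
    using orbit_sub[OF X] that is_charD(1)[OF \<rho>] by (intro sum.cong refl) (auto simp: one_J)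
  then show "((\<lambda>u. c * \<one>\<^bsub>J\<^esub> u) \<odot>\<^bsub>orbit_model X \<rho>\<^esub> g) y = c * g y"
    using g by (auto simp: orbit_model_smult supported_on_def)
qed

text \<open>The same translation as for the associativity of J; the character follows it through
  \<rho>(c) = \<rho>(a) \<rho>(inv a c).\<close>

lemma orbit_model_assoc:
  assumes X: "X \<in> orbits" and \<rho>: "is_char \<rho>"
  shows "(h \<otimes>\<^bsub>J\<^esub> h') \<odot>\<^bsub>orbit_model X \<rho>\<^esub> g
    = h \<odot>\<^bsub>orbit_model X \<rho>\<^esub> (h' \<odot>\<^bsub>orbit_model X \<rho>\<^esub> g)"
proof
  fix y
  show "((h \<otimes>\<^bsub>J\<^esub> h') \<odot>\<^bsub>orbit_model X \<rho>\<^esub> g) y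
    = (h \<odot>\<^bsub>orbit_model X \<rho>\<^esub> (h' \<odot>\<^bsub>orbit_model X \<rho>\<^esub> g)) y"
  proof (cases "y \<in> X")
    case False then show ?thesis by (simp add: orbit_model_smult)
  next
    case True
    then have yG: "y \<in> G" using orbit_sub[OF X] by blast
    have "((h \<otimes>\<^bsub>J\<^esub> h') \<odot>\<^bsub>orbit_model X \<rho>\<^esub> g) y
      = (\<Sum>c\<in>F. \<Sum>a\<in>F. h (y, a) * h' (rt y a, inv a \<otimes> c) * \<rho> c * g (rt y c))"
      using True yG by (simp add: orbit_model_smult mult_J sum_distrib_right)
    also have "\<dots> = (\<Sum>a\<in>F. \<Sum>c\<in>F. h (y, a) * h' (rt y a, inv a \<otimes> c) * \<rho> c * g (rt y c))"
      by (rule sum.swap)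
    also have "\<dots> = (\<Sum>a\<in>F. \<Sum>b\<in>F. h (y, a) * h' (rt y a, b) * (\<rho> a * \<rho> b) * g (rt (rt y a) b))"
    proof (rule sum.cong[OF refl])
      fix a assume a: "a \<in> F"
      have "(\<Sum>c\<in>F. h (y, a) * h' (rt y a, inv a \<otimes> c) * \<rho> c * g (rt y c))
        = (\<Sum>c\<in>F. h (y, a) * h' (rt y a, inv a \<otimes> c) * (\<rho> a * \<rho> (inv a \<otimes> c)) *
            g (rt (rt y a) (inv a \<otimes> c)))"
      proof (intro sum.cong refl)
        fix c assume c: "c \<in> F"
        have ac: "a \<otimes> (inv a \<otimes> c) = c" using a c by (simp add: m_assoc[symmetric])
        have "\<rho> c = \<rho> a * \<rho> (inv a \<otimes> c)"
          using is_charD(2)[OF \<rho>, of a "inv a \<otimes> c"] a c by (simp add: ac)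
        moreover have "rt y c = rt (rt y a) (inv a \<otimes> c)"
          using rt_mult[OF yG, of a "inv a \<otimes> c"] a c by (simp add: ac)
        ultimately show "h (y, a) * h' (rt y a, inv a \<otimes> c) * \<rho> c * g (rt y c)
          = h (y, a) * h' (rt y a, inv a \<otimes> c) * (\<rho> a * \<rho> (inv a \<otimes> c)) *
            g (rt (rt y a) (inv a \<otimes> c))" by simp
      qed
      also have "\<dots> = (\<Sum>b\<in>F. h (y, a) * h' (rt y a, b) * (\<rho> a * \<rho> b) * g (rt (rt y a) b))"
        by (rule sum_F_translate[OF a])
      finally show "(\<Sum>c\<in>F. h (y, a) * h' (rt y a, inv a \<otimes> c) * \<rho> c * g (rt y c)) = \<dots>" .
    qed
    also have "\<dots> = (h \<odot>\<^bsub>orbit_model X \<rho>\<^esub> (h' \<odot>\<^bsub>orbit_model X \<rho>\<^esub> g)) y"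
      using True orbit_rt[OF X True] by (simp add: orbit_model_smult sum_distrib_left ac_simps)
    finally show ?thesis .
  qed
qed

lemma left_module_orbit_model:
  fixes \<rho> :: "'a \<Rightarrow> 'k::field"
  assumes X: "X \<in> orbits" and \<rho>: "is_char \<rho>"
  shows "left_module J (orbit_model X \<rho>)"
proof (intro left_module.intro left_module_axioms.intro ring_J)
  let ?M = "orbit_model X \<rho>"
  show "abelian_group ?M"
  proof (rule abelian_groupI)
    fix g assume "g \<in> carrier ?M"
    then show "\<exists>g'\<in>carrier ?M. g' \<oplus>\<^bsub>?M\<^esub> g = \<zero>\<^bsub>?M\<^esub>"
      by (intro bexI[of _ "\<lambda>u. - g u"]) (auto simp: supported_on_def)
  qed (auto simp: supported_on_def algebra_simps)
  fix h h' :: "'a \<times> 'a \<Rightarrow> 'k" and g g' :: "'a \<Rightarrow> 'k"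
  show "h \<odot>\<^bsub>?M\<^esub> g \<in> carrier ?M"
    by (simp add: supported_on_def orbit_model_smult)
  show "(h \<oplus>\<^bsub>J\<^esub> h') \<odot>\<^bsub>?M\<^esub> g = h \<odot>\<^bsub>?M\<^esub> g \<oplus>\<^bsub>?M\<^esub> h' \<odot>\<^bsub>?M\<^esub> g"
    by (auto simp: fun_eq_iff orbit_model_smult algebra_simps sum.distrib)
  show "h \<odot>\<^bsub>?M\<^esub> (g \<oplus>\<^bsub>?M\<^esub> g') = h \<odot>\<^bsub>?M\<^esub> g \<oplus>\<^bsub>?M\<^esub> h \<odot>\<^bsub>?M\<^esub> g'"
    by (auto simp: fun_eq_iff orbit_model_smult algebra_simps sum.distrib)
  show "(h \<otimes>\<^bsub>J\<^esub> h') \<odot>\<^bsub>?M\<^esub> g = h \<odot>\<^bsub>?M\<^esub> (h' \<odot>\<^bsub>?M\<^esub> g)"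
    by (rule orbit_model_assoc[OF X \<rho>])
  show "g \<in> carrier ?M \<Longrightarrow> \<one>\<^bsub>J\<^esub> \<odot>\<^bsub>?M\<^esub> g = g"
    using scalar_smult[OF X \<rho>, of g 1] by simp
qed

text \<open>Every nonzero vector is cyclic. For each y choose s y in F carrying y to z; then p_y # s
  y moves the z-coordinate of g to the place y, and the coefficients of h cancel the factor \<rho>(s
  y) g(z).\<close>

lemma orbit_model_generated:
  assumes X: "X \<in> orbits" and \<rho>: "is_char \<rho>" and z: "z \<in> X" "g z \<noteq> 0"
    and g': "g' \<in> supported_on X"
  shows "\<exists>h\<in>supported_on (G \<times> F). h \<odot>\<^bsub>orbit_model X \<rho>\<^esub> g = g'"
proof -
  have "\<exists>a\<in>F. rt y a = z" if "y \<in> X" for y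
    using orbit_eq[OF X that] z unfolding ract_orbit_def by auto
  then obtain s where s: "\<And>y. y \<in> X \<Longrightarrow> s y \<in> F" "\<And>y. y \<in> X \<Longrightarrow> rt y (s y) = z" by metis
  define h where "h = (\<lambda>(y, a). if y \<in> X \<and> a = s y then g' y / (\<rho> a * g z) else 0)"
  have "h \<in> supported_on (G \<times> F)"
    using s orbit_sub[OF X] by (auto simp: supported_on_def h_def)
  moreover have "h \<odot>\<^bsub>orbit_model X \<rho>\<^esub> g = g'"
  proof
    fix y
    have "(\<Sum>a\<in>F. h (y, a) * \<rho> a * g (rt y a)) = (\<Sum>a\<in>F. if a = s y then g' y else 0)" if "y \<in> X"
      using s[OF that] that z char_nonzero[OF \<rho>] by (intro sum.cong refl) (simp add: h_def)
    then show "(h \<odot>\<^bsub>orbit_model X \<rho>\<^esub> g) y = g' y"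
      using s g' by (auto simp: orbit_model_smult supported_on_def)
  qed
  ultimately show ?thesis by blast
qed

lemma simple_orbit_model:
  assumes X: "X \<in> orbits" and \<rho>: "is_char \<rho>"
  shows "orbit_model X \<rho> \<in> simple_modules J"
  unfolding simple_modules_def
proof (intro CollectI conjI allI impI)
  let ?M = "orbit_model X \<rho>"
  show "left_module J ?M" by (rule left_module_orbit_model[OF assms])
  obtain z where z: "z \<in> X" using orbit_nonempty[OF X] by blast
  have "bvec z \<in> carrier ?M" using z by (auto simp: supported_on_def bvec_def)
  moreover have "bvec z \<noteq> \<zero>\<^bsub>?M\<^esub>" by (auto simp: bvec_def fun_eq_iff)
  ultimately show "carrier ?M \<noteq> {\<zero>\<^bsub>?M\<^esub>}" by blast
  fix N assume "Module.submodule N J ?M"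
  then interpret N: Module.submodule N J ?M .
  show "N = {\<zero>\<^bsub>?M\<^esub>} \<or> N = carrier ?M"
  proof (cases "N = {\<zero>\<^bsub>?M\<^esub>}")
    case False
    moreover have "\<zero>\<^bsub>?M\<^esub> \<in> N" using N.one_closed by simp
    ultimately obtain g where g: "g \<in> N" "g \<noteq> (\<lambda>_. 0)" by auto
    have NM: "N \<subseteq> supported_on X" using N.subset by simp
    obtain z where z: "g z \<noteq> 0" using g(2) by blast
    then have "z \<in> X" using g(1) NM by (auto simp: supported_on_def)
    have "g' \<in> N" if g': "g' \<in> supported_on X" for g'
    proof -
      obtain h where "h \<in> supported_on (G \<times> F)" "h \<odot>\<^bsub>?M\<^esub> g = g'"
        using orbit_model_generated[where g = g, OF X \<rho> \<open>z \<in> X\<close> z g'] by blast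
      then show ?thesis using N.smult_closed[of h g] g(1) by simp
    qed
    then show ?thesis using NM by auto
  qed simp
qed

text \<open>The idempotent p_y # 1 detects the orbit: it fixes the basis vector at y if y lies in X,
  and kills the whole model of X' if y does not lie in X'.\<close>

lemma orbit_model_iso_subset:
  assumes X: "X \<in> orbits" and iso: "module_isomorphic J (orbit_model X \<rho>) (orbit_model X' \<rho>')"
    and \<rho>: "is_char \<rho>"
  shows "X \<subseteq> X'"
proof
  fix y assume y: "y \<in> X"
  let ?M = "orbit_model X \<rho>" and ?N = "orbit_model X' \<rho>'"
  obtain f where lm: "left_module J ?M" "left_module J ?N"
    and f: "f \<in> module_hom J ?M ?N" and b: "bij_betw f (carrier ?M) (carrier ?N)"
    using iso unfolding module_isomorphic_def by blast
  have d: "bvec y \<in> carrier ?M" using y by (auto simp: supported_on_def bvec_def)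
  have yG: "y \<in> G" using y orbit_sub[OF X] by blast
  have p: "bvec (y, \<one>) \<in> carrier J" using yG by (auto simp: supported_on_def bvec_def)
  have "bvec (y, \<one>) \<odot>\<^bsub>?M\<^esub> bvec y = bvec y"
    using y yG is_charD(1)[OF \<rho>] by (simp add: bvec_smult) (auto simp: bvec_def)
  then have e: "bvec (y, \<one>) \<odot>\<^bsub>?N\<^esub> f (bvec y) = f (bvec y)"
    using module_hom_smult[OF f p d] by simp
  show "y \<in> X'"
  proof (rule ccontr)
    assume "y \<notin> X'"
    then have "bvec (y, \<one>) \<odot>\<^bsub>?N\<^esub> f (bvec y) = (\<lambda>_. 0)" by (simp add: bvec_smult)
    then have "f (bvec y) = f \<zero>\<^bsub>?M\<^esub>" using e module_hom_zero[OF lm f] by simp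
    then have "bvec y = (\<lambda>_. 0 :: 'b)"
      using inj_onD[OF bij_betw_imp_inj_on[OF b], of "bvec y" "\<zero>\<^bsub>?M\<^esub>"] d
      by (simp add: supported_on_def)
    then have "(bvec y y :: 'b) = 0" by simp
    then show False by (simp add: bvec_def)
  qed
qed

lemma orbit_model_iso_eq:
  assumes X: "X \<in> orbits" "X' \<in> orbits"
    and iso: "module_isomorphic J (orbit_model X \<rho>) (orbit_model X' \<rho>')"
    and \<rho>: "is_char \<rho>" "is_char \<rho>'"
  shows "X = X'"
  using orbit_model_iso_subset[OF X(1) iso \<rho>(1)]
    orbit_model_iso_subset[OF X(2) module_isomorphic_sym[OF iso] \<rho>(2)] by blast

text \<open>On a one-point orbit p_x # a acts as the scalar \<rho>(a). Scalars act through J itself,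
  so an isomorphism preserves them and \<rho>(a) can be read off.\<close>

lemma orbit_model_iso_char:
  fixes \<rho> :: "'a \<Rightarrow> 'k::field"
  assumes X: "{x} \<in> orbits" and \<rho>: "is_char \<rho>" "is_char \<rho>'"
    and iso: "module_isomorphic J (orbit_model {x} \<rho>) (orbit_model {x} \<rho>')" and a: "a \<in> F"
  shows "\<rho> a = \<rho>' a"
proof -
  let ?M = "orbit_model {x} \<rho>" and ?N = "orbit_model {x} \<rho>'"
  let ?s = "\<lambda>c. (\<lambda>u. c * \<one>\<^bsub>J\<^esub> u) :: 'a \<times> 'a \<Rightarrow> 'k"
  obtain f where lm: "left_module J ?M" "left_module J ?N"
    and f: "f \<in> module_hom J ?M ?N" and b: "bij_betw f (carrier ?M) (carrier ?N)"
    using iso unfolding module_isomorphic_def by blast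
  have xG: "x \<in> G" and fix_x: "rt x a = x"
    using orbit_sub[OF X] orbit_rt[OF X, of x a] a by auto
  have s: "?s c \<in> carrier J" for c
    using scalar_closed by simp
  have p: "bvec (x, a) \<in> carrier J"
    using xG a by (auto simp: supported_on_def bvec_def)
  have scal: "bvec (x, a) \<odot>\<^bsub>orbit_model {x} \<sigma>\<^esub> g = ?s (\<sigma> a) \<odot>\<^bsub>orbit_model {x} \<sigma>\<^esub> g"
    if \<sigma>: "is_char \<sigma>" and g: "g \<in> supported_on {x}" for \<sigma> g
    using a g fix_x by (auto simp: bvec_smult scalar_smult[OF X \<sigma> g] supported_on_def fun_eq_iff)
  define \<delta> where "\<delta> = (bvec x :: 'a \<Rightarrow> 'k)"
  have d: "\<delta> \<in> supported_on {x}" by (auto simp: \<delta>_def supported_on_def bvec_def)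
  have fd: "f \<delta> \<in> supported_on {x}" using bij_betwE[OF b] d by simp
  have "?s (\<rho> a) \<odot>\<^bsub>?N\<^esub> f \<delta> = f (bvec (x, a) \<odot>\<^bsub>?M\<^esub> \<delta>)"
    using module_hom_smult[OF f s, of \<delta>] scal[OF \<rho>(1) d] d by simp
  also have "\<dots> = ?s (\<rho>' a) \<odot>\<^bsub>?N\<^esub> f \<delta>"
    using module_hom_smult[OF f p, of \<delta>] scal[OF \<rho>(2) fd] d by simp
  finally have "(\<lambda>y. \<rho> a * f \<delta> y) = (\<lambda>y. \<rho>' a * f \<delta> y)"
    by (simp add: scalar_smult[OF X \<rho>(2) fd])
  then have eq: "\<rho> a * f \<delta> x = \<rho>' a * f \<delta> x" by (rule fun_cong)
  have "f \<delta> x \<noteq> 0"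
  proof
    assume 0: "f \<delta> x = 0"
    have "f \<delta> y = 0" for y using fd 0 by (cases "y = x") (auto simp: supported_on_def)
    then have "f \<delta> = f \<zero>\<^bsub>?M\<^esub>" using module_hom_zero[OF lm f] by (simp add: fun_eq_iff)
    then have "\<delta> = (\<lambda>_. 0)"
      using inj_onD[OF bij_betw_imp_inj_on[OF b], of "\<delta>" "\<zero>\<^bsub>?M\<^esub>"] d
      by (simp add: supported_on_def)
    then have "\<delta> x = 0" by simp
    then show False by (simp add: \<delta>_def bvec_def)
  qed
  with eq show ?thesis by simp
qed

text \<open>The module \<open>M(X, \<rho>)\<close> embeds into \<open>J\<close> as a left ideal; \<open>x\<close> is a base point of \<open>X\<close>.\<close>

definition ideal_embed :: "'a \<Rightarrow> ('a \<Rightarrow> 'k::field) \<Rightarrow> ('a \<Rightarrow> 'k) \<Rightarrow> 'a \<times> 'a \<Rightarrow> 'k" where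
  "ideal_embed x \<rho> g = (\<lambda>(y, b). if y \<in> G \<and> b \<in> F \<and> rt y b = x then g y / \<rho> b else 0)"

lemma ideal_embed_closed: "ideal_embed x \<rho> g \<in> supported_on (G \<times> F)"
  by (auto simp: supported_on_def ideal_embed_def)

text \<open>Both ingredients of the embedding are compatible with the product: acting by a and then
  by inv a c is acting by c, so the condition of ending at x is kept, and 1/\<rho>(inv a c) =
  \<rho>(a)/\<rho>(c) produces the weight \<rho>(a) of the action on the model.\<close>

lemma ideal_embed_smult:
  assumes x: "x \<in> G" and \<rho>: "is_char \<rho>"
  shows "ideal_embed x \<rho> (h \<odot>\<^bsub>orbit_model (orb x) \<rho>\<^esub> g) = h \<otimes>\<^bsub>J\<^esub> ideal_embed x \<rho> g"
proof
  fix u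
  show "ideal_embed x \<rho> (h \<odot>\<^bsub>orbit_model (orb x) \<rho>\<^esub> g) u = (h \<otimes>\<^bsub>J\<^esub> ideal_embed x \<rho> g) u"
  proof (cases u)
    case (Pair z c)
    show ?thesis
    proof (cases "z \<in> G \<and> c \<in> F")
      case False
      then show ?thesis unfolding Pair mult_J by (auto simp: ideal_embed_def)
    next
      case True
      have t: "rt (rt z a) (inv a \<otimes> c) = rt z c" "\<rho> c = \<rho> a * \<rho> (inv a \<otimes> c)" if "a \<in> F" for a
      proof -
        have ac: "a \<otimes> (inv a \<otimes> c) = c" using that True by (simp add: m_assoc[symmetric])
        show "rt (rt z a) (inv a \<otimes> c) = rt z c"
          using rt_mult[of z a "inv a \<otimes> c"] that True by (simp add: ac)
        show "\<rho> c = \<rho> a * \<rho> (inv a \<otimes> c)"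
          using is_charD(2)[OF \<rho>, of a "inv a \<otimes> c"] that True by (simp add: ac)
      qed
      have "(h \<otimes>\<^bsub>J\<^esub> ideal_embed x \<rho> g) (z, c)
          = (\<Sum>a\<in>F. h (z, a) * (if rt z c = x then g (rt z a) / \<rho> (inv a \<otimes> c) else 0))"
        using True by (simp add: mult_J ideal_embed_def t(1))
      also have "\<dots> = (if rt z c = x then (\<Sum>a\<in>F. h (z, a) * \<rho> a * g (rt z a)) / \<rho> c else 0)"
      proof -
        have "v / \<rho> (inv a \<otimes> c) = \<rho> a * v / \<rho> c" if "a \<in> F" for a v
          unfolding t(2)[OF that] using char_nonzero[OF \<rho> that] by simp
        then show ?thesis by (auto simp: sum_divide_distrib mult.assoc intro!: sum.cong)
      qed
      also have "\<dots> = ideal_embed x \<rho> (h \<odot>\<^bsub>orbit_model (orb x) \<rho>\<^esub> g) (z, c)"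
      proof -
        \<comment> \<open>The action on the model is cut off outside the orbit, while the product in
          J is not; ending at x already forces z into the orbit.\<close>
        have "z \<in> orb x" if "rt z c = x"
          using rt_in_orb[of "inv c" "rt z c"] rt_inv[of z c] True that by simp
        then show ?thesis using True by (simp add: ideal_embed_def orbit_model_smult)
      qed
      finally show ?thesis by (simp add: Pair)
    qed
  qed
qed

text \<open>The orbit map h -> h w from J to M is J-linear; this is its restriction to the left
  ideal.\<close>

lemma ideal_embed_hom:
  fixes \<rho> :: "'a \<Rightarrow> 'k::field"
  assumes M: "left_module J M" and w: "w \<in> carrier M" and x: "x \<in> G" and \<rho>: "is_char \<rho>"
  shows "(\<lambda>g. ideal_embed x \<rho> g \<odot>\<^bsub>M\<^esub> w) \<in> module_hom J (orbit_model (orb x) \<rho>) M"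
proof -
  interpret M: left_module J M by (rule M)
  have add: "ideal_embed x \<rho> (\<lambda>y. g y + g' y) = ideal_embed x \<rho> g \<oplus>\<^bsub>J\<^esub> ideal_embed x \<rho> g'" for g g'
    by (auto simp: ideal_embed_def fun_eq_iff add_divide_distrib)
  show ?thesis
  proof (rule module_homI)
    fix g g' assume "g \<in> carrier (orbit_model (orb x) \<rho>)" "g' \<in> carrier (orbit_model (orb x) \<rho>)"
    show "ideal_embed x \<rho> (g \<oplus>\<^bsub>orbit_model (orb x) \<rho>\<^esub> g') \<odot>\<^bsub>M\<^esub> w
        = ideal_embed x \<rho> g \<odot>\<^bsub>M\<^esub> w \<oplus>\<^bsub>M\<^esub> ideal_embed x \<rho> g' \<odot>\<^bsub>M\<^esub> w"
      using M.smult_l_distr[of "ideal_embed x \<rho> g" "ideal_embed x \<rho> g'" w] w add[of g g']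
      by (simp add: ideal_embed_closed)
  next
    fix h :: "'a \<times> 'a \<Rightarrow> 'k" and g assume "h \<in> carrier J"
    then show "ideal_embed x \<rho> (h \<odot>\<^bsub>orbit_model (orb x) \<rho>\<^esub> g) \<odot>\<^bsub>M\<^esub> w = h \<odot>\<^bsub>M\<^esub> (ideal_embed x \<rho> g \<odot>\<^bsub>M\<^esub> w)"
      using M.smult_assoc1[of h "ideal_embed x \<rho> g" w] w
      by (simp add: ideal_embed_smult[OF x \<rho>] ideal_embed_closed)
  qed (use w M.smult_closed in \<open>auto simp: ideal_embed_closed\<close>)
qed

lemma sum_smult_eq_zero:
  fixes M :: "('a \<times> 'a \<Rightarrow> 'k::field, 'v) module"
  assumes M: "left_module J M" and w: "w \<in> carrier M" and A: "finite A"
    and h: "\<And>i. i \<in> A \<Longrightarrow> h i \<in> supported_on (G \<times> F) \<and> h i \<odot>\<^bsub>M\<^esub> w = \<zero>\<^bsub>M\<^esub>"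
  shows "(\<lambda>u. \<Sum>i\<in>A. h i u) \<odot>\<^bsub>M\<^esub> w = \<zero>\<^bsub>M\<^esub>"
proof -
  interpret M: left_module J M by (rule M)
  from A h show ?thesis
  proof (induction A rule: finite_induct)
    case empty
    then show ?case using M.zero_smult[OF w] by simp
  next
    case (insert i A)
    have "(\<lambda>u. \<Sum>i\<in>A. h i u) \<in> carrier J"
      using insert.prems by (auto simp: supported_on_def intro!: sum.neutral)
    then show ?case
      using insert M.smult_l_distr[of "h i" "\<lambda>u. \<Sum>i\<in>A. h i u" w] w by simp
  qed
qed

text \<open>A nonzero \<open>w \<in> M\<close> is not killed by all \<open>p\<^sub>x # 1\<close>, as these sum to \<open>1\<close>; so one of the left ideals
  acts nontrivially on \<open>w\<close>, and Schur's lemma applies to its orbit map.\<close>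

lemma simple_module_cover:
  fixes M :: "('a \<times> 'a \<Rightarrow> 'k::field, 'v) module"
  assumes M: "M \<in> simple_modules J"
    and span: "\<And>x. x \<in> G \<Longrightarrow> \<exists>P g. finite P \<and> (\<forall>\<rho>\<in>P. is_char \<rho> \<and> (x, \<rho>) \<in> T) \<and>
       g \<in> supported_on (orb x) \<and> bvec (x, \<one>) = (\<lambda>u. \<Sum>\<rho>\<in>P. ideal_embed x \<rho> g u :: 'k)"
  shows "\<exists>(x, \<rho>)\<in>T. x \<in> G \<and> module_isomorphic J (orbit_model (orb x) \<rho>) M"
proof (rule ccontr)
  assume none: "\<not> ?thesis"
  note lm = simple_modulesD(1)[OF M]
  interpret M: left_module J M by (rule lm)
  obtain w where w: "w \<in> carrier M" "w \<noteq> \<zero>\<^bsub>M\<^esub>"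
    using simple_modulesD(2)[OF M] M.zero_closed by blast
  have "bvec (x, \<one>) \<odot>\<^bsub>M\<^esub> w = \<zero>\<^bsub>M\<^esub>" if x: "x \<in> G" for x
  proof -
    obtain P g where P: "finite P" "\<And>\<rho>. \<rho> \<in> P \<Longrightarrow> is_char \<rho> \<and> (x, \<rho>) \<in> T"
      and g: "g \<in> supported_on (orb x)"
      and sum: "bvec (x, \<one>) = (\<lambda>u. \<Sum>\<rho>\<in>P. ideal_embed x \<rho> g u :: 'k)"
      using span[OF x] by blast
    have "ideal_embed x \<rho> g \<odot>\<^bsub>M\<^esub> w = \<zero>\<^bsub>M\<^esub>" if "\<rho> \<in> P" for \<rho>
    proof (rule ccontr)
      assume ne: "ideal_embed x \<rho> g \<odot>\<^bsub>M\<^esub> w \<noteq> \<zero>\<^bsub>M\<^esub>"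
      have \<rho>: "is_char \<rho>" "(x, \<rho>) \<in> T" using P(2)[OF that] by auto
      have "orb x \<in> orbits" using x by (simp add: orbits_def)
      from schur[OF simple_orbit_model[OF this \<rho>(1)] M ideal_embed_hom[OF lm w(1) x \<rho>(1)], of g]
      have "module_isomorphic J (orbit_model (orb x) \<rho>) M" using g ne by simp
      with none \<rho>(2) x show False by blast
    qed
    then show ?thesis
      unfolding sum by (intro sum_smult_eq_zero[OF lm w(1) P(1)]) (simp add: ideal_embed_closed)
  qed
  then have "(\<lambda>u. \<Sum>x\<in>G. bvec (x, \<one>) u) \<odot>\<^bsub>M\<^esub> w = \<zero>\<^bsub>M\<^esub>"
    by (intro sum_smult_eq_zero[OF lm w(1)]) (auto simp: supported_on_def bvec_def)
  moreover have "(\<lambda>u. \<Sum>x\<in>G. bvec (x, \<one>) u) = (\<one>\<^bsub>J\<^esub> :: 'a \<times> 'a \<Rightarrow> 'k)" by (simp add: bismash_def)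
  ultimately show False using M.smult_one w by simp
qed

section \<open>Dimension, character and indicator of the orbit modules\<close>

lemma vectorspace_underlying:
  fixes M :: "('a \<times> 'a \<Rightarrow> 'k::field, 'v) module"
  assumes "left_module J M"
  shows "vectorspace (class_ring :: 'k ring) (underlying_space J M)"
proof -
  interpret M: left_module J M by fact
  let ?s = "\<lambda>c. (\<lambda>u. c * \<one>\<^bsub>J\<^esub> u) :: 'a \<times> 'a \<Rightarrow> 'k"
  have s: "?s c \<in> carrier J" for c
    using scalar_closed by simp
  have sadd: "?s c \<oplus>\<^bsub>J\<^esub> ?s d = ?s (c + d)" for c d by (simp add: algebra_simps)
  have smul: "?s c \<otimes>\<^bsub>J\<^esub> ?s d = ?s (c * d)" for c d
    using scalar_mult_J[of "?s d" c] s[of d] by (simp add: mult.assoc)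
  show ?thesis
  proof (rule vs_criteria)
    show "field (class_ring :: 'k ring)" by (rule class_field)
    show "\<forall>v\<in>carrier (underlying_space J M). \<exists>w\<in>carrier (underlying_space J M).
        v \<oplus>\<^bsub>underlying_space J M\<^esub> w = \<zero>\<^bsub>underlying_space J M\<^esub>"
      using M.r_neg by (auto simp: underlying_space_def)
    show "\<forall>a b v. a \<in> carrier class_ring \<and> b \<in> carrier class_ring \<and> v \<in> carrier (underlying_space J M) \<longrightarrow>
       (a \<otimes>\<^bsub>class_ring\<^esub> b) \<odot>\<^bsub>underlying_space J M\<^esub> v =
       a \<odot>\<^bsub>underlying_space J M\<^esub> (b \<odot>\<^bsub>underlying_space J M\<^esub> v)"
      using M.smult_assoc1[OF s s] smul by (simp add: underlying_space_def)
    show "\<forall>a b v. a \<in> carrier class_ring \<and> b \<in> carrier class_ring \<and> v \<in> carrier (underlying_space J M) \<longrightarrow>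
       (a \<oplus>\<^bsub>class_ring\<^esub> b) \<odot>\<^bsub>underlying_space J M\<^esub> v =
       a \<odot>\<^bsub>underlying_space J M\<^esub> v \<oplus>\<^bsub>underlying_space J M\<^esub> b \<odot>\<^bsub>underlying_space J M\<^esub> v"
      using M.smult_l_distr[OF s s] sadd by (simp add: underlying_space_def)
    show "\<forall>v\<in>carrier (underlying_space J M). \<one>\<^bsub>class_ring\<^esub> \<odot>\<^bsub>underlying_space J M\<^esub> v = v"
      using M.smult_one by (simp add: underlying_space_def)
  qed (use M.smult_closed[OF s] M.smult_r_distr[OF s] in
      \<open>auto simp: underlying_space_def M.a_ac\<close>)
qed

text \<open>Scalars act through elements of J, so an isomorphism of J-modules is linear over k and
  turns the orbit into a set of coordinates of M.\<close>

lemma coordinatized_underlying: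
  fixes M :: "('a \<times> 'a \<Rightarrow> 'k::field, 'v) module"
  assumes X: "X \<in> orbits" and \<rho>: "is_char \<rho>" and M: "left_module J M"
    and f: "f \<in> module_hom J (orbit_model X \<rho>) M"
    and b: "bij_betw f (carrier (orbit_model X \<rho>)) (carrier M)"
  shows "coordinatized (underlying_space J M) X f"
proof -
  have s: "(\<lambda>u. c * \<one>\<^bsub>J\<^esub> u) \<in> carrier (J :: ('a \<times> 'a, 'k) based_hopf)" for c
    using scalar_closed by simp
  show ?thesis
  proof (intro coordinatized.intro coordinatized_axioms.intro vectorspace_underlying[OF M])
    show "finite X" by (rule orbit_finite[OF X])
    show "bij_betw f (supported_on X) (carrier (underlying_space J M))"
      using b by (simp add: underlying_space_def)
    fix g h :: "'a \<Rightarrow> 'k" assume g: "g \<in> supported_on X"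
    show "f (\<lambda>i. c * g i) = c \<odot>\<^bsub>underlying_space J M\<^esub> f g" for c
      using module_hom_smult[OF f s, of g c] g scalar_smult[OF X \<rho> g, of c]
      by (simp add: underlying_space_def)
    assume "h \<in> supported_on X"
    then show "f (\<lambda>i. g i + h i) = f g \<oplus>\<^bsub>underlying_space J M\<^esub> f h"
      using module_hom_add[OF f, of g h] g by (simp add: underlying_space_def)
  qed
qed

lemma has_dim_orbit_model:
  assumes X: "X \<in> orbits" and \<rho>: "is_char \<rho>" and iso: "module_isomorphic J (orbit_model X \<rho>) M"
  shows "has_dim J M d \<longleftrightarrow> d = card X"
proof -
  obtain f where "left_module J M" "f \<in> module_hom J (orbit_model X \<rho>) M"
    "bij_betw f (carrier (orbit_model X \<rho>)) (carrier M)"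
    using iso unfolding module_isomorphic_def by blast
  then interpret coordinatized "underlying_space J M" X f
    by (rule coordinatized_underlying[OF X \<rho>])
  show ?thesis using fin_dim dim_eq by (auto simp: has_dim_def)
qed

text \<open>In the basis indexed by X, the only possible diagonal entry of p_y # a is at y, where it
  is \<rho>(a) if a fixes y and 0 otherwise.\<close>

lemma character_orbit_model:
  fixes M :: "('a \<times> 'a \<Rightarrow> 'k::field, 'v) module"
  assumes X: "X \<in> orbits" and \<rho>: "is_char \<rho>" and iso: "module_isomorphic J (orbit_model X \<rho>) M"
    and h: "h \<in> supported_on (G \<times> F)"
  shows "character J M h = (\<Sum>y\<in>X. \<Sum>a\<in>F. h (y, a) * \<rho> a * (if rt y a = y then 1 else 0))"
proof -
  obtain f where M: "left_module J M" and f: "f \<in> module_hom J (orbit_model X \<rho>) M"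
    and b: "bij_betw f (carrier (orbit_model X \<rho>)) (carrier M)"
    using iso unfolding module_isomorphic_def by blast
  then interpret V: coordinatized "underlying_space J M" X f
    using coordinatized_underlying[OF X \<rho>] by blast
  interpret M: left_module J M by (rule M)
  interpret N: left_module J "orbit_model X \<rho>" by (rule left_module_orbit_model[OF X \<rho>])
  have s: "(\<lambda>u. c * \<one>\<^bsub>J\<^esub> u) \<in> carrier (J :: ('a \<times> 'a, 'k) based_hopf)" for c
    using scalar_closed by simp
  have hJ: "h \<in> carrier J" using h by simp
  have "character J M h = (\<Sum>y\<in>X. V.\<kappa> (h \<odot>\<^bsub>M\<^esub> f (bvec y)) y)"
    unfolding character_def
  proof (rule V.lin_trace_eq)
    fix c v assume v: "v \<in> carrier (underlying_space J M)"
    have "h \<otimes>\<^bsub>J\<^esub> (\<lambda>u. c * \<one>\<^bsub>J\<^esub> u) = (\<lambda>u. c * \<one>\<^bsub>J\<^esub> u) \<otimes>\<^bsub>J\<^esub> h"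
      by (simp add: scalar_mult_J[OF h] mult_J_scalar[OF h])
    then show "h \<odot>\<^bsub>M\<^esub> (c \<odot>\<^bsub>underlying_space J M\<^esub> v) = c \<odot>\<^bsub>underlying_space J M\<^esub> (h \<odot>\<^bsub>M\<^esub> v)"
      using M.smult_assoc1[OF hJ s, of v c] M.smult_assoc1[OF s hJ, of v c] v
      by (simp add: underlying_space_def)
  qed (use M.smult_closed[OF hJ] M.smult_r_distr[OF hJ] in \<open>auto simp: underlying_space_def\<close>)
  also have "\<dots> = (\<Sum>y\<in>X. (h \<odot>\<^bsub>orbit_model X \<rho>\<^esub> bvec y) y)"
  proof (rule sum.cong[OF refl])
    fix y assume "y \<in> X"
    then have d: "(bvec y :: 'a \<Rightarrow> 'k) \<in> carrier (orbit_model X \<rho>)"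
      by (auto simp: supported_on_def bvec_def)
    then have "h \<odot>\<^bsub>M\<^esub> f (bvec y) = f (h \<odot>\<^bsub>orbit_model X \<rho>\<^esub> bvec y)"
      using module_hom_smult[OF f hJ d] by simp
    then show "V.\<kappa> (h \<odot>\<^bsub>M\<^esub> f (bvec y)) y = (h \<odot>\<^bsub>orbit_model X \<rho>\<^esub> bvec y) y"
      using V.\<kappa>_\<phi>[of "h \<odot>\<^bsub>orbit_model X \<rho>\<^esub> bvec y"] N.smult_closed[OF hJ d] by simp
  qed
  also have "\<dots> = (\<Sum>y\<in>X. \<Sum>a\<in>F. h (y, a) * \<rho> a * (if rt y a = y then 1 else 0))"
    by (intro sum.cong refl) (simp add: orbit_model_smult bvec_def)
  finally show ?thesis .
qed

text \<open>Every surviving term of \<open>\<Lambda>12\<close> is diagonal: if rt y a = inv y, then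
  lt y a carries inv y to y, and a carries y back to inv y. So it contributes \<rho>(lt y a
  \<otimes> a) as soon as inv y lies in X.\<close>

lemma indicator_orbit_model:
  fixes M :: "('a \<times> 'a \<Rightarrow> 'k::field_char_0, 'v) module"
  assumes X: "X \<in> orbits" and \<rho>: "is_char \<rho>" and iso: "module_isomorphic J (orbit_model X \<rho>) M"
  shows "indicator_FS J M
    = (\<Sum>y\<in>G. \<Sum>a\<in>F. if inv y \<in> X \<and> rt y a = inv y then \<rho> (lt y a \<otimes> a) else 0) / of_nat (card F)"
proof -
  let ?n = "of_nat (card F) :: 'k"
  define D where "D = tensor_mult J (comult J (\<Lambda> :: 'a \<times> 'a \<Rightarrow> 'k))"
  define t where "t a y w = (if rt y a = inv y then bvec (inv y, lt y a \<otimes> a) w else 0 :: 'k)" for a y w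
  have D: "D w = (\<Sum>a\<in>F. \<Sum>y\<in>G. t a y w / ?n)" for w
    unfolding D_def \<Lambda>12 t_def by simp
  have "t a y u = 0" if "a \<in> F" "y \<in> G" "u \<notin> G \<times> F" for a y u
    using that by (auto simp: t_def bvec_def)
  then have DJ: "D \<in> supported_on (G \<times> F)"
    unfolding supported_on_def by (auto simp: D intro!: sum.neutral)
  let ?S = "SIGMA z:X. F"
  let ?e = "\<lambda>(z, b). \<rho> b * (if rt z b = z then 1 else 0)"
  have one: "(\<Sum>u\<in>?S. t a y u * ?e u) = (if inv y \<in> X \<and> rt y a = inv y then \<rho> (lt y a \<otimes> a) else 0)"
    if a: "a \<in> F" and y: "y \<in> G" for a y
  proof -
    let ?u = "(inv y, lt y a \<otimes> a)"
    have "(\<Sum>u\<in>?S. t a y u * ?e u) = (\<Sum>u\<in>?S. if u = ?u then (if rt y a = inv y then ?e ?u else 0) else 0)"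
      by (intro sum.cong refl) (auto simp: t_def bvec_def)
    also have "\<dots> = (if inv y \<in> X \<and> rt y a = inv y then ?e ?u else 0)"
      using orbit_finite[OF X] a y by (auto simp: sum.delta)
    also have "rt (inv y) (lt y a \<otimes> a) = inv y" if "rt y a = inv y"
      using a y that by (simp add: rt_mult inv_rt)
    then have "(if inv y \<in> X \<and> rt y a = inv y then ?e ?u else 0)
        = (if inv y \<in> X \<and> rt y a = inv y then \<rho> (lt y a \<otimes> a) else 0)" by simp
    finally show ?thesis .
  qed
  have "indicator_FS J M = (\<Sum>z\<in>X. \<Sum>b\<in>F. D (z, b) * \<rho> b * (if rt z b = z then 1 else 0))"
    unfolding indicator_FS_def normalized_integral_J D_def[symmetric]
    by (rule character_orbit_model[OF X \<rho> iso DJ])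
  also have "\<dots> = (\<Sum>u\<in>?S. D u * ?e u)"
    using orbit_finite[OF X] by (subst sum.Sigma) (auto simp: case_prod_unfold mult.assoc)
  also have "\<dots> = (\<Sum>u\<in>?S. \<Sum>a\<in>F. \<Sum>y\<in>G. t a y u * ?e u / ?n)"
    by (simp add: D sum_distrib_right)
  also have "\<dots> = (\<Sum>a\<in>F. \<Sum>u\<in>?S. \<Sum>y\<in>G. t a y u * ?e u / ?n)"
    by (rule sum.swap)
  also have "\<dots> = (\<Sum>a\<in>F. \<Sum>y\<in>G. \<Sum>u\<in>?S. t a y u * ?e u / ?n)"
    by (intro sum.cong refl sum.swap)
  also have "\<dots> = (\<Sum>a\<in>F. \<Sum>y\<in>G. (\<Sum>u\<in>?S. t a y u * ?e u) / ?n)"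
    by (simp add: sum_divide_distrib)
  also have "\<dots> = (\<Sum>a\<in>F. \<Sum>y\<in>G. (if inv y \<in> X \<and> rt y a = inv y then \<rho> (lt y a \<otimes> a) else 0) / ?n)"
    by (intro sum.cong refl) (simp only: one)
  also have "\<dots> = (\<Sum>y\<in>G. \<Sum>a\<in>F. (if inv y \<in> X \<and> rt y a = inv y then \<rho> (lt y a \<otimes> a) else 0) / ?n)"
    by (rule sum.swap)
  also have "\<dots> = (\<Sum>y\<in>G. \<Sum>a\<in>F. if inv y \<in> X \<and> rt y a = inv y then \<rho> (lt y a \<otimes> a) else 0) / ?n"
    by (simp add: sum_divide_distrib)
  finally show ?thesis .
qed

end

section \<open>A factor of odd prime order\<close>

lemma even_card_involution:
  assumes "finite A" and "\<And>x. x \<in> A \<Longrightarrow> f x \<in> A \<and> f (f x) = x \<and> f x \<noteq> x"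
  shows "even (card A)"
  using assms
proof (induction A rule: finite_psubset_induct)
  case (psubset A)
  show ?case
  proof (cases "A = {}")
    case False
    then obtain x where x: "x \<in> A" by blast
    note fx = psubset.prems[OF x]
    have "even (card (A - {x, f x}))"
    proof (rule psubset.IH)
      show "A - {x, f x} \<subset> A" using x by blast
      fix y assume "y \<in> A - {x, f x}"
      then show "f y \<in> A - {x, f x} \<and> f (f y) = y \<and> f y \<noteq> y"
        using psubset.prems[of y] fx by auto
    qed
    moreover have "card A = card (A - {x, f x}) + card {x, f x}"
      using card_Diff_subset[of "{x, f x}" A] card_mono[of A "{x, f x}"] psubset.hyps x fx by simp
    moreover have "card {x, f x} = 2" using fx by (auto simp: card_insert_if)
    ultimately show ?thesis by simp
  qed simp
qed

text \<open>An infinite set has a bijection with its square, so one more coordinate can be absorbed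
  at each step. Followed by \<open>emb\<close>, this places every model inside the type of the
  counted modules.\<close>

lemma inj_on_supported_on:
  fixes X :: "'i set"
  assumes inf: "infinite (UNIV :: 'k::zero set)" and "finite X"
  shows "\<exists>e :: ('i \<Rightarrow> 'k) \<Rightarrow> 'k. inj_on e (supported_on X)"
proof -
  have "\<exists>\<pi>. bij_betw \<pi> ((UNIV :: 'k set) \<times> (UNIV :: 'k set)) (UNIV :: 'k set)"
    unfolding card_of_ordIso by (rule card_of_Times_same_infinite[OF inf])
  then obtain \<pi> :: "'k \<times> 'k \<Rightarrow> 'k" where \<pi>: "inj \<pi>"
    by (auto simp: bij_betw_def)
  from \<open>finite X\<close> show ?thesis
  proof (induction X rule: finite_induct)
    case empty
    show ?case by (auto simp: supported_on_def inj_on_def fun_eq_iff)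
  next
    case (insert x X)
    then obtain e :: "('i \<Rightarrow> 'k) \<Rightarrow> 'k" where e: "inj_on e (supported_on X)" by blast
    have "inj_on (\<lambda>g. \<pi> (g x, e (g(x := 0)))) (supported_on (insert x X))"
    proof (rule inj_onI)
      fix g h :: "'i \<Rightarrow> 'k"
      assume g: "g \<in> supported_on (insert x X)" and h: "h \<in> supported_on (insert x X)"
        and eq: "\<pi> (g x, e (g(x := 0))) = \<pi> (h x, e (h(x := 0)))"
      have 1: "g x = h x" "e (g(x := 0)) = e (h(x := 0))" using injD[OF \<pi> eq] by auto
      have "g(x := 0) \<in> supported_on X" "h(x := 0) \<in> supported_on X"
        using g h by (auto simp: supported_on_def)
      then have 2: "g(x := 0) = h(x := 0)" using e 1(2) unfolding inj_on_def by blast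
      have "g y = h y" for y using 1(1) fun_cong[OF 2, of y] by (cases "y = x") auto
      then show "g = h" by blast
    qed
    then show ?case by blast
  qed
qed

text \<open>The facts about the symmetric group on which the count rests. The elements of G fixed by
  F are those that normalize F; \<tau> is the one among them acting on F by inversion, and apart
  from 1 the only one that is its own inverse. As p is prime, \<zeta> is a primitive p-th root of
  unity.\<close>

locale prime_factorization = factorization L F G
  for L :: "('a, 'm) monoid_scheme" (structure) and F G :: "'a set" +
  fixes p :: nat and c \<tau> :: 'a and \<zeta> :: "'k::field_char_0"
  assumes prime_p: "prime p" and odd_p: "odd p" and card_F: "card F = p"
    and c_carrier [simp]: "c \<in> carrier L" and F_powers: "F = (\<lambda>i. c [^] i) ` {..<p}" and c_pow_p: "c [^] p = \<one>"
    and card_G: "card G = fact (p - 1)"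
    and card_fixed: "card {x \<in> G. \<forall>a\<in>F. rt x a = x} = p - 1"
    and \<tau>_fixed: "\<tau> \<in> G" "\<And>a. a \<in> F \<Longrightarrow> rt \<tau> a = \<tau>" and \<tau>_inv: "\<tau> \<noteq> \<one>" "inv \<tau> = \<tau>"
    and \<tau>_lt: "\<And>a. a \<in> F \<Longrightarrow> lt \<tau> a = inv a"
    and \<tau>_unique: "\<And>x. x \<in> G \<Longrightarrow> (\<And>a. a \<in> F \<Longrightarrow> rt x a = x) \<Longrightarrow> inv x = x \<Longrightarrow> x = \<one> \<or> x = \<tau>"
    and \<zeta>_pow: "\<zeta> ^ p = 1" and \<zeta>_ne: "\<zeta> \<noteq> 1"
begin

definition fixed :: "'a set" where "fixed = {x \<in> G. \<forall>a\<in>F. rt x a = x}"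

abbreviation free :: "'a set set" where "free \<equiv> free_orbits L F G"

lemma p_gt: "p > 2"
  using prime_p odd_p prime_ge_2_nat[of p] by (cases "p = 2") auto

lemma c_in_F: "c \<in> F"
proof -
  have "c [^] (1 :: nat) \<in> F" unfolding F_powers using p_gt by (intro imageI) simp
  then show ?thesis using c_carrier by simp
qed

section \<open>Characters of the cyclic factor\<close>

lemma power_inverse_mod_p:
  fixes i :: nat
  assumes "\<not> p dvd i" shows "\<exists>k q. i * k = p * q + 1"
proof -
  have "coprime i p"
    using prime_imp_coprime[OF prime_p assms] by (simp add: coprime_commute)
  then show ?thesis using bezout_nat[of i p] assms by auto
qed

lemma \<zeta>_nonzero: "\<zeta> \<noteq> 0"
proof
  assume "\<zeta> = 0"
  then have "\<zeta> ^ p = 0" using prime_gt_0_nat[OF prime_p] by simp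
  then show False using \<zeta>_pow by simp
qed

text \<open>If p does not divide n, raising \<zeta>^n to an inverse of n mod p returns \<zeta>,
  which is not 1.\<close>

lemma \<zeta>_pow_eq_one: "\<zeta> ^ n = 1 \<longleftrightarrow> p dvd n"
proof
  assume "\<zeta> ^ n = 1"
  show "p dvd n"
  proof (rule ccontr)
    assume "\<not> p dvd n"
    then obtain k q where "n * k = p * q + 1" using power_inverse_mod_p by blast
    then have "(\<zeta> ^ n) ^ k = (\<zeta> ^ p) ^ q * \<zeta>" by (simp flip: power_mult)
    then show False using \<open>\<zeta> ^ n = 1\<close> \<zeta>_pow \<zeta>_ne by simp
  qed
qed (auto simp: power_mult \<zeta>_pow elim: dvdE)

lemma c_pow_mod: "c [^] (n mod p) = c [^] n"
proof -
  have "c [^] n = c [^] (p * (n div p)) \<otimes> c [^] (n mod p)"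
    by (simp add: nat_pow_mult)
  then show ?thesis by (simp add: nat_pow_pow[symmetric] c_pow_p)
qed

lemma c_pow_in_F: "c [^] (n :: nat) \<in> F"
  using F_powers prime_gt_0_nat[OF prime_p] by (force simp flip: c_pow_mod[of n])

lemma inj_c_pow: "inj_on (\<lambda>i. c [^] i) {..<p}"
  by (rule eq_card_imp_inj_on) (use card_F F_powers in auto)

definition dlog :: "'a \<Rightarrow> nat" where "dlog = inv_into {..<p} (\<lambda>i. c [^] i)"

lemma c_pow_dlog: "a \<in> F \<Longrightarrow> c [^] dlog a = a"
  unfolding dlog_def using F_powers f_inv_into_f[of a "\<lambda>i. c [^] i" "{..<p}"] by simp

lemma dlog_less: "a \<in> F \<Longrightarrow> dlog a < p"
  unfolding dlog_def using F_powers inv_into_into[of a "\<lambda>i. c [^] i" "{..<p}"] by simp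

lemma dlog_c_pow: "dlog (c [^] n) = n mod p"
  unfolding c_pow_mod[of n, symmetric] dlog_def
  using inv_into_f_f[OF inj_c_pow, of "n mod p"] prime_gt_0_nat[OF prime_p] by simp

definition \<rho> :: "nat \<Rightarrow> 'a \<Rightarrow> 'k" where "\<rho> j a = (\<zeta> ^ dlog a) ^ j"

lemma \<zeta>_pow_mod: "\<zeta> ^ (n mod p) = \<zeta> ^ n"
proof -
  have "\<zeta> ^ n = \<zeta> ^ (p * (n div p)) * \<zeta> ^ (n mod p)" by (simp flip: power_add)
  then show ?thesis by (simp add: power_mult \<zeta>_pow)
qed

lemma \<rho>_c_pow: "\<rho> j (c [^] n) = (\<zeta> ^ n) ^ j"
  by (simp add: \<rho>_def dlog_c_pow \<zeta>_pow_mod)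

lemma \<rho>_char: "is_char (\<rho> j)"
  unfolding is_char_def
proof (intro conjI ballI)
  show "\<rho> j \<one> = 1" using \<rho>_c_pow[of j 0] by simp
  fix a b assume "a \<in> F" "b \<in> F"
  then have "a \<otimes> b = c [^] (dlog a + dlog b)"
    by (simp add: nat_pow_mult[symmetric] c_pow_dlog)
  then show "\<rho> j (a \<otimes> b) = \<rho> j a * \<rho> j b"
    by (simp only: \<rho>_c_pow) (simp add: \<rho>_def power_add power_mult_distrib)
qed

lemma \<rho>_0: "\<rho> 0 a = 1"
  by (simp add: \<rho>_def)

lemma \<rho>_inj: "i < p \<Longrightarrow> j < p \<Longrightarrow> \<rho> i c = \<rho> j c \<Longrightarrow> i = j"
proof (induction i j rule: linorder_wlog)
  case (le i j)
  have "\<rho> k c = \<zeta> ^ k" for k using \<rho>_c_pow[of k 1] by simp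
  with le have "\<zeta> ^ i = \<zeta> ^ j" by simp
  also have "\<dots> = \<zeta> ^ i * \<zeta> ^ (j - i)" using le by (simp flip: power_add)
  finally have "\<zeta> ^ i = \<zeta> ^ i * \<zeta> ^ (j - i)" .
  then have "\<zeta> ^ (j - i) = 1" using \<zeta>_nonzero by simp
  then have "p dvd j - i" by (simp add: \<zeta>_pow_eq_one)
  then show ?case using le dvd_imp_le[of p "j - i"] by (cases "j - i = 0") auto
qed simp

lemma sum_powers_root:
  fixes q :: 'k
  assumes "q ^ p = 1" shows "(\<Sum>j<p. q ^ j) = (if q = 1 then of_nat p else 0)"
  using assms by (auto simp: sum_gp_strict)

text \<open>Orthogonality of characters, as a geometric sum with ratio 1/\<zeta>^(dlog b). For x
  fixed by F, it is what expresses p_x # 1 through the p left ideals belonging to x.\<close>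

lemma sum_\<rho>_inverse:
  assumes b: "b \<in> F" shows "(\<Sum>j<p. 1 / \<rho> j b) = (if b = \<one> then of_nat p else 0)"
proof -
  let ?q = "1 / \<zeta> ^ dlog b"
  have "\<zeta> ^ dlog b = 1 \<longleftrightarrow> b = \<one>"
  proof
    assume "\<zeta> ^ dlog b = 1"
    then have "p dvd dlog b" by (simp add: \<zeta>_pow_eq_one)
    then have "dlog b = 0" using dlog_less[OF b] by (meson dvd_imp_le not_le gr0I)
    then show "b = \<one>" using c_pow_dlog[OF b] by simp
  qed (use dlog_c_pow[of 0] in simp)
  moreover have "?q ^ p = 1"
  proof -
    have "(\<zeta> ^ dlog b) ^ p = (\<zeta> ^ p) ^ dlog b"
      by (simp only: power_mult[symmetric] mult.commute)
    then show ?thesis by (simp only: power_one_over \<zeta>_pow power_one div_by_1)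
  qed
  ultimately show ?thesis
    using sum_powers_root[of ?q] \<zeta>_nonzero by (simp add: \<rho>_def power_one_over)
qed

lemma sum_F_c_pow: "(\<Sum>a\<in>F. f a) = (\<Sum>i<p. f (c [^] i))"
  unfolding F_powers using sum.reindex[OF inj_c_pow, of f] by simp

text \<open>The Frobenius-Schur sum of the group F: a geometric sum with ratio \<zeta>^(2j), which
  is 1 only for j = 0 because p is odd.\<close>

lemma sum_\<rho>_square:
  assumes "j < p" shows "(\<Sum>a\<in>F. \<rho> j (a \<otimes> a)) = (if j = 0 then of_nat p else 0)"
proof -
  have "\<rho> j (c [^] i \<otimes> c [^] i) = (\<zeta> ^ (2 * j)) ^ i" for i
    by (simp add: nat_pow_mult \<rho>_c_pow flip: power_mult mult_2) (simp add: ac_simps)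
  moreover have "\<zeta> ^ (2 * j) = 1 \<longleftrightarrow> j = 0"
  proof -
    have "p dvd 2 * j \<longleftrightarrow> p dvd j"
      using prime_dvd_mult_iff[OF prime_p, of 2 j] p_gt dvd_imp_le[of p 2] by auto
    then show ?thesis using assms dvd_imp_le[of p j] by (auto simp: \<zeta>_pow_eq_one)
  qed
  moreover have "(\<zeta> ^ (2 * j)) ^ p = 1"
    by (simp add: power_mult[symmetric]) (simp add: mult.commute power_mult \<zeta>_pow)
  ultimately show ?thesis using sum_powers_root[of "\<zeta> ^ (2 * j)"] by (simp add: sum_F_c_pow)
qed

section \<open>Fixed points and free orbits\<close>

lemma rt_pow: "x \<in> G \<Longrightarrow> a \<in> F \<Longrightarrow> rt x a = x \<Longrightarrow> rt x (a [^] (n :: nat)) = x"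
proof (induction n)
  case (Suc n)
  then obtain i where "a = c [^] (i :: nat)" using F_powers by auto
  then have "a [^] n \<in> F" by (simp add: nat_pow_pow c_pow_in_F)
  with Suc show ?case by (simp add: rt_mult)
qed simp

text \<open>A group of prime order has no proper nontrivial subgroup: the exponent of a stabilizing
  a other than 1 is invertible mod p, so c is a power of a and also fixes x.\<close>

lemma stabilizer_cases:
  assumes x: "x \<in> G" shows "x \<in> fixed \<or> ract_stabilizer L F G x = {\<one>}"
proof (rule disjCI)
  assume "ract_stabilizer L F G x \<noteq> {\<one>}"
  moreover have "\<one> \<in> ract_stabilizer L F G x" using x by (simp add: ract_stabilizer_def)
  ultimately obtain a where a: "a \<in> F" "rt x a = x" "a \<noteq> \<one>"
    unfolding ract_stabilizer_def by blast
  have "\<not> p dvd dlog a"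
    using dlog_less[OF a(1)] c_pow_dlog[OF a(1)] a(3) dvd_imp_le[of p "dlog a"]
    by (cases "dlog a = 0") auto
  then obtain k q where kq: "dlog a * k = p * q + 1" using power_inverse_mod_p by blast
  have "a [^] k = (c [^] dlog a) [^] k" using c_pow_dlog[OF a(1)] by simp
  also have "\<dots> = (c [^] p) [^] q \<otimes> c" by (simp add: nat_pow_pow kq)
  finally have "a [^] k = c" by (simp add: c_pow_p)
  then have "rt x c = x" using rt_pow[OF x a(1,2), of k] by simp
  then have "rt x (c [^] n) = x" for n :: nat by (rule rt_pow[OF x c_in_F])
  then have "rt x a = x" if "a \<in> F" for a using c_pow_dlog[OF that] by metis
  then show "x \<in> fixed" using x by (simp add: fixed_def)
qed

lemma fixed_iff: "x \<in> fixed \<longleftrightarrow> x \<in> G \<and> orb x = {x}"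
proof
  assume "x \<in> fixed"
  then have x: "x \<in> G" "\<And>a. a \<in> F \<Longrightarrow> rt x a = x" by (auto simp: fixed_def)
  then have "orb x \<subseteq> {x}" by (auto simp: ract_orbit_def)
  then show "x \<in> G \<and> orb x = {x}" using x(1) orb_self by blast
next
  assume "x \<in> G \<and> orb x = {x}"
  then show "x \<in> fixed" using rt_in_orb[of _ x] by (auto simp: fixed_def)
qed

lemma fixedD: "x \<in> fixed \<Longrightarrow> x \<in> G" "x \<in> fixed \<Longrightarrow> a \<in> F \<Longrightarrow> rt x a = x"
  by (auto simp: fixed_def)

lemma fixed_orbit: "x \<in> fixed \<Longrightarrow> {x} \<in> orbits"
  unfolding orbits_def using fixed_iff by (metis imageI)

lemma one_fixed: "\<one> \<in> fixed" and \<tau>_in_fixed: "\<tau> \<in> fixed"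
  using \<tau>_fixed by (auto simp: fixed_def)

lemma stabilizer_inj:
  assumes x: "x \<in> G" and st: "ract_stabilizer L F G x = {\<one>}"
    and ab: "a \<in> F" "b \<in> F" "rt x a = rt x b"
  shows "a = b"
proof -
  have "rt x (a \<otimes> inv b) = x" using x ab rt_inv[of x b] by (simp add: rt_mult)
  then have "a \<otimes> inv b \<in> ract_stabilizer L F G x" using ab by (simp add: ract_stabilizer_def)
  then have e: "a \<otimes> inv b = \<one>" using st by simp
  have "a = a \<otimes> inv b \<otimes> b" using ab by (simp add: m_assoc)
  then show ?thesis using e ab by simp
qed

lemma freeD:
  assumes "X \<in> free"
  shows free_orbit: "X \<in> orbits" and free_card: "card X = p"
    and free_not_fixed: "y \<in> X \<Longrightarrow> y \<notin> fixed"
    and free_inj: "y \<in> X \<Longrightarrow> a \<in> F \<Longrightarrow> b \<in> F \<Longrightarrow> rt y a = rt y b \<Longrightarrow> a = b"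
proof -
  obtain x where x: "x \<in> G" "ract_stabilizer L F G x = {\<one>}" "X = orb x"
    using assms unfolding free_orbits_def by blast
  show X: "X \<in> orbits" using x by (simp add: orbits_def)
  have "inj_on (rt x) F" using stabilizer_inj[OF x(1,2)] by (rule inj_onI)
  moreover have "X = rt x ` F" using x(3) by (auto simp: ract_orbit_def)
  ultimately show card: "card X = p" by (simp add: card_image card_F)
  show nf: "y \<notin> fixed" if "y \<in> X" for y
  proof
    assume "y \<in> fixed"
    then have "X = {y}" using orbit_eq[OF X that] fixed_iff by simp
    then show False using card p_gt by simp
  qed
  assume y: "y \<in> X" and ab: "a \<in> F" "b \<in> F" "rt y a = rt y b"
  then have "y \<in> G" using orbit_sub[OF X] by blast
  then show "a = b" using stabilizer_cases nf[OF y] stabilizer_inj ab by blast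
qed

lemma free_orb: "x \<in> G \<Longrightarrow> x \<notin> fixed \<Longrightarrow> orb x \<in> free"
  unfolding free_orbits_def using stabilizer_cases by blast

lemma finite_free: "finite free"
  unfolding free_orbits_def by simp

lemma finite_fixed: "finite fixed"
  unfolding fixed_def by simp

text \<open>The partition of G into orbits, stated for sums so that f = 1 counts the free orbits and
  the fibre sizes of w = a y count the square roots of 1.\<close>

lemma sum_G: "(\<Sum>y\<in>G. f y) = (\<Sum>y\<in>fixed. f y) + (\<Sum>X\<in>free. \<Sum>y\<in>X. f y)"
proof -
  have "G = fixed \<union> \<Union>free"
    using free_orb orb_self orbit_sub[OF free_orbit] fixedD(1) by blast
  moreover have "fixed \<inter> \<Union>free = {}" using free_not_fixed by blast
  moreover have "finite (\<Union>free)" using finite_free orbit_finite[OF free_orbit] by blast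
  ultimately have "(\<Sum>y\<in>G. f y) = (\<Sum>y\<in>fixed. f y) + (\<Sum>y\<in>\<Union>free. f y)"
    using sum.union_disjoint[OF finite_fixed, of "\<Union>free" f] by simp
  also have "(\<Sum>y\<in>\<Union>free. f y) = (\<Sum>X\<in>free. \<Sum>y\<in>X. f y)"
  proof -
    have "X \<inter> Y = {}" if "X \<in> free" "Y \<in> free" "X \<noteq> Y" for X Y
      using orbit_eq[OF free_orbit[OF that(1)]] orbit_eq[OF free_orbit[OF that(2)]] that(3) by blast
    then show ?thesis using orbit_finite[OF free_orbit] by (subst sum.Union_disjoint) auto
  qed
  finally show ?thesis .
qed

lemma card_fixed': "card fixed = p - 1"
  using card_fixed by (simp add: fixed_def)

lemma card_free: "p - 1 + p * card free = fact (p - 1)"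
proof -
  have "card G = card fixed + (\<Sum>X\<in>free. card X)"
    using sum_G[of "\<lambda>_. 1 :: nat"] by simp
  also have "(\<Sum>X\<in>free. card X) = p * card free" using free_card by simp
  finally show ?thesis by (simp add: card_G card_fixed')
qed

section \<open>Orbits closed under inversion and the square roots of 1\<close>

definition real_orbit :: "'a set \<Rightarrow> bool" where "real_orbit X \<longleftrightarrow> (\<exists>y\<in>X. ord y = 2)"

lemma ord_2_iff:
  assumes y: "y \<in> G" shows "ord y = 2 \<longleftrightarrow> y \<noteq> \<one> \<and> inv y = y"
proof -
  have sq: "y [^] (2 :: nat) = \<one> \<longleftrightarrow> inv y = y"
    using y inv_equality[of y y] by (auto simp: numeral_2_eq_2) (metis G_carrier l_inv)
  have "ord y = 2 \<longleftrightarrow> ord y dvd 2 \<and> ord y \<noteq> 1"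
    using two_is_prime_nat by (auto simp: prime_nat_iff)
  moreover have "ord y \<noteq> 1 \<longleftrightarrow> y \<noteq> \<one>" using y ord_eq_1[of y] by simp
  moreover have "ord y dvd 2 \<longleftrightarrow> inv y = y" using y sq pow_eq_id[of y 2] by simp
  ultimately show ?thesis by blast
qed

lemma inv_in_orbit:
  assumes X: "X \<in> orbits" and y: "y \<in> X" "inv y \<in> X" and z: "z \<in> X"
  shows "inv z \<in> X"
proof -
  obtain a where a: "a \<in> F" "z = rt y a"
    using orbit_eq[OF X y(1)] z by (auto simp: ract_orbit_def)
  have "y \<in> G" using orbit_sub[OF X] y by blast
  then have "inv z = rt (inv y) (lt y a)" using a by (simp add: inv_rt)
  then show ?thesis using orbit_rt[OF X y(2), of "lt y a"] a \<open>y \<in> G\<close> by simp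
qed

text \<open>By \<open>inv_in_orbit\<close> the condition holds on all of X or nowhere. If it holds
  and X has no involution, inversion is free of fixed points on a set of odd size. The coefficients
  are generic, as the sum is taken in the naturals for the square roots of 1 and in k for the
  indicator.\<close>

lemma real_orbit_count:
  assumes X: "X \<in> free"
  shows "(\<Sum>y\<in>X. if inv y \<in> X then 1 else 0) = (if real_orbit X then of_nat p else (0 :: 'c::semiring_1))"
proof -
  note O = free_orbit[OF X]
  have XG: "X \<subseteq> G" by (rule orbit_sub[OF O])
  show ?thesis
  proof (cases "real_orbit X")
    case True
    then obtain y where y: "y \<in> X" "ord y = 2" by (auto simp: real_orbit_def)
    then have "inv y \<in> X" using XG by (auto simp: ord_2_iff)
    from inv_in_orbit[OF O y(1) this] have "(\<Sum>y\<in>X. if inv y \<in> X then 1 else (0 :: 'c)) = (\<Sum>y\<in>X. 1)"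
      by (intro sum.cong) auto
    then show ?thesis using True by (simp add: free_card[OF X])
  next
    case False
    have "inv y \<notin> X" if y: "y \<in> X" for y
    proof
      assume iy: "inv y \<in> X"
      have "inv z \<in> X \<and> inv (inv z) = z \<and> inv z \<noteq> z" if z: "z \<in> X" for z
      proof -
        have zG: "z \<in> G" using z XG by blast
        have "z \<noteq> \<one>" using free_not_fixed[OF X z] one_fixed by blast
        then have "inv z \<noteq> z" using False z zG ord_2_iff by (auto simp: real_orbit_def)
        then show ?thesis using inv_in_orbit[OF O y iy z] zG by simp
      qed
      then have "even (card X)" by (rule even_card_involution[OF orbit_finite[OF O]])
      then show False using free_card[OF X] odd_p by simp
    qed
    then show ?thesis using False by simp
  qed
qed

text \<open>If a carries y to inv y, then both lt y a and inv a carry inv y to y; on a free orbit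
  only one element of F does so. Hence the condition on the F-part of y a follows from the one on
  its G-part.\<close>

lemma count_translations:
  assumes X: "X \<in> free" and y: "y \<in> X" "inv y \<in> X"
  obtains a where "a \<in> F" "lt y a = inv a" "\<And>b. b \<in> F \<Longrightarrow> rt y b = inv y \<longleftrightarrow> b = a"
proof -
  note O = free_orbit[OF X]
  have yG: "y \<in> G" using orbit_sub[OF O] y by blast
  obtain a where a: "a \<in> F" "inv y = rt y a"
    using orbit_eq[OF O y(1)] y(2) by (auto simp: ract_orbit_def)
  have "rt (inv y) (lt y a) = y" using inv_rt[OF yG a(1)] a(2)[symmetric] yG by simp
  moreover have "rt (inv y) (inv a) = y" using rt_inv[OF yG a(1)] a(2) by simp
  ultimately have "lt y a = inv a"
    using free_inj[OF X y(2), of "lt y a" "inv a"] a yG by simp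
  moreover have "rt y b = inv y \<longleftrightarrow> b = a" if "b \<in> F" for b
    using free_inj[OF X y(1) that a(1)] a(2) by auto
  ultimately show ?thesis using that[of a] a(1) by blast
qed

text \<open>The equation w = inv w for w = a y reads y a = inv a inv y, and the right-hand side is
  already a factorization.\<close>

lemma square_eq_one_iff:
  assumes a: "a \<in> F" and y: "y \<in> G"
  shows "(a \<otimes> y) \<otimes> (a \<otimes> y) = \<one> \<longleftrightarrow> rt y a = inv y \<and> lt y a = inv a"
proof
  assume "(a \<otimes> y) \<otimes> (a \<otimes> y) = \<one>"
  then have "inv (a \<otimes> y) = a \<otimes> y" using inv_equality[of "a \<otimes> y" "a \<otimes> y"] a y by simp
  then have e: "inv y \<otimes> inv a = a \<otimes> y" using a y by (simp add: inv_mult_group)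
  have "y \<otimes> a = inv a \<otimes> (a \<otimes> y) \<otimes> a" using a y by (simp add: m_assoc[symmetric])
  also have "\<dots> = inv a \<otimes> (inv y \<otimes> inv a) \<otimes> a" by (simp only: e)
  also have "\<dots> = inv a \<otimes> inv y" using a y by (simp add: m_assoc)
  finally show "rt y a = inv y \<and> lt y a = inv a" using rt_lt_eqI[of "inv a" "inv y" y a] a y by simp
next
  assume "rt y a = inv y \<and> lt y a = inv a"
  then have e: "y \<otimes> a = inv a \<otimes> inv y" using lt_rt[OF y a] by simp
  have "(a \<otimes> y) \<otimes> (a \<otimes> y) = a \<otimes> (y \<otimes> a) \<otimes> y" using a y by (simp add: m_assoc)
  also have "\<dots> = (a \<otimes> inv a) \<otimes> (inv y \<otimes> y)" unfolding e using a y by (simp only: m_assoc F_carrier G_carrier m_closed inv_closed F_inv G_inv)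
  finally show "(a \<otimes> y) \<otimes> (a \<otimes> y) = \<one>" using a y by simp
qed

lemma square_eq_one_F: "a \<in> F \<Longrightarrow> a = inv a \<longleftrightarrow> a = \<one>"
proof
  assume a: "a \<in> F" "a = inv a"
  then have "a \<otimes> a = \<one>" using l_inv[of a] by simp
  then have "c [^] (dlog a + dlog a) = c [^] (0 :: nat)"
    using a by (simp add: nat_pow_mult[symmetric] c_pow_dlog)
  then have "p dvd 2 * dlog a"
    using dlog_c_pow[of "dlog a + dlog a"] dlog_c_pow[of 0] by (simp add: mod_eq_0_iff_dvd mult_2)
  then have "p dvd dlog a"
    using prime_dvd_mult_iff[OF prime_p, of 2 "dlog a"] p_gt dvd_imp_le[of p 2] by auto
  then have "dlog a = 0" using dlog_less[OF a(1)] by (meson dvd_imp_le not_le gr0I)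
  then show "a = \<one>" using c_pow_dlog[OF a(1)] by simp
qed simp

lemma card_involutions:
  "card {w \<in> carrier L. w \<otimes> w = \<one>} = p * card {X \<in> free. real_orbit X} + 1 + p"
proof -
  let ?I = "{w \<in> carrier L. w \<otimes> w = \<one>}"
  let ?A = "\<lambda>y. {a \<in> F. rt y a = inv y \<and> lt y a = inv a}"
  have "bij_betw (\<lambda>(y, a). a \<otimes> y) (Sigma G ?A) ?I"
  proof (rule bij_betwI')
    fix u v assume "u \<in> Sigma G ?A" "v \<in> Sigma G ?A"
    then show "(case u of (y, a) \<Rightarrow> a \<otimes> y) = (case v of (y, a) \<Rightarrow> a \<otimes> y) \<longleftrightarrow> u = v"
      using factor_unique by (cases u; cases v) auto
  next
    fix u assume "u \<in> Sigma G ?A"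
    then show "(case u of (y, a) \<Rightarrow> a \<otimes> y) \<in> ?I" using square_eq_one_iff by (cases u) auto
  next
    fix w assume w: "w \<in> ?I"
    then obtain a y where "a \<in> F" "y \<in> G" "w = a \<otimes> y" using factor by blast
    then show "\<exists>u\<in>Sigma G ?A. w = (case u of (y, a) \<Rightarrow> a \<otimes> y)"
      using w square_eq_one_iff[of a y] by (intro bexI[of _ "(y, a)"]) auto
  qed
  then have "card ?I = card (Sigma G ?A)" by (simp add: bij_betw_same_card)
  also have "\<dots> = (\<Sum>y\<in>G. card (?A y))" by (rule card_SigmaI) auto
  also have "\<dots> = (\<Sum>y\<in>fixed. card (?A y)) + (\<Sum>X\<in>free. \<Sum>y\<in>X. card (?A y))" by (rule sum_G)
  \<comment> \<open>For fixed y a nonempty fibre forces inv y = y, so y is 1 or \<tau>. For y = 1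
    the condition left on a is a = inv a, with the single solution 1; for \<tau> it holds throughout
    F.\<close>
  also have "(\<Sum>y\<in>fixed. card (?A y)) = (\<Sum>y\<in>fixed. (if y = \<one> then 1 else 0) + (if y = \<tau> then p else 0))"
  proof (rule sum.cong[OF refl])
    fix y assume y: "y \<in> fixed"
    note yG = fixedD(1)[OF y]
    consider "y = \<one>" | "y = \<tau>" | "y \<noteq> \<one>" "y \<noteq> \<tau>" by blast
    then show "card (?A y) = (if y = \<one> then 1 else 0) + (if y = \<tau> then p else 0)"
    proof cases
      case 1
      then have "?A y = {\<one>}" using square_eq_one_F by auto
      then show ?thesis using 1 \<tau>_inv by simp
    next
      case 2
      then have "?A y = F" using \<tau>_fixed \<tau>_inv \<tau>_lt by auto
      then show ?thesis using 2 \<tau>_inv card_F by simp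
    next
      case 3
      then have "inv y \<noteq> y" using \<tau>_unique[OF yG fixedD(2)[OF y]] by blast
      then have "?A y = {}" using fixedD(2)[OF y] by auto
      then show ?thesis using 3 by simp
    qed
  qed
  also have "\<dots> = 1 + p"
    using finite_fixed one_fixed \<tau>_in_fixed by (simp add: sum.distrib)
  also have "(\<Sum>X\<in>free. \<Sum>y\<in>X. card (?A y)) = (\<Sum>X\<in>free. if real_orbit X then p else 0)"
  proof (rule sum.cong[OF refl])
    fix X assume X: "X \<in> free"
    have "card (?A y) = (if inv y \<in> X then 1 else 0)" if y: "y \<in> X" for y
    proof (cases "inv y \<in> X")
      case True
      obtain a where "a \<in> F" "lt y a = inv a" "\<And>b. b \<in> F \<Longrightarrow> rt y b = inv y \<longleftrightarrow> b = a"
        using count_translations[OF X y True] by blast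
      then have "?A y = {a}" by auto
      then show ?thesis using True by simp
    next
      case False
      then have "rt y a \<noteq> inv y" if "a \<in> F" for a using orbit_rt[OF free_orbit[OF X] y that] by metis
      then have "?A y = {}" by blast
      then show ?thesis using False by (simp only: card.empty if_False)
    qed
    then show "(\<Sum>y\<in>X. card (?A y)) = (if real_orbit X then p else 0)"
      using real_orbit_count[OF X, where 'c = nat] by simp
  qed
  also have "\<dots> = p * card {X \<in> free. real_orbit X}"
    using finite_free by (simp add: sum.If_cases Int_def)
  finally show ?thesis by simp
qed

text \<open>Only y = inv x contributes, and only if inv x = x. At x = 1 this leaves the sum of
  \<rho>(a a), which is p for the trivial character and 0 otherwise; at \<tau> each product lt
  \<tau> a \<otimes> a is 1, so every character gives p.\<close>

lemma indicator_fixed: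
  fixes M :: "('a \<times> 'a \<Rightarrow> 'k, 'v) module"
  assumes x: "x \<in> fixed" and j: "j < p" and iso: "module_isomorphic J (orbit_model {x} (\<rho> j)) M"
  shows "indicator_FS J M = (if x = \<tau> \<or> x = \<one> \<and> j = 0 then 1 else 0)"
proof -
  note xG = fixedD(1)[OF x]
  \<comment> \<open>By \<open>inv_lt\<close> at inv x, the element a is itself a value of lt x, so
    \<open>inv_rt\<close> at x applies to it.\<close>
  have fix_inv: "rt (inv x) a = inv x" if a: "a \<in> F" for a
    using inv_rt[OF xG, of "lt (inv x) a"] inv_lt[of "inv x" a] fixedD(2)[OF x, of "lt (inv x) a"] xG a
    by simp
  have "(\<Sum>y\<in>G. \<Sum>a\<in>F. if inv y \<in> {x} \<and> rt y a = inv y then \<rho> j (lt y a \<otimes> a) else 0)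
      = (\<Sum>y\<in>G. if y = inv x then \<Sum>a\<in>F. if inv x = x then \<rho> j (lt y a \<otimes> a) else 0 else 0)"
  proof (intro sum.cong refl)
    fix y assume y: "y \<in> G"
    have "inv y = x \<longleftrightarrow> y = inv x" using y xG by auto
    then show "(\<Sum>a\<in>F. if inv y \<in> {x} \<and> rt y a = inv y then \<rho> j (lt y a \<otimes> a) else 0)
      = (if y = inv x then \<Sum>a\<in>F. if inv x = x then \<rho> j (lt y a \<otimes> a) else 0 else 0)"
      using fix_inv xG by (auto intro!: sum.cong)
  qed
  also have "\<dots> = (if inv x = x then \<Sum>a\<in>F. \<rho> j (lt x a \<otimes> a) else 0)"
    using xG by simp
  also have "\<dots> = (if x = \<tau> \<or> x = \<one> \<and> j = 0 then of_nat p else 0)"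
  proof -
    consider "x = \<one>" | "x = \<tau>" | "x \<noteq> \<one>" "x \<noteq> \<tau>" by blast
    then show ?thesis
    proof cases
      case 1
      then show ?thesis using sum_\<rho>_square[OF j] \<tau>_inv by simp
    next
      case 2
      then show ?thesis using \<tau>_inv \<tau>_lt is_charD(1)[OF \<rho>_char] card_F by simp
    next
      case 3
      then show ?thesis using \<tau>_unique[OF xG fixedD(2)[OF x]] by auto
    qed
  qed
  finally have s: "(\<Sum>y\<in>G. \<Sum>a\<in>F. if inv y \<in> {x} \<and> rt y a = inv y then \<rho> j (lt y a \<otimes> a) else 0)
    = (if x = \<tau> \<or> x = \<one> \<and> j = 0 then of_nat p else 0)" .
  show ?thesis
    unfolding indicator_orbit_model[OF fixed_orbit[OF x] \<rho>_char iso] s card_F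
    using prime_gt_0_nat[OF prime_p] by simp
qed

text \<open>With the trivial character, each y in X whose inverse lies in X contributes 1, coming
  from the single a that carries y to inv y; the total is p or 0.\<close>

lemma indicator_free:
  fixes M :: "('a \<times> 'a \<Rightarrow> 'k, 'v) module"
  assumes X: "X \<in> free" and iso: "module_isomorphic J (orbit_model X (\<rho> 0)) M"
  shows "indicator_FS J M = (if real_orbit X then 1 else 0)"
proof -
  note O = free_orbit[OF X]
  let ?f = "\<lambda>y. (\<Sum>a\<in>F. if inv y \<in> X \<and> rt y a = inv y then \<rho> 0 (lt y a \<otimes> a) else 0)"
  have out: "?f y = 0" if "y \<in> G" "y \<notin> X" for y
  proof (rule sum.neutral, rule ballI)
    fix a assume "a \<in> F"
    then show "(if inv y \<in> X \<and> rt y a = inv y then \<rho> 0 (lt y a \<otimes> a) else 0) = 0"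
      using rt_notin[OF O that, of a] by metis
  qed
  have inn: "?f y = (if inv y \<in> X then 1 else 0)" if y: "y \<in> X" for y
  proof (cases "inv y \<in> X")
    case True
    obtain a where "a \<in> F" "\<And>b. b \<in> F \<Longrightarrow> rt y b = inv y \<longleftrightarrow> b = a"
      using count_translations[OF X y True] by blast
    then have "?f y = (\<Sum>b\<in>F. if b = a then 1 else 0)"
      using True by (intro sum.cong refl) (simp add: \<rho>_0)
    then show ?thesis using True \<open>a \<in> F\<close> by simp
  qed simp
  have "(\<Sum>y\<in>G. ?f y) = (\<Sum>y\<in>X. ?f y)"
    using orbit_sub[OF O] out by (intro sum.mono_neutral_right) auto
  also have "\<dots> = (if real_orbit X then of_nat p else 0)"
    using inn real_orbit_count[OF X, where 'c = 'k] by simp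
  finally show ?thesis
    unfolding indicator_orbit_model[OF O \<rho>_char iso] card_F
    using prime_gt_0_nat[OF prime_p] by simp
qed

text \<open>The pair \<open>(X, j)\<close> stands for the module \<open>M(X, \<rho>\<^sub>j)\<close>; on a free orbit all characters
  give isomorphic modules, so only \<open>j = 0\<close> is used.\<close>

definition labels :: "('a set \<times> nat) set" where
  "labels = (\<lambda>(x, j). ({x}, j)) ` (fixed \<times> {..<p}) \<union> (\<lambda>X. (X, 0)) ` free"

abbreviation model :: "'a set \<times> nat \<Rightarrow> ('a \<times> 'a \<Rightarrow> 'k, 'a \<Rightarrow> 'k) module" where
  "model t \<equiv> orbit_model (fst t) (\<rho> (snd t))"

lemma labels_cases:
  assumes "t \<in> labels"
  obtains (fixed) x j where "t = ({x}, j)" "x \<in> fixed" "j < p"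
    | (free) X where "t = (X, 0)" "X \<in> free"
  using assms unfolding labels_def by auto

lemma labels_orbits: "t \<in> labels \<Longrightarrow> fst t \<in> orbits"
  by (erule labels_cases) (auto intro: fixed_orbit free_orbit)

lemma labels_cover:
  fixes M :: "('a \<times> 'a \<Rightarrow> 'k, 'v) module"
  assumes M: "M \<in> simple_modules J"
  shows "\<exists>t\<in>labels. module_isomorphic J (model t) M"
proof -
  define T where "T = {(x, \<rho> j) | x j. (orb x, j) \<in> labels}"
  have span: "\<exists>P g. finite P \<and> (\<forall>\<sigma>\<in>P. is_char \<sigma> \<and> (x, \<sigma>) \<in> T) \<and>
      g \<in> supported_on (orb x) \<and> bvec (x, \<one>) = (\<lambda>u. \<Sum>\<sigma>\<in>P. ideal_embed x \<sigma> g u :: 'k)"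
    if x: "x \<in> G" for x
  proof (cases "x \<in> fixed")
    case True
    \<comment> \<open>The factor 1/p compensates the value p of the orthogonality sum at b =
      1.\<close>
    define g where "g y = (if y = x then 1 / of_nat p else 0 :: 'k)" for y
    have orbx: "orb x = {x}" using True fixed_iff by blast
    have inj: "inj_on \<rho> {..<p}" by (rule inj_onI) (auto intro: \<rho>_inj)
    have "bvec (x, \<one>) u = (\<Sum>\<sigma>\<in>\<rho> ` {..<p}. ideal_embed x \<sigma> g u)" for u
    proof (cases u)
      case (Pair y b)
      show ?thesis
      proof (cases "y = x \<and> b \<in> F")
        case True': True
        have "(\<Sum>\<sigma>\<in>\<rho> ` {..<p}. ideal_embed x \<sigma> g u) = (\<Sum>j<p. (1 / of_nat p) * (1 / \<rho> j b))"
          using True' x fixedD(2)[OF True] by (simp add: sum.reindex[OF inj] Pair ideal_embed_def g_def)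
        also have "\<dots> = (1 / of_nat p) * (\<Sum>j<p. 1 / \<rho> j b)" by (rule sum_distrib_left[symmetric])
        also have "\<dots> = bvec (x, \<one>) u"
          using True' prime_gt_0_nat[OF prime_p] by (auto simp: sum_\<rho>_inverse bvec_def Pair)
        finally show ?thesis by simp
      next
        case False
        then have "ideal_embed x \<sigma> g u = 0" for \<sigma> by (auto simp: ideal_embed_def g_def Pair)
        then show ?thesis using False by (auto simp: Pair bvec_def)
      qed
    qed
    moreover have "(x, \<rho> j) \<in> T" if "j < p" for j
      using True that orbx by (auto simp: T_def labels_def)
    ultimately show ?thesis
      by (intro exI[of _ "\<rho> ` {..<p}"] exI[of _ g]) (auto simp: orbx g_def supported_on_def \<rho>_char)
  next
    case False
    have X: "orb x \<in> free" by (rule free_orb[OF x False])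
    have "bvec (x, \<one>) u = (\<Sum>\<sigma>\<in>{\<rho> 0}. ideal_embed x \<sigma> (bvec x) u)" for u
    proof (cases u)
      case (Pair y b)
      \<comment> \<open>Only b = 1 carries x to x, so the embedding sends the basis vector at x to
        p_x # 1 itself.\<close>
      have "rt x b = x \<longleftrightarrow> b = \<one>" if "b \<in> F"
        using free_inj[OF X orb_self[OF x] that F_one] x by auto
      then show ?thesis using x by (auto simp: Pair bvec_def ideal_embed_def \<rho>_0)
    qed
    moreover have "(x, \<rho> 0) \<in> T" using X by (auto simp: T_def labels_def)
    ultimately show ?thesis
      using orb_self[OF x]
      by (intro exI[of _ "{\<rho> 0}"] exI[of _ "bvec x"]) (auto simp: bvec_def supported_on_def \<rho>_char)
  qed
  obtain x j where "(orb x, j) \<in> labels" "module_isomorphic J (orbit_model (orb x) (\<rho> j)) M"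
    using simple_module_cover[OF M span] unfolding T_def by blast
  then show ?thesis by (intro bexI[of _ "(orb x, j)"]) simp_all
qed

text \<open>The orbit is always recovered; the index j matters only at one-point orbits, where the
  value of the character at the generator c determines it.\<close>

lemma labels_distinct:
  assumes t: "t \<in> labels" and s: "s \<in> labels" and iso: "module_isomorphic J (model t) (model s)"
  shows "t = s"
proof -
  have eq: "fst t = fst s"
    by (rule orbit_model_iso_eq[OF labels_orbits[OF t] labels_orbits[OF s] iso \<rho>_char \<rho>_char])
  from t show ?thesis
  proof (cases rule: labels_cases)
    case (fixed x i)
    from s show ?thesis
    proof (cases rule: labels_cases)
      case (fixed y j)
      then show ?thesis
        using orbit_model_iso_char[OF fixed_orbit \<rho>_char \<rho>_char _ c_in_F, of x i j]
          \<rho>_inj[of i j] iso eq \<open>t = ({x}, i)\<close> \<open>x \<in> fixed\<close> \<open>i < p\<close> by simp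
    next
      case (free X)
      then have "{x} \<in> free" using eq \<open>t = ({x}, i)\<close> by simp
      then show ?thesis using free_not_fixed[of "{x}" x] \<open>x \<in> fixed\<close> by blast
    qed
  next
    case (free X)
    from s show ?thesis
    proof (cases rule: labels_cases)
      case (fixed y j)
      then have "{y} \<in> free" using free eq by simp
      then show ?thesis using free_not_fixed[of "{y}" y] \<open>y \<in> fixed\<close> by blast
    next
      case (free Y)
      then show ?thesis using \<open>t = (X, 0)\<close> eq by simp
    qed
  qed
qed

lemma finite_labels: "finite labels"
  unfolding labels_def using finite_fixed finite_free by simp

lemma labels_card_orbit:
  assumes "t \<in> labels"
  shows "(card (fst t) = 1 \<longleftrightarrow> t \<in> (\<lambda>(x, j). ({x}, j)) ` (fixed \<times> {..<p})) \<and>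
    (card (fst t) = p \<longleftrightarrow> t \<in> (\<lambda>X. (X, 0)) ` free)"
  using assms
proof (cases rule: labels_cases)
  case (fixed x j)
  moreover have "{x} \<notin> free" using free_not_fixed[of "{x}" x] fixed by auto
  ultimately show ?thesis using p_gt by auto
next
  case (free X)
  moreover have "{x} \<noteq> X" if "x \<in> fixed" for x using free_not_fixed[of X x] free that by auto
  ultimately show ?thesis using p_gt free_card by auto
qed

definition indicator_label :: "'a set \<times> nat \<Rightarrow> bool" where
  "indicator_label t \<longleftrightarrow> (if fst t \<in> free then real_orbit (fst t) else fst t = {\<tau>} \<or> t = ({\<one>}, 0))"

lemma indicator_labels:
  fixes M :: "('a \<times> 'a \<Rightarrow> 'k, 'v) module"
  assumes t: "t \<in> labels" and iso: "module_isomorphic J (model t) M"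
  shows "indicator_FS J M = (if indicator_label t then 1 else 0)"
  using t
proof (cases rule: labels_cases)
  case (fixed x j)
  moreover have "{x} \<notin> free" using free_not_fixed[of "{x}" x] fixed by auto
  ultimately show ?thesis
    using indicator_fixed[of x j M] iso by (simp add: indicator_label_def)
next
  case (free X)
  then show ?thesis using indicator_free[of X M] iso by (simp add: indicator_label_def)
qed

lemma simple_modules_dimension:
  fixes M :: "('a \<times> 'a \<Rightarrow> 'k, 'v) module"
  assumes M: "M \<in> simple_modules J"
  shows "has_dim J M 1 \<or> has_dim J M p" and "indicator_FS J M = 1 \<or> indicator_FS J M = 0"
proof -
  obtain t where t: "t \<in> labels" and iso: "module_isomorphic J (model t) M"
    using labels_cover[OF M] by blast
  show "indicator_FS J M = 1 \<or> indicator_FS J M = 0" by (simp add: indicator_labels[OF t iso])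
  have "card (fst t) = 1 \<or> card (fst t) = p"
    using labels_card_orbit[OF t] t by (auto simp: labels_def)
  then show "has_dim J M 1 \<or> has_dim J M p"
    unfolding has_dim_orbit_model[OF labels_orbits[OF t] \<rho>_char iso] by (elim disjE) simp_all
qed

section \<open>The counts of isomorphism classes\<close>

context
  fixes emb :: "'k \<Rightarrow> 'v"
  assumes emb: "inj emb"
begin

lemma labels_realized:
  assumes "t \<in> labels" shows "\<exists>e :: ('a \<Rightarrow> 'k) \<Rightarrow> 'v. inj_on e (carrier (model t))"
proof -
  obtain e :: "('a \<Rightarrow> 'k) \<Rightarrow> 'k" where "inj_on e (supported_on (fst t))"
    using inj_on_supported_on[OF infinite_UNIV_char_0 orbit_finite[OF labels_orbits[OF assms]]] by blast
  then have "inj_on (emb \<circ> e) (carrier (model t))"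
    using comp_inj_on[of e _ emb] inj_on_subset[OF emb] by simp
  then show ?thesis by blast
qed

lemma num_iso_labels:
  fixes P :: "('a \<times> 'a \<Rightarrow> 'k, 'v) module \<Rightarrow> bool"
  assumes "\<And>M t. t \<in> labels \<Longrightarrow> module_isomorphic J (model t) M \<Longrightarrow> P M \<longleftrightarrow> Q t"
  shows "finite ({M \<in> simple_modules J. P M} // module_iso J)"
    and "num_iso J {M \<in> simple_modules J. P M} = card {t \<in> labels. Q t}"
proof -
  have simple: "model t \<in> simple_modules J" if "t \<in> labels" for t
    by (rule simple_orbit_model[OF labels_orbits[OF that] \<rho>_char])
  note * = simple_modules_quotient[of labels J model P Q, OF finite_labels labels_cover simple
      labels_distinct labels_realized assms]
  show "finite ({M \<in> simple_modules J. P M} // module_iso J)"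
    "num_iso J {M \<in> simple_modules J. P M} = card {t \<in> labels. Q t}"
    by (rule *; assumption)+
qed

lemma simple_modules_count:
  fixes S :: "('a \<times> 'a \<Rightarrow> 'k, 'v) module set"
  assumes S: "S = simple_modules J"
  shows "finite (S // module_iso J)"
    and "num_iso J {M \<in> S. has_dim J M 1} = p * (p - 1)"
    and "num_iso J {M \<in> S. has_dim J M 1 \<and> indicator_FS J M = 1} = p + 1"
    and "num_iso J {M \<in> S. has_dim J M p} = card free"
    and "num_iso J {M \<in> S. has_dim J M p \<and> indicator_FS J M = 1} = card {X \<in> free. real_orbit X}"
proof -
  let ?pair = "\<lambda>(x, j). ({x}, j :: nat)" and ?zero = "\<lambda>X. (X, 0 :: nat)"
  have dim: "has_dim J M d \<longleftrightarrow> d = card (fst t)"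
    if "t \<in> labels" "module_isomorphic J (model t) M" for t d and M :: "('a \<times> 'a \<Rightarrow> 'k, 'v) module"
    by (rule has_dim_orbit_model[OF labels_orbits[OF that(1)] \<rho>_char that(2)])
  have ind: "indicator_FS J M = 1 \<longleftrightarrow> indicator_label t"
    if "t \<in> labels" "module_isomorphic J (model t) M" for t and M :: "('a \<times> 'a \<Rightarrow> 'k, 'v) module"
    using indicator_labels[OF that] by simp
  have inj: "inj_on ?pair A" "inj_on ?zero B" for A B
    by (auto simp: inj_on_def)
  show "finite (S // module_iso J)"
    using num_iso_labels(1)[of "\<lambda>_. True" "\<lambda>_. True"] by (simp add: S)
  have 1: "{t \<in> labels. 1 = card (fst t)} = ?pair ` (fixed \<times> {..<p})"
  proof (intro equalityI subsetI)
    fix t assume "t \<in> {t \<in> labels. 1 = card (fst t)}"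
    then show "t \<in> ?pair ` (fixed \<times> {..<p})" using labels_card_orbit[of t] by simp
  next
    fix t assume t: "t \<in> ?pair ` (fixed \<times> {..<p})"
    then have "t \<in> labels" by (simp add: labels_def)
    then show "t \<in> {t \<in> labels. 1 = card (fst t)}" using labels_card_orbit[of t] t by simp
  qed
  show "num_iso J {M \<in> S. has_dim J M 1} = p * (p - 1)"
  proof -
    have "num_iso J {M \<in> S. has_dim J M 1} = card {t \<in> labels. 1 = card (fst t)}"
      unfolding S by (rule num_iso_labels(2)) (rule dim)
    also have "\<dots> = p * (p - 1)"
      unfolding 1 card_image[OF inj(1)] by (simp add: card_cartesian_product card_fixed')
    finally show ?thesis .
  qed
  have 2: "{t \<in> labels. p = card (fst t)} = ?zero ` free"
  proof (intro equalityI subsetI)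
    fix t assume "t \<in> {t \<in> labels. p = card (fst t)}"
    then have "t \<in> labels" "card (fst t) = p" by blast+
    then show "t \<in> ?zero ` free" using labels_card_orbit[of t] by blast
  next
    fix t assume t: "t \<in> ?zero ` free"
    then have tl: "t \<in> labels" by (simp add: labels_def)
    have "card (fst t) = p" using labels_card_orbit[OF tl] t by blast
    with tl show "t \<in> {t \<in> labels. p = card (fst t)}" by blast
  qed
  show "num_iso J {M \<in> S. has_dim J M p} = card free"
  proof -
    have "num_iso J {M \<in> S. has_dim J M p} = card {t \<in> labels. p = card (fst t)}"
      unfolding S by (rule num_iso_labels(2)) (rule dim)
    also have "\<dots> = card free" unfolding 2 by (rule card_image[OF inj(2)])
    finally show ?thesis .
  qed
  have "{t \<in> labels. 1 = card (fst t) \<and> indicator_label t}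
      = {t \<in> ?pair ` (fixed \<times> {..<p}). indicator_label t}"
    using 1 by blast
  \<comment> \<open>The trivial character at 1 and all p characters at \<tau>, which makes p + 1
    labels.\<close>
  also have "\<dots> = insert ({\<one>}, 0) (Pair {\<tau>} ` {..<p})"
    (is "_ = ?R")
  proof -
    have "{x} \<notin> free" if "x \<in> fixed" for x using free_not_fixed[of "{x}" x] that by auto
    then show ?thesis
      using one_fixed \<tau>_in_fixed prime_gt_0_nat[OF prime_p]
      by (auto simp: indicator_label_def image_iff)
  qed
  finally have 3: "{t \<in> labels. 1 = card (fst t) \<and> indicator_label t} = ?R" .
  have "({\<one>}, 0) \<notin> Pair {\<tau>} ` {..<p}" using \<tau>_inv by auto
  then have "card ?R = p + 1" by (simp add: card_image inj_on_def)
  moreover have "num_iso J {M \<in> S. has_dim J M 1 \<and> indicator_FS J M = 1}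
      = card {t \<in> labels. 1 = card (fst t) \<and> indicator_label t}"
    unfolding S by (rule num_iso_labels(2)) (simp only: dim ind)
  ultimately show "num_iso J {M \<in> S. has_dim J M 1 \<and> indicator_FS J M = 1} = p + 1"
    by (simp only: 3)
  have "{t \<in> labels. p = card (fst t) \<and> indicator_label t} = {t \<in> ?zero ` free. indicator_label t}"
    using 2 by blast
  also have "\<dots> = ?zero ` {X \<in> free. real_orbit X}" by (auto simp: indicator_label_def)
  finally have 4: "card {t \<in> labels. p = card (fst t) \<and> indicator_label t} = card {X \<in> free. real_orbit X}"
    by (simp add: card_image[OF inj(2)])
  have "num_iso J {M \<in> S. has_dim J M p \<and> indicator_FS J M = 1}
      = card {t \<in> labels. p = card (fst t) \<and> indicator_label t}"
    unfolding S by (rule num_iso_labels(2)) (simp only: dim ind)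
  then show "num_iso J {M \<in> S. has_dim J M p \<and> indicator_FS J M = 1} = card {X \<in> free. real_orbit X}"
    by (simp only: 4)
qed

end

end

section \<open>The symmetric group of prime degree\<close>

locale symmetric_prime =
  fixes p :: nat
  assumes prime_p: "prime p" and odd_p: "odd p"
begin

abbreviation "L \<equiv> sym_group p"
abbreviation "F \<equiv> cyc_sub p"
abbreviation "G \<equiv> point_stab p"

definition c :: "nat \<Rightarrow> nat" where "c = cycle_of_list [1..<Suc p]"

text \<open>\<open>pt\<close> identifies the points with the residues mod \<open>p\<close>, the fixed point \<open>p\<close> of \<open>G\<close> being \<open>0\<close>.\<close>

definition pt :: "nat \<Rightarrow> nat" where "pt k = (c ^^ k) p"

lemma p_gt: "p > 2"
  using prime_p odd_p prime_ge_2_nat[of p] by (cases "p = 2") auto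

lemma L_simps [simp]: "carrier L = {g. g permutes {1..p}}" "mult L = (\<circ>)" "one L = id"
  by (simp_all add: sym_group_def)

lemma c_permutes: "c permutes {1..p}"
proof -
  have "set [1..<Suc p] = {1..p}" by auto
  then show ?thesis unfolding c_def using cycle_permutes[of "[1..<Suc p]"] by simp
qed

lemma c_pow_permutes: "(c ^^ k) permutes {1..p}"
proof (induction k)
  case 0
  show ?case by (simp only: funpow.simps(1) permutes_id)
next
  case (Suc k)
  show ?case unfolding funpow_Suc_right by (rule permutes_compose[OF c_permutes Suc])
qed

lemma c_pow_outside: "i \<notin> {1..p} \<Longrightarrow> (c ^^ k) i = i"
  using c_pow_permutes permutes_not_in by metis

text \<open>Powers of c act as rotations of the list of points, whose entry at index i is i + 1;
  hence the shift by \<open>Suc\<close> on both sides.\<close>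

lemma c_funpow:
  assumes "i < p" shows "(c ^^ k) (Suc i) = Suc ((i + k) mod p)"
proof -
  let ?cs = "[1..<Suc p]"
  have "map (c ^^ k) ?cs ! i = rotate k ?cs ! i"
    unfolding c_def by (subst cyclic_rotation) auto
  moreover have "map (c ^^ k) ?cs ! i = (c ^^ k) (Suc i)"
    using assms by (simp add: nth_upt del: upt_Suc)
  moreover have "rotate k ?cs ! i = Suc ((i + k) mod p)"
    using assms p_gt by (simp add: nth_rotate nth_upt add.commute del: upt_Suc)
  ultimately show ?thesis by simp
qed

lemma pt_eq: "pt k = Suc ((p - 1 + k) mod p)"
  using c_funpow[of "p - 1" k] p_gt by (simp add: pt_def)

lemma pt_in: "pt k \<in> {1..p}"
  using p_gt mod_less_divisor[of p "p - 1 + k"] unfolding pt_eq by (simp add: Suc_leI del: mod_less_divisor)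

text \<open>So \<open>pt k\<close> is the representative of k mod p taken from {1..p}, and any point
  may be written as \<open>pt\<close> of itself.\<close>

lemma pt_id: "i \<in> {1..p} \<Longrightarrow> pt i = i"
  by (cases "i = p") (auto simp: pt_eq le_mod_geq mod_add_self1 Suc_diff_le)

lemma pt_0: "pt 0 = p"
  by (simp add: pt_def)

lemma c_pt: "(c ^^ j) (pt k) = pt (j + k)"
  by (simp add: pt_def funpow_add)

lemma pt_eq_iff: "pt k = pt l \<longleftrightarrow> k mod p = l mod p"
proof -
  have "(p - 1 + k) mod p = (p - 1 + l) mod p \<longleftrightarrow> k mod p = l mod p"
  proof
    assume "(p - 1 + k) mod p = (p - 1 + l) mod p"
    then have "((p - 1 + k) mod p + 1) mod p = ((p - 1 + l) mod p + 1) mod p" by simp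
    then have "(p - 1 + k + 1) mod p = (p - 1 + l + 1) mod p" by (simp only: mod_add_left_eq)
    then show "k mod p = l mod p" using p_gt by simp
  next
    assume "k mod p = l mod p"
    then show "(p - 1 + k) mod p = (p - 1 + l) mod p" by (metis mod_add_right_eq)
  qed
  then show ?thesis by (simp add: pt_eq)
qed

lemma c_pow_eqI: "k mod p = l mod p \<Longrightarrow> c ^^ k = c ^^ l"
proof
  fix i assume kl: "k mod p = l mod p"
  show "(c ^^ k) i = (c ^^ l) i"
  proof (cases "i \<in> {1..p}")
    case True
    have "(k + i) mod p = (l + i) mod p" using kl by (metis mod_add_left_eq)
    then have "(c ^^ k) (pt i) = (c ^^ l) (pt i)" by (simp add: c_pt pt_eq_iff)
    then show ?thesis by (simp add: pt_id[OF True])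
  qed (simp add: c_pow_outside)
qed

lemma c_pow_eq_iff: "c ^^ k = c ^^ l \<longleftrightarrow> k mod p = l mod p"
proof
  assume "c ^^ k = c ^^ l"
  then have "pt k = pt l" by (simp only: pt_def)
  then show "k mod p = l mod p" by (simp only: pt_eq_iff)
qed (rule c_pow_eqI)

lemma nat_pow_L: "a [^]\<^bsub>L\<^esub> (k :: nat) = a ^^ k"
  by (induction k) (simp_all add: nat_pow_def funpow_Suc_right del: funpow.simps(2))

lemma finite_L: "finite (carrier L)"
  by (simp add: finite_permutations)

lemma F_eq: "F = (\<lambda>k. c ^^ k) ` {..<p}"
proof -
  interpret L: group L by (rule sym_group_is_group)
  have "c \<in> carrier L" using c_permutes by simp
  from L.generate_pow_on_finite_carrier[OF finite_L this]
  have "F = {c ^^ k | k. k \<in> UNIV}" by (simp add: cyc_sub_def c_def nat_pow_L)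
  moreover have "c ^^ k \<in> (\<lambda>k. c ^^ k) ` {..<p}" for k
    using c_pow_eqI[of k "k mod p"] p_gt by (intro image_eqI[of _ _ "k mod p"]) auto
  ultimately show ?thesis by auto
qed

lemma c_pow_in_F: "c ^^ k \<in> F"
  unfolding F_eq using c_pow_eqI[of k "k mod p"] p_gt by (intro image_eqI[of _ _ "k mod p"]) auto

lemma F_cases: "a \<in> F \<Longrightarrow> \<exists>k. a = c ^^ k"
  unfolding F_eq by blast

lemma G_iff: "g \<in> G \<longleftrightarrow> g permutes {1..p} \<and> g p = p"
  by (simp add: point_stab_def)

lemma factorization_L: "factorization L F G"
proof -
  interpret L: group L by (rule sym_group_is_group)
  show ?thesis
  proof (intro factorization.intro factorization_axioms.intro)
    show "group L" by (rule sym_group_is_group)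
    show "subgroup F L"
      unfolding cyc_sub_def using c_permutes by (intro L.generate_is_subgroup) (simp add: c_def)
    show "subgroup G L"
    proof (rule L.subgroupI)
      show "G \<subseteq> carrier L" by (auto simp: G_iff)
      have "id \<in> G" using permutes_id by (simp add: G_iff)
      then show "G \<noteq> {}" by blast
      show "g \<otimes>\<^bsub>L\<^esub> h \<in> G" if "g \<in> G" "h \<in> G" for g h
        using that by (auto simp: G_iff permutes_compose)
      show "inv\<^bsub>L\<^esub> g \<in> G" if "g \<in> G" for g
        using that by (auto simp: G_iff permutes_inv permutes_inv_eq)
    qed
    show "finite (carrier L)" by (rule finite_L)
    show "\<exists>a\<in>F. \<exists>x\<in>G. l = a \<otimes>\<^bsub>L\<^esub> x" if l: "l \<in> carrier L" for l
    proof (intro bexI)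
      \<comment> \<open>The power of c that agrees with l at p: the exponent j sends p to
        \<open>pt j\<close>, which is j for j in {1..p}. The other factor then fixes p.\<close>
      let ?a = "c ^^ (l p)"
      have lp: "l p \<in> {1..p}" using l permutes_in_image[of l "{1..p}" p] p_gt by simp
      show "?a \<in> F" by (rule c_pow_in_F)
      show "l = ?a \<otimes>\<^bsub>L\<^esub> (inv' ?a \<circ> l)"
        using permutes_inv_o(1)[OF c_pow_permutes] by (simp add: o_assoc)
      have "?a p = l p" using pt_id[OF lp] by (simp add: pt_def)
      then have "inv' ?a (l p) = p" using permutes_inv_eq[OF c_pow_permutes] by simp
      then show "inv' ?a \<circ> l \<in> G"
        using l permutes_compose[OF _ permutes_inv[OF c_pow_permutes], of l] by (simp add: G_iff)
    qed
    show "F \<inter> G = {\<one>\<^bsub>L\<^esub>}"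
    proof
      show "F \<inter> G \<subseteq> {\<one>\<^bsub>L\<^esub>}"
      proof
        fix a assume "a \<in> F \<inter> G"
        then obtain k where k: "a = c ^^ k" "(c ^^ k) p = p" using F_cases by (auto simp: G_iff)
        then have "pt k = pt 0" by (simp add: pt_def)
        then show "a \<in> {\<one>\<^bsub>L\<^esub>}" using c_pow_eqI[of k 0] k(1) by (simp add: pt_eq_iff)
      qed
      show "{\<one>\<^bsub>L\<^esub>} \<subseteq> F \<inter> G"
        using c_pow_in_F[of 0] permutes_id by (simp add: G_iff)
    qed
  qed
qed

sublocale factorization L F G by (rule factorization_L)

section \<open>Multiplications mod p as the elements of G normalizing F\<close>

definition aff :: "nat \<Rightarrow> nat \<Rightarrow> nat" where "aff v i = (if i \<in> {1..p} then pt (v * i) else i)"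

lemma aff_outside: "i \<notin> {1..p} \<Longrightarrow> aff v i = i"
  unfolding aff_def by (rule if_not_P)

lemma aff_pt: "aff v (pt m) = pt (v * m)"
proof -
  have "pt (pt m) = pt m" by (rule pt_id[OF pt_in])
  then have "pt m mod p = m mod p" by (simp add: pt_eq_iff)
  then have "(v * pt m) mod p = (v * m) mod p" by (metis mod_mult_right_eq)
  then show ?thesis using pt_in[of m] by (simp add: aff_def pt_eq_iff)
qed

lemma eq_on_pt:
  assumes "\<And>i. i \<notin> {1..p} \<Longrightarrow> f i = g i" and "\<And>m. f (pt m) = g (pt m)"
  shows "f = g"
proof
  fix i show "f i = g i"
    using assms(1)[of i] assms(2)[of i] by (cases "i \<in> {1..p}") (simp_all add: pt_id)
qed

lemma aff_permutes:
  assumes v: "v \<in> {1..<p}" shows "aff v permutes {1..p}"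
proof (rule bij_imp_permutes)
  have "\<not> p dvd v" using v dvd_imp_le[of p v] by auto
  then have cop: "coprime v p" using prime_imp_coprime[OF prime_p, of v] by (simp add: coprime_commute)
  have "inj_on (aff v) {1..p}"
  proof (rule inj_onI)
    fix i j assume i: "i \<in> {1..p}" and j: "j \<in> {1..p}" and "aff v i = aff v j"
    then have "[v * i = v * j] (mod p)" by (simp add: aff_def pt_eq_iff cong_def)
    then have "i mod p = j mod p" using cong_mult_lcancel_nat[OF cop] by (simp add: cong_def)
    then show "i = j" using i j pt_id by (metis pt_eq_iff)
  qed
  moreover have "aff v ` {1..p} \<subseteq> {1..p}" using pt_in by (auto simp: aff_def simp del: atLeastAtMost_iff)
  ultimately show "bij_betw (aff v) {1..p} {1..p}"
    using endo_inj_surj[of "{1..p}" "aff v"] by (simp add: bij_betw_def)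
qed (auto simp: aff_def)

lemma aff_in_G: "v \<in> {1..<p} \<Longrightarrow> aff v \<in> G"
  using aff_permutes aff_pt[of v 0] by (simp add: G_iff pt_0)

text \<open>Distributivity: multiplication by v turns the shift by k into the shift by v k. Read as
  a factorization, this yields both actions at once.\<close>

lemma aff_c_pow: "aff v \<circ> c ^^ k = c ^^ (v * k) \<circ> aff v"
proof (rule eq_on_pt)
  show "(aff v \<circ> c ^^ k) i = (c ^^ (v * k) \<circ> aff v) i" if "i \<notin> {1..p}" for i
    using that by (simp add: aff_outside c_pow_outside del: atLeastAtMost_iff)
  show "(aff v \<circ> c ^^ k) (pt m) = (c ^^ (v * k) \<circ> aff v) (pt m)" for m
    by (simp add: c_pt aff_pt algebra_simps)
qed

lemma aff_rt_lt:
  assumes "v \<in> {1..<p}"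
  shows "rt (aff v) (c ^^ k) = aff v" and "lt (aff v) (c ^^ k) = c ^^ (v * k)"
  using rt_lt_eqI[OF c_pow_in_F[of "v * k"] aff_in_G[OF assms], of "aff v" "c ^^ k"] aff_c_pow[of v k]
  by simp_all

definition normalizing :: "(nat \<Rightarrow> nat) set" where "normalizing = {x \<in> G. \<forall>a\<in>F. rt x a = x}"

text \<open>Let c^u be the F-part of x c. As c fixes x under \<open>rt\<close>, x c = c^u x; since x
  fixes the residue 0, induction shows that x is multiplication by u, and the value at 1 is the
  representative of u.\<close>

lemma normalizing_aff:
  assumes x: "x \<in> normalizing"
  shows "x 1 \<in> {1..<p}" and "x = aff (x 1)"
proof -
  have xG: "x \<in> G" and xF: "\<And>a. a \<in> F \<Longrightarrow> rt x a = x" using x by (auto simp: normalizing_def)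
  have perm: "x permutes {1..p}" and xp: "x p = p" using xG by (auto simp: G_iff)
  have cF: "c \<in> F" using c_pow_in_F[of 1] by simp
  obtain u where u: "lt x c = c ^^ u" using F_cases[OF lt_closed[OF xG cF]] by blast
  have xc: "x \<circ> c = c ^^ u \<circ> x" using lt_rt[OF xG cF] xF[OF cF] u by simp
  have xpt: "x (pt k) = pt (u * k)" for k
  proof (induction k)
    case (Suc k)
    have "x (pt (Suc k)) = (x \<circ> c) (pt k)" using c_pt[of 1 k] by simp
    also have "\<dots> = (c ^^ u) (pt (u * k))" unfolding xc using Suc by simp
    finally show ?case by (simp add: c_pt)
  qed (simp add: pt_0 xp)
  have x1: "x 1 = pt u" using xpt[of 1] pt_id[of 1] p_gt by simp
  have "x 1 \<noteq> p"
  proof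
    assume "x 1 = p"
    then have "x 1 = x p" using xp by simp
    from injD[OF permutes_inj[OF perm] this] show False using p_gt by simp
  qed
  then show "x 1 \<in> {1..<p}" using pt_in[of u] x1 by simp
  show "x = aff (x 1)"
  proof (rule eq_on_pt)
    show "x i = aff (x 1) i" if "i \<notin> {1..p}" for i
      by (simp only: permutes_not_in[OF perm that] aff_outside[OF that])
    fix m
    have "pt (pt u) = pt u" by (rule pt_id[OF pt_in])
    then have "pt u mod p = u mod p" by (simp add: pt_eq_iff)
    then have "(pt u * m) mod p = (u * m) mod p" by (metis mod_mult_left_eq)
    then show "x (pt m) = aff (x 1) (pt m)" unfolding x1 xpt aff_pt pt_eq_iff by simp
  qed
qed

lemma aff_normalizing: "v \<in> {1..<p} \<Longrightarrow> aff v \<in> normalizing"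
  using aff_in_G[of v] aff_rt_lt(1)[of v] F_cases unfolding normalizing_def by fastforce

lemma aff_1: "v \<in> {1..<p} \<Longrightarrow> aff v 1 = v"
  using pt_id[of v] by (auto simp: aff_def)

lemma card_normalizing: "card normalizing = p - 1"
proof -
  have "bij_betw (\<lambda>x. x 1) normalizing {1..<p}"
    by (rule bij_betwI[of _ _ _ aff]) (use normalizing_aff aff_normalizing aff_1 in auto)
  from bij_betw_same_card[OF this] show ?thesis by simp
qed

lemma aff_comp: "aff v \<circ> aff w = aff (v * w)"
  by (rule eq_on_pt) (simp_all add: aff_outside aff_pt mult.assoc del: atLeastAtMost_iff)

lemma aff_one: "aff 1 = id"
  by (rule eq_on_pt) (simp_all add: aff_outside aff_pt del: atLeastAtMost_iff One_nat_def)

lemma aff_cong: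
  assumes "v mod p = w mod p" shows "aff v = aff w"
proof (rule eq_on_pt)
  show "aff v (pt m) = aff w (pt m)" for m
    unfolding aff_pt pt_eq_iff using assms by (metis mod_mult_left_eq)
qed (simp add: aff_outside del: atLeastAtMost_iff)

lemma inv_eq_self_iff:
  assumes "x permutes {1..p}" shows "inv\<^bsub>L\<^esub> x = x \<longleftrightarrow> x \<circ> x = id"
  using inv_equality[of x x] l_inv[of x] assms by auto

lemma square_mod:
  assumes v: "v \<in> {1..<p}" shows "(v * v) mod p = 1 mod p \<longleftrightarrow> v = 1 \<or> v = p - 1"
proof -
  have "(v * v) mod p = 1 mod p \<longleftrightarrow> p dvd v * v - 1"
    using v by (intro mod_eq_dvd_iff_nat) simp
  also have "v * v - 1 = (v - 1) * (v + 1)" using v by (simp add: algebra_simps)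
  also have "p dvd (v - 1) * (v + 1) \<longleftrightarrow> p dvd v - 1 \<or> p dvd v + 1"
    by (rule prime_dvd_mult_iff[OF prime_p])
  also have "p dvd v - 1 \<longleftrightarrow> v = 1"
    using v dvd_imp_le[of p "v - 1"] by (cases "v = 1") auto
  also have "p dvd v + 1 \<longleftrightarrow> v = p - 1" using v dvd_imp_le[of p "v + 1"] by auto
  finally show ?thesis .
qed

lemma card_point_stab: "card G = fact (p - 1)"
proof -
  have "G = {g. g permutes {1..p - 1}}"
  proof (intro equalityI subsetI)
    fix g assume "g \<in> G"
    then have g: "g permutes {1..p}" "g p = p" by (auto simp: G_iff)
    have "g i = i" if "i \<in> {1..p} - {1..p - 1}" for i
    proof -
      have "i = p" using that by auto
      then show ?thesis using g by simp
    qed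
    then show "g \<in> {g. g permutes {1..p - 1}}" using permutes_superset[OF g(1)] by blast
  next
    fix g assume "g \<in> {g. g permutes {1..p - 1}}"
    then have g: "g permutes {1..p - 1}" by simp
    then have "g permutes {1..p}" by (rule permutes_subset) auto
    moreover have "g p = p" using permutes_not_in[OF g, of p] p_gt by simp
    ultimately show "g \<in> G" by (simp add: G_iff)
  qed
  then show ?thesis using card_permutations[of "{1..p - 1}" "p - 1"] by simp
qed

text \<open>The role of \<tau> is taken by multiplication by -1, written as p - 1.\<close>

lemma prime_factorization_L:
  fixes \<zeta> :: "'k::field_char_0"
  assumes "\<zeta> ^ p = 1" "\<zeta> \<noteq> 1"
  shows "prime_factorization L F G p c (aff (p - 1)) \<zeta>"
proof -
  have v: "p - 1 \<in> {1..<p}" using p_gt by auto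
  have sq: "((p - 1) * (p - 1)) mod p = 1 mod p" using square_mod[OF v] by simp
  show ?thesis
  proof (intro prime_factorization.intro prime_factorization_axioms.intro factorization_L prime_p odd_p
      card_point_stab assms)
    show "card F = p"
      unfolding F_eq by (subst card_image) (auto simp: inj_on_def c_pow_eq_iff)
    show "c \<in> carrier L" using c_permutes by simp
    show "F = (\<lambda>i. c [^]\<^bsub>L\<^esub> i) ` {..<p}" using F_eq by (simp add: nat_pow_L)
    show "c [^]\<^bsub>L\<^esub> p = \<one>\<^bsub>L\<^esub>" using c_pow_eqI[of p 0] by (simp add: nat_pow_L)
    show "card {x \<in> G. \<forall>a\<in>F. rt x a = x} = p - 1"
      using card_normalizing by (simp add: normalizing_def)
    show "aff (p - 1) \<in> G" by (rule aff_in_G[OF v])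
    show "rt (aff (p - 1)) a = aff (p - 1)" if "a \<in> F" for a
      using aff_rt_lt(1)[OF v] F_cases[OF that] by auto
    show "aff (p - 1) \<noteq> \<one>\<^bsub>L\<^esub>"
      using aff_1[OF v] p_gt by auto
    show "inv\<^bsub>L\<^esub> (aff (p - 1)) = aff (p - 1)"
      unfolding inv_eq_self_iff[OF aff_permutes[OF v]] aff_comp using aff_cong[OF sq] aff_one by simp
    show "lt (aff (p - 1)) a = inv\<^bsub>L\<^esub> a" if "a \<in> F" for a
    proof -
      obtain k where k: "a = c ^^ k" using F_cases[OF \<open>a \<in> F\<close>] by blast
      have "(p - 1) * k + k = p * k" using p_gt by (simp add: algebra_simps)
      then have "c ^^ ((p - 1) * k) \<circ> c ^^ k = c ^^ (p * k)" by (metis funpow_add)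
      also have "\<dots> = id" using c_pow_eqI[of "p * k" 0] by simp
      finally have "inv\<^bsub>L\<^esub> a = c ^^ ((p - 1) * k)"
        using inv_equality[of "c ^^ ((p - 1) * k)" a] c_pow_permutes k by simp
      then show ?thesis using aff_rt_lt(2)[OF v] k by simp
    qed
    show "x = \<one>\<^bsub>L\<^esub> \<or> x = aff (p - 1)"
      if "x \<in> G" "\<And>a. a \<in> F \<Longrightarrow> rt x a = x" "inv\<^bsub>L\<^esub> x = x" for x
    proof -
      have xN: "x \<in> normalizing" using that(1,2) by (simp add: normalizing_def)
      let ?v = "x 1"
      note v = normalizing_aff[OF xN]
      \<comment> \<open>By \<open>normalizing_aff\<close>, x is multiplication by \<open>?v\<close>;
        evaluating its square at 1 gives \<open>?v * ?v\<close> = 1 mod p.\<close>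
      have "aff (?v * ?v) = id"
        using that(1,3) inv_eq_self_iff[of x] aff_comp[of ?v ?v] v(2) by (simp add: G_iff)
      then have "pt (?v * ?v) = pt 1" using aff_pt[of "?v * ?v" 1] by simp
      then have "?v = 1 \<or> ?v = p - 1" using square_mod[OF v(1)] by (simp add: pt_eq_iff)
      then show ?thesis using v(2) aff_one by (metis L_simps(3))
    qed
  qed
qed

end

text \<open>A root of 1 + X + ... + X^(p - 1), the quotient of X^p - 1 by X - 1; it differs from 1
  because the value at 1 is p, which is nonzero in characteristic 0.\<close>

lemma exists_root_of_unity:
  assumes "p > 1"
  shows "\<exists>\<zeta> :: 'k::{alg_closed_field, field_char_0}. \<zeta> ^ p = 1 \<and> \<zeta> \<noteq> 1"
proof -
  obtain \<zeta> :: 'k where z: "(\<Sum>k\<le>p - 1. 1 * \<zeta> ^ k) = 0"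
    using alg_closed[of "p - 1" "\<lambda>_. 1 :: 'k"] assms by auto
  have s: "(\<Sum>k<p. \<zeta> ^ k) = 0"
    using z assms lessThan_Suc_atMost[of "p - 1"] by simp
  have "\<zeta> ^ p - 1 = (\<zeta> - 1) * (\<Sum>k<p. \<zeta> ^ k)" by (rule power_diff_1_eq)
  moreover have "\<zeta> \<noteq> 1" using s assms by auto
  ultimately show ?thesis using s by auto
qed

theorem theorem5p3:
  fixes p :: nat
    and J :: "((nat \<Rightarrow> nat) \<times> (nat \<Rightarrow> nat), 'k::{alg_closed_field, field_char_0}) based_hopf"
    and S :: "((nat \<Rightarrow> nat) \<times> (nat \<Rightarrow> nat) \<Rightarrow> 'k, 'v) module set"
    and emb :: "'k \<Rightarrow> 'v"
  assumes "prime p" and "odd p"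
    and "J = J_hopf p"
    and "S = simple_modules J"
    and "inj emb"
  shows "real (m1 p) = (real (i_num p) - 1) / real p - 1
    \<and> real (m0 p + m1 p) = (real p - 1) * ((fact (p - 2) - 1) / real p)
    \<and> finite (S // module_iso J)
    \<and> num_iso J {M \<in> S. has_dim J M 1} = p * (p - 1)
    \<and> num_iso J {M \<in> S. has_dim J M 1 \<and> indicator_FS J M = 1} = p + 1
    \<and> (\<forall>M\<in>S. has_dim J M 1 \<longrightarrow> indicator_FS J M = 1 \<or> indicator_FS J M = 0)
    \<and> (\<forall>M\<in>S. has_dim J M 1 \<or> has_dim J M p)
    \<and> real (num_iso J {M \<in> S. has_dim J M p}) = (real p - 1) * ((fact (p - 2) - 1) / real p)
    \<and> num_iso J {M \<in> S. has_dim J M p \<and> indicator_FS J M = 1} = m1 p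
    \<and> (\<forall>M\<in>S. has_dim J M p \<longrightarrow> indicator_FS J M = 1 \<or> indicator_FS J M = 0)"
proof -
  interpret symmetric_prime p using assms(1,2) by unfold_locales
  obtain \<zeta> :: 'k where "\<zeta> ^ p = 1" "\<zeta> \<noteq> 1"
    using exists_root_of_unity[of p] p_gt by auto
  then interpret P: prime_factorization L F G p c "aff (p - 1)" \<zeta>
    by (rule prime_factorization_L)
  have J: "J = bismash L F G" using assms(3) by (simp add: J_hopf_def)
  note S = assms(4)[unfolded J]
  have m1: "m1 p = card {X \<in> P.free. P.real_orbit X}"
    by (simp add: m1_def P.real_orbit_def)
  have "m0 p + m1 p = card ({X \<in> P.free. \<not> P.real_orbit X} \<union> {X \<in> P.free. P.real_orbit X})"
    unfolding m1 using P.finite_free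
    by (subst card_Un_disjoint) (auto simp: m0_def P.real_orbit_def)
  also have "{X \<in> P.free. \<not> P.real_orbit X} \<union> {X \<in> P.free. P.real_orbit X} = P.free" by blast
  finally have m: "m0 p + m1 p = card P.free" .
  have "i_num p = p * m1 p + 1 + p"
    using P.card_involutions unfolding i_num_def m1 .
  then have 1: "real (m1 p) = (real (i_num p) - 1) / real p - 1"
    using p_gt by (simp add: field_simps)
  \<comment> \<open>Splitting off the factor p - 1 turns the orbit equation into p |free| = (p - 1)
    ((p - 2)! - 1).\<close>
  have "fact (p - 1) = (p - 1) * fact (p - 2)"
    using p_gt fact_reduce[of "p - 1", where ?'a = nat] by (simp add: numeral_2_eq_2)
  then have "p - 1 + p * card P.free = (p - 1) * fact (p - 2)" using P.card_free by simp
  then have "real (p - 1) + real p * real (card P.free) = real (p - 1) * fact (p - 2)"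
    by (metis of_nat_add of_nat_fact of_nat_mult)
  then have 2: "real (card P.free) = (real p - 1) * ((fact (p - 2) - 1) / real p)"
    using p_gt by (simp add: field_simps of_nat_diff)
  show ?thesis
    using 1 2 m m1 P.simple_modules_count[OF assms(5) S] P.simple_modules_dimension
    unfolding J S by auto
qed

end
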